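(* Let $f(z)=\sum_{j=0}^\infty a_jz^j$ be a transcendental entire function and let $f_\omega(z)=\sum_{j=0}^\infty \chi_j(\omega)a_jz^j$ be the associated random entire function. Then, for any $\epsilon>0$, there exists a set $E$ of finite logarithmic measure such that, for every $a\in\mathbb C$, for almost every $\omega\in\Omega$ there exists $r_0=r_0(\omega,\epsilon,a)$ such that, for all $r>r_0$ with $r\notin E$: (i) if $f_\omega$ is a Gaussian entire function, then $$\log \sigma (r, f) \leq N(r,a, f_\omega)+\Big(\frac32+\epsilon\Big) \log \log\sigma (r, f);$$ (ii) if $f_\omega$ is a Rademacher entire function, then $$\log \sigma (r, f) \leq N(r,a, f_\omega)+ \Big(\Big(\frac{eC_0}6\Big)^6 +\epsilon \Big) \bigl(\log \log \sigma(r,f)\bigr)^6,$$ where $C_0$ is the absolute constant described in the context; (iii) if $f_\omega$ is a Steinhaus entire function, then $$\log\sigma(r, f) \leq N(r,a, f_\omega)+(2+\epsilon) \log \log\sigma(r,f).$$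
   Context: $(\Omega,\mathcal F,\mu)$ is a probability space and $\chi_j$ ($j=0,1,2,\dots$) are independent, identically distributed complex-valued random variables on it. $f_\omega$ is called a Gaussian entire function if the $\chi_j$ are standard complex Gaussian (density $e^{-|z|^2}/\pi$ with respect to Lebesgue measure on $\mathbb C$); a Rademacher entire function if the $\chi_j$ take the values $\pm1$ with probability $1/2$ each; a Steinhaus entire function if $\chi_j=e^{2\pi i\theta_j}$ with $\theta_j$ independent and uniformly distributed on $[0,1]$. In each case $f_\omega$ is entire for almost every $\omega$. "Almost every $\omega$" means all $\omega$ outside a $\mu$-null set. $\sigma(r,f)=\bigl(\sum_{j=0}^\infty|a_j|^2r^{2j}\bigr)^{1/2}$. For $a\in\mathbb C$, $N(r,a,f_\omega)=N(r,0,f_\omega-a)$, where for an entire function $h\not\equiv0$, $N(r,0,h)=\int_0^r\frac{n(t,0,h)-n(0,0,h)}{t}\,dt+n(0,0,h)\log r$, $n(t,0,h)$ is the number of zeros (with multiplicity) of $h$ in the disk of center $0$ and radius $t$, and $n(0,0,h)$ is the multiplicity of the zero at the origin. A set $E\subset(0,\infty)$ has finite logarithmic measure if $\int_E\frac{dr}{r}<\infty$. The constant $C_0$: it is the absolute constant in the following theorem of Nazarov, Nishry and Sodin (log-integrability). For every Rademacher entire function $f_\omega$, every $r>0$ and every $p\ge1$, $$\mathrm{E}\left(\int_{0}^{2\pi}\bigl|\log|\hat f_\omega(re^{i\theta})|\bigr|^p \,\frac{d\theta}{2\pi}\right)\leq (C_0p)^{6p},$$ where $\hat f_\omega(re^{i\theta})=f_\omega(re^{i\theta})/\sigma(r,f)$.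 *)

theory Defs
  imports "HOL-Probability.Probability" "HOL-Complex_Analysis.Complex_Analysis"
begin

definition transcendental_entire :: "(complex \<Rightarrow> complex) \<Rightarrow> bool" where
  "transcendental_entire f \<longleftrightarrow>
     f holomorphic_on UNIV \<and> \<not> (\<exists>p :: complex poly. \<forall>z. f z = poly p z)"

text \<open>\<open>\<sigma>(r, f)\<close> for the function with Taylor coefficients \<open>a\<close>.\<close>

definition sigma_series :: "(nat \<Rightarrow> complex) \<Rightarrow> real \<Rightarrow> real" where
  "sigma_series a r = sqrt (\<Sum>j. (cmod (a j))\<^sup>2 * r ^ (2 * j))"

definition random_series ::
  "(nat \<Rightarrow> complex) \<Rightarrow> (nat \<Rightarrow> 'w \<Rightarrow> complex) \<Rightarrow> 'w \<Rightarrow> complex \<Rightarrow> complex" where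
  "random_series a X \<omega> z = (\<Sum>j. X j \<omega> * a j * z ^ j)"

definition gaussian_sequence :: "'w measure \<Rightarrow> (nat \<Rightarrow> 'w \<Rightarrow> complex) \<Rightarrow> bool" where
  "gaussian_sequence M X \<longleftrightarrow>
     prob_space.indep_vars M (\<lambda>_. borel) X UNIV \<and>
     (\<forall>j. distributed M lborel (X j) (\<lambda>z. ennreal (exp (- (cmod z)\<^sup>2) / pi)))"

definition rademacher_sequence :: "'w measure \<Rightarrow> (nat \<Rightarrow> 'w \<Rightarrow> complex) \<Rightarrow> bool" where
  "rademacher_sequence M X \<longleftrightarrow>
     prob_space.indep_vars M (\<lambda>_. borel) X UNIV \<and>
     (\<forall>j. measure M {\<omega> \<in> space M. X j \<omega> = 1} = 1 / 2 \<and>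
          measure M {\<omega> \<in> space M. X j \<omega> = - 1} = 1 / 2)"

definition steinhaus_sequence :: "'w measure \<Rightarrow> (nat \<Rightarrow> 'w \<Rightarrow> complex) \<Rightarrow> bool" where
  "steinhaus_sequence M X \<longleftrightarrow>
     (\<exists>\<theta> :: nat \<Rightarrow> 'w \<Rightarrow> real.
        prob_space.indep_vars M (\<lambda>_. borel) \<theta> UNIV \<and>
        (\<forall>j. distr M lborel (\<theta> j) = uniform_measure lborel {0..1}) \<and>
        (\<forall>j. \<forall>\<omega>\<in>space M. X j \<omega> = exp (2 * of_real pi * \<i> * of_real (\<theta> j \<omega>))))"

text \<open>
  Zeros in the closed disk of radius \<open>t\<close>, with multiplicity, for an entire \<open>h\<close> that is not
  identically zero. At \<open>t = 0\<close> this is the multiplicity of the zero at the origin, i.e. the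
  quantity \<open>n(0, 0, h)\<close>. Counting in the open disk instead would change the integrand below
  only for countably many \<open>t\<close>.
\<close>

definition zero_count :: "real \<Rightarrow> (complex \<Rightarrow> complex) \<Rightarrow> int" where
  "zero_count t h = (\<Sum>z\<in>{z \<in> cball 0 t. h z = 0}. zorder h z)"

definition integrated_zero_count :: "real \<Rightarrow> (complex \<Rightarrow> complex) \<Rightarrow> real" where
  "integrated_zero_count r h =
     integral {0..r} (\<lambda>t. of_int (zero_count t h - zero_count 0 h) / t)
       + of_int (zero_count 0 h) * ln r"

definition integrated_count :: "real \<Rightarrow> complex \<Rightarrow> (complex \<Rightarrow> complex) \<Rightarrow> real" where
  "integrated_count r c f = integrated_zero_count r (\<lambda>z. f z - c)"

definition finite_log_measure :: "real set \<Rightarrow> bool" where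
  "finite_log_measure E \<longleftrightarrow>
     E \<subseteq> {0<..} \<and> E \<in> sets lebesgue \<and> (\<integral>\<^sup>+r\<in>E. ennreal (1 / r) \<partial>lebesgue) < \<infinity>"

text \<open>
  \<open>C\<close> is admissible in the log-integrability theorem of Nazarov, Nishry and Sodin: the bound
  holds for every Rademacher entire function on \<open>M\<close>. Both sides of the bound depend only on the
  law of the sequence, so admissibility is the same on every probability space that carries a
  Rademacher sequence. The integrals are taken in \<open>[0, \<infinity>]\<close>, so that the bound includes
  integrability; the zero function is excluded because the normalisation divides by \<open>\<sigma>\<close>. The
  convention \<open>ln 0 = 0\<close> is harmless: almost surely the random function is not identically zero
  and so has finitely many zeros on the circle.
\<close>

definition log_integrability_constant :: "'w measure \<Rightarrow> real \<Rightarrow> bool" where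
  "log_integrability_constant M C \<longleftrightarrow> C > 0 \<and>
     (\<forall>(b :: nat \<Rightarrow> complex) X (r :: real) (p :: real).
        rademacher_sequence M X \<longrightarrow> (\<forall>z. summable (\<lambda>j. b j * z ^ j)) \<longrightarrow> (\<exists>j. b j \<noteq> 0) \<longrightarrow>
        r > 0 \<longrightarrow> p \<ge> 1 \<longrightarrow>
        (\<integral>\<^sup>+\<omega>. (\<integral>\<^sup>+\<theta>\<in>{0..2 * pi}.
            ennreal (\<bar>ln (cmod (random_series b X \<omega> (of_real r * cis \<theta>) / of_real (sigma_series b r)))\<bar>
                       powr p / (2 * pi)) \<partial>lborel) \<partial>M)
          \<le> ennreal ((C * p) powr (6 * p)))"

end

theory Submission imports Defs begin

text \<open>
  Write \<open>T(r) = ln \<sigma>(r, f)\<close>, which increases continuously to infinity. By Jensen's formula,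
  \<open>N(r, c, f\<^sub>\<omega>)\<close> is the mean of \<open>ln |f\<^sub>\<omega> - c|\<close> over the circle of radius \<open>r\<close>, up to a constant
  that depends on \<open>\<omega>\<close> and \<open>c\<close> but not on \<open>r\<close>. Such a constant is absorbed by the \<open>\<epsilon>\<close>, so what has
  to be shown is that almost surely the mean of \<open>ln (|f\<^sub>\<omega> - c| / \<sigma>(r, f))\<close> is not much below zero
  for all large \<open>r\<close> at once.

  Countably many radii are enough. Since \<open>N\<close> is nondecreasing in \<open>r\<close>, it suffices to control,
  for every \<open>n\<close>, the smallest admissible radius \<open>\<rho>\<^sub>n\<close> with \<open>n \<le> T(\<rho>\<^sub>n) \<le> n + 1\<close>: passing from \<open>\<rho>\<^sub>n\<close> to another
  admissible radius of the same level loses at most 1 (\<open>first_good_radii\<close>). If the deficit at \<open>\<rho>\<^sub>n\<close>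
  exceeds \<open>t(n)\<close> only with probabilities that are summable over \<open>n\<close>, the Borel--Cantelli lemma gives
  \<open>T(r) \<le> N(r, c, f\<^sub>\<omega>) + t(T(r)) + O(1)\<close> (\<open>AE_lower_bound\<close>). The two kinds of sequences differ
  in how the probabilities are estimated.

  Gaussian and Steinhaus variables have small ball probabilities \<open>P(|X\<^sub>j - w| \<le> s) \<le> K s\<close>, uniformly in
  \<open>w\<close>. Conditioning on all variables but one, \<open>P(|f\<^sub>\<omega>(z) - c| \<le> s |a\<^sub>m z\<^sup>m|) \<le> K s\<close> for every \<open>m\<close>
  (\<open>sum_small_ball\<close>), so negative moments of order \<open>p < 1\<close> of \<open>|f\<^sub>\<omega> - c| / |a\<^sub>m z\<^sup>m|\<close> are bounded, and a
  deficit of more than \<open>q ln n\<close> below \<open>ln |a\<^sub>m z\<^sup>m|\<close> has probability at most a constant times \<open>n\<close> to the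
  power \<open>-pq\<close>. This is summable for \<open>q > 1\<close> once \<open>p > 1/q\<close>, so \<open>q\<close> may be taken arbitrarily close to 1. It remains to
  compare \<open>\<sigma>\<close> with its largest term. By Markov's inequality for the weights \<open>|a\<^sub>j|\<^sup>2 r\<^sup>2\<^sup>j\<close>, half of
  \<open>\<sigma>\<^sup>2\<close> is carried by the indices up to twice their weighted mean, and that mean is a logarithmic
  derivative of \<open>\<sigma>\<^sup>2\<close>, hence at most a power \<open>1 + \<delta>\<close> of \<open>ln \<sigma>\<^sup>2\<close> outside a set \<open>E\<close> of finite logarithmic
  measure (\<open>exceptional_set\<close>). The comparison costs \<open>(1 + \<delta>)/2 \<sqdot> ln T(r)\<close>, which together with \<open>q ln n\<close>
  gives the constant \<open>3/2 + \<epsilon>\<close> for both kinds of variables (\<open>small_ball_lower_bound\<close>).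

  Rademacher variables are controlled by the log-integrability theorem. With \<open>\<tau> = (\<beta> ln n)\<^sup>6\<close>, a
  deficit larger than \<open>\<tau>\<close> has probability at most the \<open>p\<close>-th moment bound divided by \<open>\<tau>\<close> to the power \<open>p\<close>,
  and the choice \<open>p = \<beta> ln n / (e C\<^sub>0)\<close> makes this \<open>n\<close> to the power \<open>-6\<beta> / (e C\<^sub>0)\<close>, which is summable
  exactly when \<open>\<beta> > e C\<^sub>0 / 6\<close> (\<open>rademacher_lower_bound\<close>). A value \<open>c \<noteq> 0\<close> reduces to \<open>c = 0\<close>: as \<open>X\<^sub>0\<^sup>2 = 1\<close>,
  on the event \<open>X\<^sub>0 = s\<close> the function \<open>f\<^sub>\<omega> - c\<close> is the Rademacher series whose constant coefficient is
  \<open>a\<^sub>0 - s c\<close> (\<open>rademacher_lower_bound_shifted\<close>).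
\<close>

section \<open>Averages over the angle\<close>

definition uniform_angle :: "real measure" where
  "uniform_angle = density lborel (\<lambda>\<theta>. ennreal (indicator {0..2 * pi} \<theta> / (2 * pi)))"

lemma sets_uniform_angle [measurable_cong, simp]: "sets uniform_angle = sets borel"
  by (simp add: uniform_angle_def)

lemma space_uniform_angle [simp]: "space uniform_angle = UNIV"
  by (simp add: uniform_angle_def)

lemma nn_integral_uniform_angle:
  assumes [measurable]: "u \<in> borel_measurable borel"
  shows "(\<integral>\<^sup>+\<theta>. u \<theta> \<partial>uniform_angle) = (\<integral>\<^sup>+\<theta>\<in>{0..2 * pi}. u \<theta> * ennreal (1 / (2 * pi)) \<partial>lborel)"
  unfolding uniform_angle_def
  by (subst nn_integral_density) (auto intro!: nn_integral_cong simp: indicator_def mult.commute)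

lemma prob_space_uniform_angle: "prob_space uniform_angle"
proof
  have "emeasure uniform_angle (space uniform_angle) = (\<integral>\<^sup>+\<theta>. 1 \<partial>uniform_angle)"
    by simp
  also have "\<dots> = (\<integral>\<^sup>+\<theta>. ennreal (1 / (2 * pi)) * indicator {0..2 * pi} \<theta> \<partial>lborel)"
    by (subst nn_integral_uniform_angle) (auto intro!: nn_integral_cong)
  also have "\<dots> = ennreal (1 / (2 * pi)) * ennreal (2 * pi)"
    by (subst nn_integral_cmult_indicator) auto
  also have "\<dots> = 1"
    by (simp flip: ennreal_mult')
  finally show "emeasure uniform_angle (space uniform_angle) = 1" .
qed

interpretation uniform_angle: prob_space uniform_angle
  by (rule prob_space_uniform_angle)

lemma prob_uniform_angle_UNIV [simp]: "measure uniform_angle UNIV = 1"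
  using uniform_angle.prob_space by simp

lemma continuous_uniform_angle:
  fixes u :: "real \<Rightarrow> real"
  assumes cont: "continuous_on UNIV u" and int: "(u has_integral 2 * pi * I) {0..2 * pi}"
  shows "integrable uniform_angle u" "(\<integral>\<theta>. u \<theta> \<partial>uniform_angle) = I"
proof -
  have [measurable]: "u \<in> borel_measurable borel"
    using cont by (rule borel_measurable_continuous_onI)
  have si: "set_integrable lborel {0..2 * pi} u"
    unfolding set_integrable_def
    by (rule borel_integrable_compact) (auto intro: continuous_on_subset[OF cont])
  have eq: "(\<lambda>\<theta>. (indicator {0..2 * pi} \<theta> / (2 * pi)) *\<^sub>R u \<theta>)
      = (\<lambda>\<theta>. (1 / (2 * pi)) * (indicator {0..2 * pi} \<theta> *\<^sub>R u \<theta>))"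
    by auto
  show "integrable uniform_angle u"
    unfolding uniform_angle_def
    by (subst integrable_density) (use si in \<open>auto simp: eq set_integrable_def intro!: AE_I2\<close>)
  have "(\<integral>\<theta>. u \<theta> \<partial>uniform_angle) = (1 / (2 * pi)) * (LINT \<theta>:{0..2 * pi}|lborel. u \<theta>)"
    unfolding uniform_angle_def set_lebesgue_integral_def
    by (subst integral_density) (auto simp: eq intro!: AE_I2)
  also have "(LINT \<theta>:{0..2 * pi}|lborel. u \<theta>) = 2 * pi * I"
    using set_borel_integral_eq_integral(2)[OF si] int by (simp add: integral_unique)
  finally show "(\<integral>\<theta>. u \<theta> \<partial>uniform_angle) = I" by simp
qed

text \<open>
  The mean value property is Cauchy's integral formula at the centre of the circle.
\<close>
lemma has_integral_circle_holomorphic: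
  fixes f :: "complex \<Rightarrow> complex"
  assumes "f holomorphic_on ball 0 R" "0 < r" "r < R"
  shows "((\<lambda>\<theta>. f (of_real r * cis \<theta>)) has_integral 2 * pi * f 0) {0..2 * pi}"
proof -
  have "f holomorphic_on cball 0 r"
    using assms by (auto intro: holomorphic_on_subset)
  hence "((\<lambda>u. f u / (u - 0)) has_contour_integral 2 * of_real pi * \<i> * f 0) (circlepath 0 r)"
    using assms by (intro Cauchy_integral_circlepath_simple) auto
  hence "((\<lambda>t. f (0 + r * cis t) / (0 + r * cis t - 0) * r * \<i> * cis t) has_integral
      2 * of_real pi * \<i> * f 0) {0..2 * pi}"
    unfolding circlepath_def by (subst (asm) has_contour_integral_part_circlepath_iff) auto
  hence "((\<lambda>t. (f (0 + r * cis t) / (0 + r * cis t - 0) * r * \<i> * cis t) * (1 / \<i>)) has_integral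
      2 * of_real pi * \<i> * f 0 * (1 / \<i>)) {0..2 * pi}"
    by (rule has_integral_mult_left)
  thus ?thesis
    using assms by (simp add: field_simps)
qed

text \<open>
  On a disk a zero-free function has a holomorphic logarithm, and \<open>ln |g|\<close> is its real part.
\<close>
lemma circle_mean_ln_nonzero:
  assumes hol: "g holomorphic_on ball 0 R" and nz: "\<And>z. z \<in> ball 0 R \<Longrightarrow> g z \<noteq> 0"
    and r: "0 < r" "r < R"
  shows "integrable uniform_angle (\<lambda>\<theta>. ln (cmod (g (of_real r * cis \<theta>))))"
    and "(\<integral>\<theta>. ln (cmod (g (of_real r * cis \<theta>))) \<partial>uniform_angle) = ln (cmod (g 0))"
proof -
  obtain L where L: "L holomorphic_on ball 0 R" "\<And>z. z \<in> ball 0 R \<Longrightarrow> g z = exp (L z)"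
    using contractible_imp_holomorphic_log[OF hol _ nz] convex_imp_contractible[of "ball 0 R"] by auto
  have ln_eq: "ln (cmod (g z)) = Re (L z)" if "z \<in> ball 0 R" for z
    using L(2)[OF that] by simp
  have in_ball: "of_real r * cis \<theta> \<in> ball 0 R" for \<theta>
    using r by (simp add: norm_mult)
  have "((\<lambda>\<theta>. Re (L (of_real r * cis \<theta>))) has_integral Re (2 * pi * L 0)) {0..2 * pi}"
    using has_integral_linear[OF has_integral_circle_holomorphic[OF L(1) r] bounded_linear_Re]
    by (simp add: o_def)
  hence int: "((\<lambda>\<theta>. ln (cmod (g (of_real r * cis \<theta>)))) has_integral 2 * pi * ln (cmod (g 0))) {0..2 * pi}"
    using r unfolding ln_eq[OF in_ball] by (simp add: ln_eq)
  have "continuous_on UNIV (\<lambda>\<theta>. g (of_real r * cis \<theta>))"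
    using in_ball by (intro continuous_on_compose2[OF holomorphic_on_imp_continuous_on[OF hol]] continuous_intros) auto
  hence "continuous_on UNIV (\<lambda>\<theta>. ln (cmod (g (of_real r * cis \<theta>))))"
    using nz in_ball by (intro continuous_intros) auto
  from continuous_uniform_angle[OF this int]
  show "integrable uniform_angle (\<lambda>\<theta>. ln (cmod (g (of_real r * cis \<theta>))))"
    and "(\<integral>\<theta>. ln (cmod (g (of_real r * cis \<theta>))) \<partial>uniform_angle) = ln (cmod (g 0))" .
qed

section \<open>Small balls and negative moments\<close>

definition negative_moment_bound :: "real \<Rightarrow> real \<Rightarrow> real" where
  "negative_moment_bound K p = 1 + K * 2 powr p / (1 - 2 powr (p - 1))"

text \<open>
  On the event that \<open>Y\<close> lies between two consecutive powers of \<open>1/2\<close>, say above the power with exponent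
  \<open>k + 1\<close> and at most the one with exponent \<open>k\<close>, the integrand is at most \<open>2\<close> to the power \<open>(k + 1) p\<close>, while
  the event has probability at most \<open>K\<close> times \<open>2\<close> to the power \<open>-k\<close>. For \<open>p < 1\<close> the products form a
  convergent geometric series; its sum, and 1 for the values \<open>Y \<ge> 1\<close>, make up the bound.
\<close>
lemma (in prob_space) negative_moment_le:
  fixes Y :: "'a \<Rightarrow> real"
  assumes [measurable]: "random_variable borel Y" and Y0: "\<And>\<omega>. Y \<omega> \<ge> 0"
    and small: "\<And>s. s > 0 \<Longrightarrow> prob {\<omega>\<in>space M. Y \<omega> \<le> s} \<le> K * s"
    and p: "0 < p" "p < 1"
  shows "(\<integral>\<^sup>+\<omega>. ennreal (Y \<omega> powr (- p)) \<partial>M) \<le> ennreal (negative_moment_bound K p)"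
proof -
  define S where "S k = {\<omega>\<in>space M. Y \<omega> \<le> (1/2) ^ k}" for k :: nat
  have [measurable]: "S k \<in> sets M" for k unfolding S_def by measurable
  define c where "c k = (2 powr ((real k + 1) * p) :: real)" for k :: nat
  have K0: "K \<ge> 0" using order.trans[OF measure_nonneg small[of 1]] by simp
  have ptw: "ennreal (Y \<omega> powr (- p)) \<le> 1 + (\<Sum>k. ennreal (c k) * indicator (S k) \<omega>)"
    if w: "\<omega> \<in> space M" for \<omega>
  proof (cases "Y \<omega> = 0 \<or> Y \<omega> \<ge> 1")
    case True
    hence "Y \<omega> powr (- p) \<le> 1"
      using p powr_mono2'[of "- p" 1 "Y \<omega>"] by auto
    hence "ennreal (Y \<omega> powr (- p)) \<le> 1 + 0" by simp
    also have "\<dots> \<le> 1 + (\<Sum>k. ennreal (c k) * indicator (S k) \<omega>)"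
      by (intro add_mono) auto
    finally show ?thesis .
  next
    case False
    with Y0[of \<omega>] have y: "0 < Y \<omega>" "Y \<omega> < 1" by auto
    define x where "x = - log 2 (Y \<omega>)"
    have x: "x > 0" "Y \<omega> = 2 powr (- x)" using y by (auto simp: x_def)
    define k where "k = nat \<lfloor>x\<rfloor>"
    have k: "real k \<le> x" "x \<le> real k + 1" using x by (auto simp: k_def)
    have "Y \<omega> \<le> 2 powr (- real k)" using k by (simp add: x(2))
    also have "\<dots> = (1/2) ^ k" by (simp add: powr_minus_divide powr_realpow power_one_over)
    finally have inS: "\<omega> \<in> S k" using w by (simp add: S_def)
    have "Y \<omega> powr (- p) = 2 powr (x * p)" by (simp add: x(2) powr_powr)
    also have "\<dots> \<le> c k" unfolding c_def using k p by (intro powr_mono mult_right_mono) auto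
    finally have "ennreal (Y \<omega> powr (- p)) \<le> ennreal (c k) * indicator (S k) \<omega>"
      using inS by (simp add: ennreal_leI)
    also have "\<dots> \<le> (\<Sum>k. ennreal (c k) * indicator (S k) \<omega>)"
      using sum_le_suminf[OF summableI, of "{k}" "\<lambda>k. ennreal (c k) * indicator (S k) \<omega>"]
      by (simp del: sum_mult_indicator)
    also have "\<dots> \<le> 1 + \<dots>" by (simp add: add_increasing)
    finally show ?thesis .
  qed
  define q where "q = (2 powr (p - 1) :: real)"
  have q: "0 < q" "q < 1"
    using p powr_less_mono[of "p - 1" 0 2] by (auto simp: q_def)
  have ck: "c k * (K * (1/2) ^ k) = K * 2 powr p * q ^ k" for k
  proof -
    have "q ^ k = 2 powr ((p - 1) * real k)" by (simp add: q_def powr_powr flip: powr_realpow)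
    moreover have "(1/2 :: real) ^ k = 2 powr (- real k)"
      by (simp add: powr_minus_divide powr_realpow power_one_over)
    ultimately have "2 powr p * q ^ k = c k * (1/2) ^ k"
      by (simp add: c_def algebra_simps flip: powr_add)
    thus ?thesis by simp
  qed
  have "(\<integral>\<^sup>+\<omega>. ennreal (Y \<omega> powr (- p)) \<partial>M) \<le> (\<integral>\<^sup>+\<omega>. 1 + (\<Sum>k. ennreal (c k) * indicator (S k) \<omega>) \<partial>M)"
    by (intro nn_integral_mono ptw)
  also have "\<dots> = 1 + (\<Sum>k. ennreal (c k) * emeasure M (S k))"
    by (subst nn_integral_add) (auto simp: nn_integral_suminf nn_integral_cmult emeasure_space_1)
  also have "\<dots> \<le> 1 + (\<Sum>k. ennreal (K * 2 powr p * q ^ k))"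
  proof (intro add_left_mono suminf_le)
    fix k
    have "ennreal (c k) * emeasure M (S k) \<le> ennreal (c k) * ennreal (K * (1/2) ^ k)"
      using small[of "(1/2) ^ k"] unfolding S_def
      by (intro mult_left_mono) (auto simp: emeasure_eq_measure intro!: ennreal_leI)
    also have "\<dots> = ennreal (K * 2 powr p * q ^ k)"
      using K0 by (subst ennreal_mult'[symmetric]) (auto simp: ck[symmetric] c_def)
    finally show "ennreal (c k) * emeasure M (S k) \<le> ennreal (K * 2 powr p * q ^ k)" .
  qed auto
  also have "(\<Sum>k. ennreal (K * 2 powr p * q ^ k)) = ennreal (K * 2 powr p * (1 / (1 - q)))"
    using q K0 geometric_sums[of q] by (intro suminf_ennreal_eq sums_mult) auto
  also have "1 + \<dots> = ennreal (negative_moment_bound K p)"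
    using q K0 by (simp add: negative_moment_bound_def q_def[symmetric] flip: ennreal_plus ennreal_1)
  finally show ?thesis .
qed

lemma (in prob_space) small_ball_AE_pos:
  fixes Y :: "'a \<Rightarrow> real"
  assumes [measurable]: "random_variable borel Y" and Y0: "\<And>\<omega>. Y \<omega> \<ge> 0"
    and small: "\<And>s. s > 0 \<Longrightarrow> prob {\<omega>\<in>space M. Y \<omega> \<le> s} \<le> K * s"
  shows "AE \<omega> in M. Y \<omega> > 0"
proof -
  have K0: "K \<ge> 0" using order.trans[OF measure_nonneg small[of 1]] by simp
  have "prob {\<omega>\<in>space M. \<not> Y \<omega> > 0} \<le> 0 + e" if "e > 0" for e
  proof -
    have "prob {\<omega>\<in>space M. \<not> Y \<omega> > 0} \<le> prob {\<omega>\<in>space M. Y \<omega> \<le> e / (K + 1)}"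
      using K0 that by (intro finite_measure_mono) (auto intro: order.trans[of _ 0])
    also have "\<dots> \<le> K * (e / (K + 1))" using K0 that by (intro small) auto
    also have "\<dots> \<le> e" using K0 that by (simp add: field_simps)
    finally show ?thesis by simp
  qed
  hence "prob {\<omega>\<in>space M. \<not> Y \<omega> > 0} = 0"
    using field_le_epsilon[of "prob {\<omega>\<in>space M. \<not> Y \<omega> > 0}" 0] measure_nonneg[of M]
    by (meson order.antisym)
  thus ?thesis
    by (subst AE_iff_measurable[OF _ refl]) (auto simp: emeasure_eq_measure)
qed

text \<open>
  The sine is concave on \<open>[0, \<pi>]\<close>, so on \<open>[0, \<pi>/2]\<close> its graph lies above the chord.
\<close>
lemma sin_ge_chord: "x / pi \<le> sin (x / 2)" if "0 \<le> x" "x \<le> pi" for x :: real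
proof -
  have cvx: "convex_on {0..pi} (\<lambda>x. - sin x)"
    by (rule f''_ge0_imp_convex[where f' = "\<lambda>x. - cos x" and f'' = sin])
       (auto intro!: derivative_eq_intros sin_ge_zero)
  have "- sin ((1 - x / pi) *\<^sub>R 0 + (x / pi) *\<^sub>R (pi / 2)) \<le> (1 - x / pi) * (- sin 0) + (x / pi) * (- sin (pi / 2))"
    using that by (intro convex_onD[OF cvx]) auto
  thus ?thesis by simp
qed

lemma cmod_cis_diff: "cmod (cis a - cis b) = 2 * \<bar>sin ((a - b) / 2)\<bar>"
proof -
  have "(cmod (cis a - cis b))\<^sup>2 = (cos a - cos b)\<^sup>2 + (sin a - sin b)\<^sup>2"
    by (simp add: cmod_power2)
  also have "\<dots> = 2 - 2 * cos (a - b)"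
    using sin_cos_squared_add[of a] sin_cos_squared_add[of b]
    by (simp add: power2_eq_square cos_diff algebra_simps)
  also have "cos (a - b) = 1 - 2 * (sin ((a - b) / 2))\<^sup>2"
    using cos_double_sin[of "(a - b) / 2"] by (metis nonzero_mult_div_cancel_left times_divide_eq_right zero_neq_numeral)
  finally have "(cmod (cis a - cis b))\<^sup>2 = (2 * \<bar>sin ((a - b) / 2)\<bar>)\<^sup>2"
    by (simp add: power_mult_distrib)
  thus ?thesis by (rule power2_eq_imp_eq) auto
qed

lemma emeasure_uniform_angle_le:
  assumes [measurable]: "A \<in> sets borel"
  shows "emeasure uniform_angle A \<le> emeasure lborel A * ennreal (1 / (2 * pi))"
proof -
  have "emeasure uniform_angle A = (\<integral>\<^sup>+\<theta>. indicator A \<theta> \<partial>uniform_angle)" by simp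
  also have "\<dots> \<le> (\<integral>\<^sup>+\<theta>. ennreal (1 / (2 * pi)) * indicator A \<theta> \<partial>lborel)"
    by (subst nn_integral_uniform_angle) (auto intro!: nn_integral_mono simp: indicator_def)
  also have "\<dots> = emeasure lborel A * ennreal (1 / (2 * pi))"
    by (subst nn_integral_cmult_indicator) (auto simp: mult.commute)
  finally show ?thesis .
qed

text \<open>
  If \<open>cis \<theta>\<close> is within \<open>s\<close> of \<open>w\<close>, then \<open>w\<close> is within \<open>s\<close> of the unit circle, so \<open>cis \<theta>\<close> is within \<open>2s\<close> of the
  nearest point \<open>cis \<alpha>\<close> of the circle. By the chord bound for the sine, \<open>\<theta>\<close> is then within \<open>\<pi> s\<close> of
  \<open>\<alpha>\<close> modulo \<open>2\<pi>\<close>.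
\<close>
lemma uniform_angle_small_ball:
  assumes s: "s > 0"
  shows "uniform_angle.prob {\<theta>. cmod (cis \<theta> - w) \<le> s} \<le> 2 * s"
proof -
  define \<alpha> where "\<alpha> = Arg2pi w"
  have w: "w = of_real (cmod w) * cis \<alpha>" and \<alpha>: "0 \<le> \<alpha>" "\<alpha> < 2 * pi"
    using Arg2pi_eq[of w] Arg2pi_ge_0[of w] Arg2pi_lt_2pi[of w] by (simp_all add: \<alpha>_def cis_conv_exp)
  \<comment> \<open>The first interval is the proper neighbourhood of \<open>\<alpha>\<close>; the others are its wrap-around at \<open>0\<close> and \<open>2\<pi>\<close>.\<close>
  define I where "I = {\<alpha> - pi * s..\<alpha> + pi * s} \<union> {\<alpha> + 2 * pi - pi * s..\<alpha> + 2 * pi} \<union> {\<alpha> - 2 * pi..\<alpha> - 2 * pi + pi * s}"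
  have sub: "\<theta> \<in> I" if \<theta>: "0 \<le> \<theta>" "\<theta> \<le> 2 * pi" "cmod (cis \<theta> - w) \<le> s" for \<theta>
  proof -
    have "cmod (w - cis \<alpha>) = \<bar>cmod w - 1\<bar>"
    proof -
      have "w - cis \<alpha> = of_real (cmod w - 1) * cis \<alpha>" by (subst w) (simp add: algebra_simps)
      thus ?thesis by (metis norm_mult norm_cis norm_of_real mult.right_neutral)
    qed
    also have "\<dots> \<le> cmod (cis \<theta> - w)"
      using norm_triangle_ineq3[of "cis \<theta>" w] by simp
    finally have "cmod (cis \<theta> - cis \<alpha>) \<le> 2 * s"
      using \<theta>(3) norm_triangle_ineq[of "cis \<theta> - w" "w - cis \<alpha>"] by simp
    hence *: "\<bar>sin ((\<theta> - \<alpha>) / 2)\<bar> \<le> s" by (simp add: cmod_cis_diff)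
    define d where "d = \<bar>\<theta> - \<alpha>\<bar>"
    have d: "0 \<le> d" "d \<le> 2 * pi" using \<theta> \<alpha> by (auto simp: d_def)
    have sd: "sin (d / 2) \<le> s"
    proof (cases "\<theta> \<ge> \<alpha>")
      case True thus ?thesis using * by (simp add: d_def)
    next
      case False
      hence "d / 2 = - ((\<theta> - \<alpha>) / 2)" by (simp add: d_def field_simps)
      thus ?thesis using * by (simp only: sin_minus)
    qed
    show ?thesis
    proof (cases "d \<le> pi")
      case True
      have "d / pi \<le> s" using sin_ge_chord[OF d(1) True] sd by linarith
      hence "d \<le> pi * s" by (simp add: field_simps)
      thus ?thesis by (auto simp: I_def d_def)
    next
      case False
      have "(2 * pi - d) / pi \<le> sin ((2 * pi - d) / 2)" using False d by (intro sin_ge_chord) auto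
      also have "(2 * pi - d) / 2 = pi - d / 2" by (simp add: field_simps)
      also have "sin (pi - d / 2) = sin (d / 2)" by simp
      finally have "(2 * pi - d) / pi \<le> s" using sd by linarith
      hence "2 * pi - d \<le> pi * s" by (simp add: field_simps)
      thus ?thesis using \<theta> \<alpha> by (auto simp: I_def d_def abs_if split: if_splits)
    qed
  qed
  have [measurable]: "I \<in> sets borel" by (auto simp: I_def)
  have [measurable]: "{\<theta>. cmod (cis \<theta> - w) \<le> s} \<in> sets borel"
    by (intro borel_closed closed_Collect_le continuous_intros)
  have AE1: "AE \<theta> in uniform_angle. \<theta> \<in> {0..2 * pi}"
    unfolding uniform_angle_def by (subst AE_density) (auto simp: indicator_def)
  have "emeasure uniform_angle {\<theta>. cmod (cis \<theta> - w) \<le> s} \<le> emeasure uniform_angle I"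
    by (rule emeasure_mono_AE) (use AE1 sub in auto)
  also have "\<dots> \<le> emeasure lborel I * ennreal (1 / (2 * pi))"
    by (rule emeasure_uniform_angle_le) simp
  also have "\<dots> \<le> ennreal (4 * pi * s) * ennreal (1 / (2 * pi))"
  proof (intro mult_right_mono)
    have "emeasure lborel I \<le> emeasure lborel {\<alpha> - pi * s..\<alpha> + pi * s} +
        emeasure lborel {\<alpha> + 2 * pi - pi * s..\<alpha> + 2 * pi} + emeasure lborel {\<alpha> - 2 * pi..\<alpha> - 2 * pi + pi * s}"
      unfolding I_def by (intro order.trans[OF emeasure_subadditive] add_mono order.refl) auto
    also have "\<dots> = ennreal (4 * pi * s)"
      using s by (simp flip: ennreal_plus)
    finally show "emeasure lborel I \<le> ennreal (4 * pi * s)" .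
  qed auto
  also have "\<dots> = ennreal (2 * s)"
    using s by (simp flip: ennreal_mult')
  finally show ?thesis
    using s by (simp add: uniform_angle.emeasure_eq_measure)
qed

section \<open>Means of logarithms over circles\<close>

text \<open>
  A negative moment of a bounded function thereby gives integrability of its logarithm.
\<close>
lemma abs_ln_le_negative_power:
  fixes y :: real
  assumes "y \<ge> 0" "0 < p"
  shows "\<bar>ln y\<bar> \<le> y powr (- p) / p + y"
proof (cases "y = 0")
  case False
  with assms have y: "y > 0" by simp
  have 1: "ln y \<le> y" using ln_le_minus_one[OF y] by simp
  have "ln (y powr (- p)) \<le> y powr (- p)"
    using ln_le_minus_one[of "y powr (- p)"] y by simp
  hence 2: "- ln y \<le> y powr (- p) / p"
    using y assms by (simp add: ln_powr field_simps)
  have "0 \<le> y powr (- p) / p" using assms by simp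
  with 1 2 y show ?thesis by linarith
qed auto

text \<open>
  The zero lies on the circle of integration. Moving it inside to \<open>\<rho> u\<close> with \<open>\<rho> < 1\<close> gives mean zero,
  because \<open>|cis \<theta> - \<rho> u|\<close> is also the modulus of \<open>1 - \<rho> cnj u cis \<theta>\<close>, which has no zero in the closed disk.
  As \<open>|cis \<theta> - \<rho> u|\<close> is at least half of \<open>|cis \<theta> - u|\<close>, the logarithms are dominated by an
  integrable function, and \<open>\<rho>\<close> may tend to 1.
\<close>
lemma circle_mean_ln_on_circle:
  assumes u: "cmod u = 1"
  shows "integrable uniform_angle (\<lambda>\<theta>. ln (cmod (cis \<theta> - u)))"
    and "(\<integral>\<theta>. ln (cmod (cis \<theta> - u)) \<partial>uniform_angle) = 0"
proof -
  define Y where "Y \<theta> = cmod (cis \<theta> - u)" for \<theta>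
  have [measurable]: "Y \<in> borel_measurable borel"
    unfolding Y_def[abs_def] by (intro borel_measurable_continuous_onI continuous_intros)
  have Y0: "Y \<theta> \<ge> 0" for \<theta> by (simp add: Y_def)
  have Y2: "Y \<theta> \<le> 2" for \<theta> using norm_triangle_ineq4[of "cis \<theta>" u] u by (simp add: Y_def)
  have small: "uniform_angle.prob {\<theta>\<in>space uniform_angle. Y \<theta> \<le> s} \<le> 2 * s" if "s > 0" for s
    using uniform_angle_small_ball[OF that, of u] by (simp add: Y_def)
  have pos: "AE \<theta> in uniform_angle. Y \<theta> > 0"
    by (rule uniform_angle.small_ball_AE_pos[OF _ Y0 small]) auto
  have "(\<integral>\<^sup>+\<theta>. ennreal (Y \<theta> powr (- (1/2))) \<partial>uniform_angle) < \<infinity>"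
    by (rule le_less_trans[OF uniform_angle.negative_moment_le[OF _ Y0 small]]) auto
  hence intp: "integrable uniform_angle (\<lambda>\<theta>. Y \<theta> powr (- (1/2)))"
    by (intro integrableI_nonneg) auto
  have intl: "integrable uniform_angle (\<lambda>\<theta>. ln (Y \<theta>))"
  proof (rule Bochner_Integration.integrable_bound)
    show "integrable uniform_angle (\<lambda>\<theta>. Y \<theta> powr (- (1/2)) / (1/2) + 2)"
      using intp by auto
    show "AE \<theta> in uniform_angle. norm (ln (Y \<theta>)) \<le> norm (Y \<theta> powr (- (1/2)) / (1/2) + 2)"
    proof (intro AE_I2)
      fix \<theta>
      have "\<bar>ln (Y \<theta>)\<bar> \<le> Y \<theta> powr (- (1/2)) / (1/2) + 2"
        using abs_ln_le_negative_power[OF Y0[of \<theta>], of "1/2"] Y2[of \<theta>] by simp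
      thus "norm (ln (Y \<theta>)) \<le> norm (Y \<theta> powr (- (1/2)) / (1/2) + 2)" by simp
    qed
  qed auto
  thus "integrable uniform_angle (\<lambda>\<theta>. ln (cmod (cis \<theta> - u)))" by (simp add: Y_def)
  define \<rho> where "\<rho> n = 1 - inverse (real (Suc n))" for n
  have \<rho>: "0 \<le> \<rho> n" "\<rho> n < 1" for n by (auto simp: \<rho>_def inverse_le_1_iff)
  have \<rho>_lim: "\<rho> \<longlonglongrightarrow> 1"
    unfolding \<rho>_def[abs_def] using tendsto_diff[OF tendsto_const[of 1] LIMSEQ_inverse_real_of_nat] by simp
  define Z where "Z n \<theta> = cmod (cis \<theta> - of_real (\<rho> n) * u)" for n \<theta>
  have Z_eq: "Z n \<theta> = cmod (1 - of_real (\<rho> n) * cnj u * cis \<theta>)" for n \<theta>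
  proof -
    have "1 - of_real (\<rho> n) * cnj u * cis \<theta> = cis \<theta> * cnj (cis \<theta> - of_real (\<rho> n) * u)"
      by (simp add: algebra_simps cis_cnj cis_mult)
    thus ?thesis by (simp add: Z_def norm_mult flip: complex_cnj_diff complex_cnj_mult)
  qed
  have mean0: "(\<integral>\<theta>. ln (Z n \<theta>) \<partial>uniform_angle) = 0" for n
  proof -
    define R where "R = (if \<rho> n = 0 then 2 else 1 / \<rho> n)"
    have R: "1 < R" using \<rho>[of n] by (auto simp: R_def)
    have "(\<integral>\<theta>. ln (cmod (1 - of_real (\<rho> n) * cnj u * (of_real 1 * cis \<theta>))) \<partial>uniform_angle) =
        ln (cmod (1 - of_real (\<rho> n) * cnj u * 0))"
    proof (rule circle_mean_ln_nonzero(2)[where R = R])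
      fix z :: complex assume z: "z \<in> ball 0 R"
      have "cmod (of_real (\<rho> n) * cnj u * z) < 1"
      proof (cases "\<rho> n = 0")
        case False
        thus ?thesis using z \<rho>[of n] u by (simp add: norm_mult R_def field_simps)
      qed auto
      thus "1 - of_real (\<rho> n) * cnj u * z \<noteq> 0" by auto
    qed (use R in \<open>auto intro!: holomorphic_intros\<close>)
    thus ?thesis by (simp add: Z_eq mult.assoc)
  qed
  have half: "Y \<theta> / 2 \<le> Z n \<theta>" for n \<theta>
  proof -
    have "1 - \<rho> n \<le> Z n \<theta>"
      using norm_triangle_ineq2[of "cis \<theta>" "of_real (\<rho> n) * u"] \<rho>[of n] u by (simp add: Z_def norm_mult)
    moreover have "Y \<theta> \<le> Z n \<theta> + (1 - \<rho> n)"
    proof -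
      have "cis \<theta> - u = (cis \<theta> - of_real (\<rho> n) * u) - of_real (1 - \<rho> n) * u" by (simp add: algebra_simps)
      hence "Y \<theta> \<le> Z n \<theta> + cmod (of_real (1 - \<rho> n) * u)"
        unfolding Y_def Z_def by (metis norm_triangle_ineq4)
      also have "cmod (of_real (1 - \<rho> n) * u) = 1 - \<rho> n"
        using \<rho>[of n] u by (simp only: norm_mult norm_of_real) simp
      finally show ?thesis .
    qed
    ultimately show ?thesis by linarith
  qed
  have Zle: "Z n \<theta> \<le> 2" for n \<theta>
    using norm_triangle_ineq4[of "cis \<theta>" "of_real (\<rho> n) * u"] \<rho>[of n] u by (simp add: Z_def norm_mult)
  have [measurable]: "Z n \<in> borel_measurable borel" for n
    unfolding Z_def[abs_def] by (intro borel_measurable_continuous_onI continuous_intros)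
  have "(\<lambda>n. \<integral>\<theta>. ln (Z n \<theta>) \<partial>uniform_angle) \<longlonglongrightarrow> (\<integral>\<theta>. ln (Y \<theta>) \<partial>uniform_angle)"
  proof (rule integral_dominated_convergence[where w = "\<lambda>\<theta>. \<bar>ln (Y \<theta>)\<bar> + 2"])
    show "integrable uniform_angle (\<lambda>\<theta>. \<bar>ln (Y \<theta>)\<bar> + 2)" using intl by auto
    show "AE \<theta> in uniform_angle. (\<lambda>n. ln (Z n \<theta>)) \<longlonglongrightarrow> ln (Y \<theta>)"
      using pos
    proof eventually_elim
      case (elim \<theta>)
      have "(\<lambda>n. Z n \<theta>) \<longlonglongrightarrow> cmod (cis \<theta> - of_real 1 * u)"
        unfolding Z_def by (intro tendsto_intros \<rho>_lim)
      thus ?case using elim by (intro tendsto_ln) (auto simp: Y_def)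
    qed
    fix n
    show "AE \<theta> in uniform_angle. norm (ln (Z n \<theta>)) \<le> \<bar>ln (Y \<theta>)\<bar> + 2"
      using pos
    proof eventually_elim
      case (elim \<theta>)
      have "ln (Y \<theta> / 2) \<le> ln (Z n \<theta>)" using half[of \<theta> n] elim by simp
      moreover have "ln (Z n \<theta>) \<le> ln 2" using half[of \<theta> n] elim Zle[of n \<theta>] by simp
      moreover have "ln (2::real) \<le> 1" using ln_le_minus_one[of 2] by simp
      ultimately show ?case using elim by (simp add: ln_div)
    qed
  qed auto
  hence "(\<integral>\<theta>. ln (Y \<theta>) \<partial>uniform_angle) = 0"
    unfolding mean0 by (simp add: LIMSEQ_const_iff)
  thus "(\<integral>\<theta>. ln (cmod (cis \<theta> - u)) \<partial>uniform_angle) = 0" by (simp add: Y_def)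
qed

text \<open>
  The mean is the maximum of \<open>ln r\<close> and \<open>ln |z|\<close>. For \<open>z\<close> inside the circle, the linear factor is replaced by
  one with the same modulus on the circle and its zero at the reflected point \<open>r\<^sup>2 / cnj z\<close>.
\<close>
lemma circle_mean_ln_linear:
  assumes r: "r > 0"
  shows "integrable uniform_angle (\<lambda>\<theta>. ln (cmod (of_real r * cis \<theta> - z)))" (is ?int)
    and "(\<integral>\<theta>. ln (cmod (of_real r * cis \<theta> - z)) \<partial>uniform_angle) = (if cmod z \<le> r then ln r else ln (cmod z))" (is ?mean)
proof -
  consider "cmod z > r" | "cmod z < r" "z \<noteq> 0" | "z = 0" | "cmod z = r" by fastforce
  hence "?int \<and> ?mean"
  proof cases
    case 1
    have nz: "w - z \<noteq> 0" if "w \<in> ball 0 (cmod z)" for w using that by auto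
    have hol: "(\<lambda>w. w - z) holomorphic_on ball 0 (cmod z)" by (intro holomorphic_intros)
    show ?thesis using circle_mean_ln_nonzero[OF hol nz r 1] 1 by simp
  next
    case 2
    define R where "R = r\<^sup>2 / cmod z"
    have R: "r < R" using 2 r by (simp add: R_def field_simps power2_eq_square)
    define g where "g w = 1 - cnj z * w / of_real (r\<^sup>2)" for w
    have hol: "g holomorphic_on ball 0 R" unfolding g_def[abs_def] using r by (intro holomorphic_intros) auto
    have nz: "g w \<noteq> 0" if "w \<in> ball 0 R" for w
    proof -
      have "cmod (cnj z * w / of_real (r\<^sup>2)) < 1"
        using that r 2 by (simp add: R_def norm_mult norm_divide norm_power field_simps)
      thus ?thesis by (auto simp: g_def)
    qed
    have eq: "ln (cmod (of_real r * cis \<theta> - z)) = ln r + ln (cmod (g (of_real r * cis \<theta>)))" for \<theta>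
    proof -
      have "of_real r * g (of_real r * cis \<theta>) = of_real r - cnj z * cis \<theta>"
        using r by (simp add: g_def field_simps power2_eq_square)
      also have "\<dots> = cis \<theta> * cnj (of_real r * cis \<theta> - z)"
        by (simp add: algebra_simps cis_cnj cis_mult)
      finally have cm: "cmod (of_real r * g (of_real r * cis \<theta>)) = cmod (of_real r * cis \<theta> - z)"
        by (simp only: norm_mult norm_cis complex_mod_cnj mult_1)
      moreover have "g (of_real r * cis \<theta>) \<noteq> 0" using r R by (intro nz) (simp add: norm_mult)
      ultimately show ?thesis using r by (simp add: norm_mult ln_mult_pos flip: cm)
    qed
    show ?thesis
      using circle_mean_ln_nonzero[OF hol nz r R] 2 unfolding eq by (simp add: g_def uniform_angle.prob_space)
  next
    case 3
    thus ?thesis using r by (simp add: norm_mult uniform_angle.prob_space)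
  next
    case 4
    define u where "u = z / of_real r"
    have u: "cmod u = 1" using 4 r by (simp add: u_def norm_divide)
    have zu: "z = of_real r * u" using r by (simp add: u_def)
    have eq: "ln (cmod (of_real r * cis \<theta> - z)) = ln r + ln (cmod (cis \<theta> - u))" if "cis \<theta> \<noteq> u" for \<theta>
    proof -
      have "cmod (of_real r * cis \<theta> - z) = r * cmod (cis \<theta> - u)"
        unfolding zu using r by (simp add: norm_mult flip: right_diff_distrib)
      thus ?thesis using r that by (simp add: ln_mult_pos)
    qed
    have meas [measurable]: "(\<lambda>\<theta>. cmod (cis \<theta> - v)) \<in> borel_measurable borel"
         "(\<lambda>\<theta>. cmod (of_real r * cis \<theta> - v)) \<in> borel_measurable borel" for v
      by (intro borel_measurable_continuous_onI continuous_intros)+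
    have "AE \<theta> in uniform_angle. cmod (cis \<theta> - u) > 0"
      by (rule uniform_angle.small_ball_AE_pos[where K = 2]) (use uniform_angle_small_ball in auto)
    hence ae: "AE \<theta> in uniform_angle. ln (cmod (of_real r * cis \<theta> - z)) = ln r + ln (cmod (cis \<theta> - u))"
      by eventually_elim (use eq in auto)
    have i: "integrable uniform_angle (\<lambda>\<theta>. ln r + ln (cmod (cis \<theta> - u)))"
      using circle_mean_ln_on_circle(1)[OF u] by auto
    have ?int
      by (rule integrable_cong_AE_imp[OF i]) (use ae in \<open>auto simp: eq_commute\<close>)
    moreover have "(\<integral>\<theta>. ln (cmod (of_real r * cis \<theta> - z)) \<partial>uniform_angle) = (\<integral>\<theta>. ln r + ln (cmod (cis \<theta> - u)) \<partial>uniform_angle)"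
      by (rule integral_cong_AE) (use ae in auto)
    ultimately show ?thesis
      using circle_mean_ln_on_circle[OF u] 4 by (simp add: uniform_angle.prob_space)
  qed
  thus ?int ?mean by auto
qed

section \<open>Jensen's formula\<close>

lemma entire_finite_zeros_in_ball:
  assumes hol: "h holomorphic_on UNIV" and nz: "h w\<^sub>0 \<noteq> 0"
  shows "finite {z \<in> ball 0 R. h z = (0::complex)}"
proof (cases "h constant_on UNIV")
  case True
  hence "\<And>z. h z \<noteq> 0" using nz by (metis UNIV_I constant_on_def)
  thus ?thesis by simp
next
  case False
  have "finite {z \<in> cball 0 R. h z = 0}"
    using holomorphic_compact_finite_zeros[OF hol open_UNIV connected_UNIV compact_cball subset_UNIV False] .
  thus ?thesis by (rule rev_finite_subset) auto
qed

lemma entire_factor_zeros_in_ball: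
  fixes R :: real
  assumes hol: "h holomorphic_on UNIV" and nz: "h w\<^sub>0 \<noteq> (0::complex)"
  defines "Z \<equiv> {z \<in> ball 0 R. h z = 0}"
  obtains g where "g holomorphic_on ball 0 R" "\<And>w. w \<in> ball 0 R \<Longrightarrow> g w \<noteq> 0"
    "\<And>w. w \<in> ball 0 R \<Longrightarrow> h w = g w * (\<Prod>z\<in>Z. (w - z) ^ nat (zorder h z))"
proof -
  have fin: "finite Z" unfolding Z_def by (rule entire_finite_zeros_in_ball[OF hol nz])
  have ord: "if h z = 0 then zorder h z > 0 else zorder h z = 0" for z
    using zorder_exist_zero[OF hol open_UNIV connected_UNIV UNIV_I] nz by blast
  define P where "P w = (\<Prod>z\<in>Z. (w - z) ^ nat (zorder h z))" for w
  have holP: "P holomorphic_on A" for A unfolding P_def[abs_def] by (intro holomorphic_intros)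
  have P0: "P z = 0 \<longleftrightarrow> z \<in> Z" for z
    using fin ord by (force simp: P_def Z_def)
  have ordP: "zorder P z = zorder h z" if z: "z \<in> ball 0 R" for z
  proof (cases "z \<in> Z")
    case True
    define Q where "Q w = (\<Prod>z'\<in>Z - {z}. (w - z') ^ nat (zorder h z'))" for w
    have "zorder P z = int (nat (zorder h z))"
    proof (rule zorder_eqI[where S = UNIV and g = Q])
      show "Q holomorphic_on UNIV" unfolding Q_def[abs_def] by (intro holomorphic_intros)
      show "Q z \<noteq> 0" using fin by (auto simp: Q_def)
      show "P w = Q w * (w - z) powi int (nat (zorder h z))" for w
        unfolding P_def Q_def power_int_of_nat using fin True by (subst prod.remove[of Z z]) (auto simp: mult.commute)
    qed auto
    thus ?thesis using ord[of z] True by (auto simp: Z_def)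
  next
    case False
    hence "P z \<noteq> 0" using P0 by simp
    hence "zorder P z = 0"
      using zorder_exist_zero[OF holP open_UNIV connected_UNIV UNIV_I] by (metis UNIV_I)
    moreover have "zorder h z = 0" using ord[of z] False z by (auto simp: Z_def)
    ultimately show ?thesis by simp
  qed
  show ?thesis
  proof (rule holomorphic_zorder_factorization[of h "ball 0 R" P])
    show "h holomorphic_on ball 0 R" using hol by (rule holomorphic_on_subset) auto
    show "P z = 0 \<longleftrightarrow> h z = 0" if "z \<in> ball 0 R" for z using that by (auto simp: P0 Z_def)
  next
    fix g assume "g holomorphic_on ball 0 R" "\<And>z. z \<in> ball 0 R \<Longrightarrow> g z \<noteq> 0"
       "\<And>z. z \<in> ball 0 R \<Longrightarrow> h z = g z * P z"
    thus ?thesis using that by (auto simp: P_def)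
  qed (use ordP holP in auto)
qed

text \<open>
  Integrated over \<open>t\<close>, a zero at \<open>z \<noteq> 0\<close> contributes the integral of \<open>1/t\<close> from \<open>|z|\<close> to \<open>r\<close> for every unit of its
  multiplicity. The sum ranges over the zeros in a disk that is independent of the radius, so that
  different radii can be compared term by term.
\<close>
lemma integrated_zero_count_eq_sum:
  assumes hol: "h holomorphic_on UNIV" and nz: "h w\<^sub>0 \<noteq> (0::complex)" and t: "0 < t" "t < R"
  shows "integrated_zero_count t h = (\<Sum>z\<in>{z \<in> ball 0 R. h z = 0}.
           zorder h z * (if z = 0 then ln t else max 0 (ln t - ln (cmod z))))"
proof -
  define Z where "Z = {z \<in> ball 0 R. h z = 0}"
  have fin: "finite Z" unfolding Z_def by (rule entire_finite_zeros_in_ball[OF hol nz])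
  have zc: "zero_count x h = (\<Sum>z\<in>Z. if cmod z \<le> x then zorder h z else 0)" if "x < R" for x
  proof -
    have "{z \<in> cball 0 x. h z = 0} = {z\<in>Z. cmod z \<le> x}" using that by (auto simp: Z_def)
    thus ?thesis unfolding zero_count_def using fin by (simp add: sum.inter_filter)
  qed
  have zc0: "zero_count 0 h = (\<Sum>z\<in>Z. if z = 0 then zorder h z else 0)"
    using t by (subst zc) (auto intro!: sum.cong)
  have piece: "((\<lambda>x. if cmod z \<le> x then 1 / x else 0) has_integral max 0 (ln t - ln (cmod z))) {0..t}"
    if "z \<noteq> 0" for z :: complex
  proof (cases "cmod z \<le> t")
    case True
    have "x > 0" if "cmod z \<le> x" for x
      using that \<open>z \<noteq> 0\<close> by (meson less_le_trans zero_less_norm_iff)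
    hence "((\<lambda>x. 1 / x) has_integral (ln t - ln (cmod z))) {cmod z..t}"
      using that True by (intro fundamental_theorem_of_calculus)
        (auto intro!: derivative_eq_intros simp flip: has_real_derivative_iff_has_vector_derivative)
    hence "((\<lambda>x. if x \<in> {cmod z..t} then 1 / x else 0) has_integral (ln t - ln (cmod z))) {0..t}"
      by (subst has_integral_restrict) auto
    hence "((\<lambda>x. if cmod z \<le> x then 1 / x else 0) has_integral (ln t - ln (cmod z))) {0..t}"
      by (rule has_integral_eq[rotated]) auto
    moreover have "max 0 (ln t - ln (cmod z)) = ln t - ln (cmod z)"
      using True that t by simp
    ultimately show ?thesis by simp
  next
    case False
    have "((\<lambda>x. 0::real) has_integral 0) {0..t}" by simp
    hence "((\<lambda>x. if cmod z \<le> x then 1 / x else 0) has_integral 0) {0..t}"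
      by (rule has_integral_eq[rotated]) (use False in auto)
    moreover have "max 0 (ln t - ln (cmod z)) = 0"
      using False that t by simp
    ultimately show ?thesis by simp
  qed
  have "((\<lambda>x. \<Sum>z\<in>Z - {0}. zorder h z * (if cmod z \<le> x then 1 / x else 0)) has_integral
           (\<Sum>z\<in>Z - {0}. zorder h z * max 0 (ln t - ln (cmod z)))) {0..t}"
    using fin piece by (intro has_integral_sum has_integral_mult_right) auto
  hence "((\<lambda>x. of_int (zero_count x h - zero_count 0 h) / x) has_integral
           (\<Sum>z\<in>Z - {0}. zorder h z * max 0 (ln t - ln (cmod z)))) {0..t}"
  proof (rule has_integral_eq[rotated])
    fix x assume x: "x \<in> {0..t}"
    have "zero_count x h - zero_count 0 h = (\<Sum>z\<in>Z. (if cmod z \<le> x then zorder h z else 0) - (if z = 0 then zorder h z else 0))"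
      using x t by (subst zc, simp, subst zc0) (simp add: sum_subtractf)
    also have "\<dots> = (\<Sum>z\<in>Z - {0}. if cmod z \<le> x then zorder h z else 0)"
      using x fin by (intro sum.mono_neutral_cong_right) auto
    finally have "of_int (zero_count x h - zero_count 0 h) / x =
        (\<Sum>z\<in>Z - {0}. of_int (if cmod z \<le> x then zorder h z else 0) / x)"
      by (simp only: of_int_sum sum_divide_distrib)
    also have "\<dots> = (\<Sum>z\<in>Z - {0}. zorder h z * (if cmod z \<le> x then 1 / x else 0))"
      by (rule sum.cong) auto
    finally show "(\<Sum>z\<in>Z - {0}. zorder h z * (if cmod z \<le> x then 1 / x else 0)) = of_int (zero_count x h - zero_count 0 h) / x"
      by (rule sym)
  qed
  hence "integrated_zero_count t h = (\<Sum>z\<in>Z - {0}. zorder h z * max 0 (ln t - ln (cmod z))) + zero_count 0 h * ln t"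
    unfolding integrated_zero_count_def by (simp add: integral_unique)
  also have "(\<Sum>z\<in>Z - {0}. zorder h z * max 0 (ln t - ln (cmod z))) =
      (\<Sum>z\<in>Z. if z = 0 then 0 else zorder h z * max 0 (ln t - ln (cmod z)))"
    using fin by (intro sum.mono_neutral_cong_left) auto
  also have "zero_count 0 h * ln t = (\<Sum>z\<in>Z. if z = 0 then zorder h z * ln t else 0)"
    by (auto simp: zc0 sum_distrib_right intro!: sum.cong)
  also have "(\<Sum>z\<in>Z. if z = 0 then 0 else zorder h z * max 0 (ln t - ln (cmod z))) + \<dots> =
     (\<Sum>z\<in>Z. zorder h z * (if z = 0 then ln t else max 0 (ln t - ln (cmod z))))"
    by (subst sum.distrib[symmetric]) (auto intro!: sum.cong)
  finally show ?thesis by (simp add: Z_def)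
qed

lemma integrated_zero_count_mono:
  assumes hol: "h holomorphic_on UNIV" and nz: "h w\<^sub>0 \<noteq> (0::complex)" and st: "0 < s" "s \<le> t"
  shows "integrated_zero_count s h \<le> integrated_zero_count t h"
proof -
  have ord: "zorder h z \<ge> 0" for z
    using zorder_exist_zero[OF hol open_UNIV connected_UNIV UNIV_I, of z] nz by (metis UNIV_I order.refl order_less_imp_le)
  have "ln s \<le> ln t" using st by simp
  hence "ln s - c \<le> ln t - c" "max 0 (ln s - c) \<le> max 0 (ln t - c)" for c by (auto simp: max_def)
  thus ?thesis
    using st ord by (subst (1 2) integrated_zero_count_eq_sum[OF hol nz, of _ "t + 1"])
      (auto intro!: sum_mono mult_left_mono simp del: max.bounded_iff)
qed

lemma AE_circle_nonzero:
  assumes hol: "h holomorphic_on UNIV" and nz: "h w\<^sub>0 \<noteq> (0::complex)" and t: "0 < t"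
  shows "AE \<theta> in uniform_angle. h (of_real t * cis \<theta>) \<noteq> 0"
proof -
  define Z where "Z = {z \<in> ball 0 (t + 1). h z = 0}"
  have fin: "finite Z" unfolding Z_def by (rule entire_finite_zeros_in_ball[OF hol nz])
  have meas [measurable]: "(\<lambda>\<theta>. cmod (cis \<theta> - v)) \<in> borel_measurable borel" for v
    by (intro borel_measurable_continuous_onI continuous_intros)
  have "AE \<theta> in uniform_angle. \<forall>z\<in>Z. cmod (cis \<theta> - z / of_real t) > 0"
    using fin by (intro AE_finite_allI)
      (auto intro!: uniform_angle.small_ball_AE_pos[where K = 2] uniform_angle_small_ball simp del: zero_less_norm_iff)
  thus ?thesis
  proof eventually_elim
    case (elim \<theta>)
    show ?case
    proof
      assume "h (of_real t * cis \<theta>) = 0"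
      hence "of_real t * cis \<theta> \<in> Z" using t by (simp add: Z_def norm_mult)
      hence "cmod (cis \<theta> - of_real t * cis \<theta> / of_real t) > 0" using elim by blast
      thus False using t by simp
    qed
  qed
qed

text \<open>
  After division by the zeros in the disk a zero-free function remains, and its mean does not depend
  on the radius; this is the constant \<open>c\<close>.
\<close>
lemma circle_mean_ln_eq_sum:
  assumes hol: "h holomorphic_on UNIV" and nz: "h w\<^sub>0 \<noteq> (0::complex)"
  obtains c where "\<And>t. 0 < t \<Longrightarrow> t < R \<Longrightarrow> integrable uniform_angle (\<lambda>\<theta>. ln (cmod (h (of_real t * cis \<theta>))))"
     "\<And>t. 0 < t \<Longrightarrow> t < R \<Longrightarrow> (\<integral>\<theta>. ln (cmod (h (of_real t * cis \<theta>))) \<partial>uniform_angle) =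
       c + (\<Sum>z\<in>{z \<in> ball 0 R. h z = 0}. zorder h z * (if cmod z \<le> t then ln t else ln (cmod z)))"
proof -
  define Z where "Z = {z \<in> ball 0 R. h z = 0}"
  have fin: "finite Z" unfolding Z_def by (rule entire_finite_zeros_in_ball[OF hol nz])
  have ord: "zorder h z \<ge> 0" for z
    using zorder_exist_zero[OF hol open_UNIV connected_UNIV UNIV_I, of z] nz by (metis UNIV_I order.refl order_less_imp_le)
  obtain g where g: "g holomorphic_on ball 0 R" "\<And>w. w \<in> ball 0 R \<Longrightarrow> g w \<noteq> 0"
    "\<And>w. w \<in> ball 0 R \<Longrightarrow> h w = g w * (\<Prod>z\<in>Z. (w - z) ^ nat (zorder h z))"
    using entire_factor_zeros_in_ball[OF hol nz, of R] unfolding Z_def by blast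
  have main: "integrable uniform_angle (\<lambda>\<theta>. ln (cmod (h (of_real t * cis \<theta>)))) \<and>
      (\<integral>\<theta>. ln (cmod (h (of_real t * cis \<theta>))) \<partial>uniform_angle) =
       ln (cmod (g 0)) + (\<Sum>z\<in>Z. zorder h z * (if cmod z \<le> t then ln t else ln (cmod z)))"
    if t: "0 < t" "t < R" for t
  proof -
    define S where "S \<theta> = ln (cmod (g (of_real t * cis \<theta>))) + (\<Sum>z\<in>Z. zorder h z * ln (cmod (of_real t * cis \<theta> - z)))" for \<theta>
    have gm: "integrable uniform_angle (\<lambda>\<theta>. ln (cmod (g (of_real t * cis \<theta>))))"
      "(\<integral>\<theta>. ln (cmod (g (of_real t * cis \<theta>))) \<partial>uniform_angle) = ln (cmod (g 0))"
      by (rule circle_mean_ln_nonzero[OF g(1) _ t], rule g(2), assumption)+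
    note lm = circle_mean_ln_linear[OF t(1)]
    have int1: "integrable uniform_angle (\<lambda>\<theta>. zorder h z * ln (cmod (of_real t * cis \<theta> - z)))" for z
      by (rule integrable_mult_right) (rule lm(1))
    have int2: "integrable uniform_angle (\<lambda>\<theta>. \<Sum>z\<in>Z. zorder h z * ln (cmod (of_real t * cis \<theta> - z)))"
      by (rule Bochner_Integration.integrable_sum) (rule int1)
    have intS: "integrable uniform_angle S"
      unfolding S_def[abs_def] by (rule Bochner_Integration.integrable_add[OF gm(1) int2])
    have "(\<integral>\<theta>. S \<theta> \<partial>uniform_angle) = ln (cmod (g 0)) +
        (\<integral>\<theta>. (\<Sum>z\<in>Z. zorder h z * ln (cmod (of_real t * cis \<theta> - z))) \<partial>uniform_angle)"
      unfolding S_def[abs_def]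
      by (subst Bochner_Integration.integral_add[OF gm(1) int2], subst gm(2)) (rule refl)
    also have "(\<integral>\<theta>. (\<Sum>z\<in>Z. zorder h z * ln (cmod (of_real t * cis \<theta> - z))) \<partial>uniform_angle) =
        (\<Sum>z\<in>Z. \<integral>\<theta>. zorder h z * ln (cmod (of_real t * cis \<theta> - z)) \<partial>uniform_angle)"
      by (rule Bochner_Integration.integral_sum) (rule int1)
    also have "\<dots> = (\<Sum>z\<in>Z. zorder h z * (if cmod z \<le> t then ln t else ln (cmod z)))"
      unfolding integral_mult_right_zero lm(2) ..
    finally have meanS: "(\<integral>\<theta>. S \<theta> \<partial>uniform_angle) = ln (cmod (g 0)) + (\<Sum>z\<in>Z. zorder h z * (if cmod z \<le> t then ln t else ln (cmod z)))" .
    have meas [measurable]: "(\<lambda>\<theta>. cmod (cis \<theta> - v)) \<in> borel_measurable borel" for v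
      by (intro borel_measurable_continuous_onI continuous_intros)
    have "continuous_on UNIV h" using hol by (rule holomorphic_on_imp_continuous_on)
    hence "continuous_on UNIV (\<lambda>\<theta>. h (of_real t * cis \<theta>))"
      by (rule continuous_on_compose2) (auto intro!: continuous_intros)
    hence "continuous_on UNIV (\<lambda>\<theta>. cmod (h (of_real t * cis \<theta>)))"
      by (rule continuous_on_norm)
    hence [measurable]: "(\<lambda>\<theta>. cmod (h (of_real t * cis \<theta>))) \<in> borel_measurable borel"
      by (rule borel_measurable_continuous_onI)
    have ae: "AE \<theta> in uniform_angle. ln (cmod (h (of_real t * cis \<theta>))) = S \<theta>"
      using AE_circle_nonzero[OF hol nz t(1)]
    proof eventually_elim
      case (elim \<theta>)
      have nzz: "of_real t * cis \<theta> - z \<noteq> 0" if "z \<in> Z" for z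
        using elim that by (auto simp: Z_def)
      have ib: "of_real t * cis \<theta> \<in> ball 0 R" using t by (simp add: norm_mult)
      have "ln (cmod (h (of_real t * cis \<theta>))) = ln (cmod (g (of_real t * cis \<theta>)) *
          (\<Prod>z\<in>Z. cmod (of_real t * cis \<theta> - z) ^ nat (zorder h z)))"
        unfolding g(3)[OF ib] by (simp add: norm_mult norm_power flip: prod_norm)
      also have "\<dots> = ln (cmod (g (of_real t * cis \<theta>))) + (\<Sum>z\<in>Z. ln (cmod (of_real t * cis \<theta> - z) ^ nat (zorder h z)))"
        using nzz g(2)[OF ib] fin by (subst ln_mult_pos) (auto intro!: prod_pos ln_prod)
      also have "(\<Sum>z\<in>Z. ln (cmod (of_real t * cis \<theta> - z) ^ nat (zorder h z))) = (\<Sum>z\<in>Z. zorder h z * ln (cmod (of_real t * cis \<theta> - z)))"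
        using nzz ord by (intro sum.cong refl) (simp add: ln_realpow)
      finally show ?case by (simp add: S_def)
    qed
    have "integrable uniform_angle (\<lambda>\<theta>. ln (cmod (h (of_real t * cis \<theta>))))"
      by (rule integrable_cong_AE_imp[OF intS]) (use ae in \<open>auto simp: eq_commute\<close>)
    moreover have "(\<integral>\<theta>. ln (cmod (h (of_real t * cis \<theta>))) \<partial>uniform_angle) = (\<integral>\<theta>. S \<theta> \<partial>uniform_angle)"
      by (rule integral_cong_AE) (use ae intS in auto)
    ultimately show ?thesis using meanS by simp
  qed
  show ?thesis using main that[of "ln (cmod (g 0))"] unfolding Z_def by blast
qed

lemma integrable_ln_circle:
  assumes hol: "h holomorphic_on UNIV" and nz: "h w\<^sub>0 \<noteq> (0::complex)" and r: "0 < r"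
  shows "integrable uniform_angle (\<lambda>\<theta>. ln (cmod (h (of_real r * cis \<theta>))))"
  using circle_mean_ln_eq_sum[OF hol nz, of "r + 1"] r by (metis less_add_one)

text \<open>
  Each zero contributes to the mean and to the integrated count by amounts whose difference does not depend on
  the radius. The constant is the logarithm of the modulus of the first nonvanishing Taylor
  coefficient of \<open>h\<close>; for the growth estimates below its existence is enough.
\<close>
theorem jensen_formula:
  assumes hol: "h holomorphic_on UNIV" and nz: "h w\<^sub>0 \<noteq> (0::complex)"
  shows "\<exists>K. \<forall>r>0. integrated_zero_count r h = (\<integral>\<theta>. ln (cmod (h (of_real r * cis \<theta>))) \<partial>uniform_angle) - K"
proof -
  define D where "D r = (\<integral>\<theta>. ln (cmod (h (of_real r * cis \<theta>))) \<partial>uniform_angle) - integrated_zero_count r h" for r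
  have "D r = D 1" if r: "0 < r" for r
  proof -
    define R where "R = max 1 r + 1"
    define Z where "Z = {z \<in> ball 0 R. h z = 0}"
    have R: "1 < R" "r < R" by (auto simp: R_def)
    obtain c where c: "\<And>t. 0 < t \<Longrightarrow> t < R \<Longrightarrow> (\<integral>\<theta>. ln (cmod (h (of_real t * cis \<theta>))) \<partial>uniform_angle) =
       c + (\<Sum>z\<in>Z. zorder h z * (if cmod z \<le> t then ln t else ln (cmod z)))"
      using circle_mean_ln_eq_sum[OF hol nz, of R] unfolding Z_def by blast
    have "D t = c + (\<Sum>z\<in>Z. if z = 0 then 0 else zorder h z * ln (cmod z))" if t: "0 < t" "t < R" for t
    proof -
      have "(if cmod z \<le> t then ln t else ln (cmod z)) - (if z = 0 then ln t else max 0 (ln t - ln (cmod z)))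
          = (if z = 0 then 0 else ln (cmod z))" for z :: complex
        using t by auto
      note eq = this
      have "D t = c + (\<Sum>z\<in>Z. zorder h z * ((if cmod z \<le> t then ln t else ln (cmod z)) - (if z = 0 then ln t else max 0 (ln t - ln (cmod z)))))"
        unfolding D_def c[OF t] integrated_zero_count_eq_sum[OF hol nz t] Z_def[symmetric]
        by (simp add: right_diff_distrib sum_subtractf)
      thus ?thesis unfolding eq by (simp add: if_distrib cong: if_cong)
    qed
    thus ?thesis using R r by simp
  qed
  thus ?thesis by (intro exI[of _ "D 1"]) (force simp: D_def)
qed

section \<open>Growth of \<sigma> and the exceptional set\<close>

text \<open>
  For the weights \<open>t\<^sub>j / P\<close> the mean index is \<open>Q / P \<le> L / 2\<close>. By Markov's inequality at least half of the
  mass sits on the indices up to \<open>L\<close>, and there are at most \<open>L + 1\<close> of them.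
\<close>
lemma exists_large_term:
  fixes t :: "nat \<Rightarrow> real"
  assumes t0: "\<And>j. t j \<ge> 0" and P: "t sums P" "P > 0" and Q: "(\<lambda>j. real j * t j) sums Q"
    and L: "L > 0" "Q \<le> P * L / 2"
  shows "\<exists>m. P \<le> 2 * (L + 1) * t m"
proof (rule ccontr)
  assume "\<not> ?thesis"
  hence small: "t m < P / (2 * (L + 1))" for m
    using L by (auto simp: not_le field_simps)
  define N where "N = Suc (nat \<lfloor>L\<rfloor>)"
  have N: "real N \<le> L + 1" "L < real N" using L by (simp_all add: N_def) linarith+
  have "(\<Sum>j<N. t j) < (\<Sum>j<N. P / (2 * (L + 1)))"
    using small by (intro sum_strict_mono) (auto simp: N_def)
  also have "\<dots> = real N * (P / (2 * (L + 1)))" by simp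
  also have "\<dots> \<le> (L + 1) * (P / (2 * (L + 1)))"
    using N P L by (intro mult_right_mono) auto
  also have "\<dots> = P / 2" using L by (simp add: field_simps)
  finally have head: "(\<Sum>j<N. t j) < P / 2" .
  have "(\<lambda>j. t (j + N)) sums (P - (\<Sum>j<N. t j))"
    using P(1) by (rule sums_split_initial_segment)
  moreover have "(\<lambda>j. real (j + N) * t (j + N) / L) sums ((Q - (\<Sum>j<N. real j * t j)) / L)"
    by (intro sums_divide sums_split_initial_segment[OF Q])
  ultimately have "P - (\<Sum>j<N. t j) \<le> (Q - (\<Sum>j<N. real j * t j)) / L"
  proof (rule sums_le[rotated])
    fix j
    have "L * t (j + N) \<le> real (j + N) * t (j + N)"
      using N t0 by (intro mult_right_mono) auto
    thus "t (j + N) \<le> real (j + N) * t (j + N) / L" using L by (simp add: field_simps)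
  qed
  also have "\<dots> \<le> Q / L" using L t0 by (intro divide_right_mono) (auto intro!: sum_nonneg)
  also have "\<dots> \<le> P / 2" using L by (simp add: field_simps)
  finally show False using head by simp
qed

text \<open>
  The Taylor coefficients of an entire function. The index \<open>m\<^sub>0\<close> witnesses that \<open>\<sigma>(r)\<close> grows at least
  linearly in \<open>r\<close>.
\<close>
locale entire_coefficients =
  fixes a :: "nat \<Rightarrow> complex" and m\<^sub>0 :: nat
  assumes summable_coeff: "\<And>z. summable (\<lambda>j. a j * z ^ j)"
    and m\<^sub>0: "m\<^sub>0 \<ge> 1" "a m\<^sub>0 \<noteq> 0"
begin

text \<open>
  The square of \<open>\<sigma>\<close> as a power series in \<open>x = r\<^sup>2\<close>.
\<close>
definition energy :: "real \<Rightarrow> real" where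
  "energy x = (\<Sum>j. (cmod (a j))\<^sup>2 * x ^ j)"

definition energy_deriv :: "real \<Rightarrow> real" where
  "energy_deriv x = (\<Sum>j. diffs (\<lambda>j. (cmod (a j))\<^sup>2) j * x ^ j)"

lemma sigma_series_eq: "sigma_series a r = sqrt (energy (r\<^sup>2))"
  by (simp add: sigma_series_def energy_def power_mult)

lemma summable_energy: "summable (\<lambda>j. (cmod (a j))\<^sup>2 * x ^ j)"
proof -
  have lim: "(\<lambda>j. a j * 1 ^ j) \<longlonglongrightarrow> 0"
    by (rule summable_LIMSEQ_zero[OF summable_coeff])
  have "eventually (\<lambda>j. cmod (a j) < 1) sequentially"
    using tendstoD[OF lim, of 1] by simp
  hence ev: "eventually (\<lambda>j. norm ((cmod (a j))\<^sup>2 * \<bar>x\<bar> ^ j) \<le> cmod (a j) * \<bar>x\<bar> ^ j) sequentially"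
  proof eventually_elim
    case (elim j)
    hence "(cmod (a j))\<^sup>2 \<le> cmod (a j)" by (simp add: power2_eq_square mult_left_le)
    thus ?case by (simp add: mult_right_mono)
  qed
  have "summable (\<lambda>j. norm (a j * (of_real \<bar>x\<bar>) ^ j))"
    by (rule powser_insidea[OF summable_coeff[of "of_real (\<bar>x\<bar> + 1)"]]) auto
  hence "summable (\<lambda>j. cmod (a j) * \<bar>x\<bar> ^ j)" by (simp add: norm_mult norm_power)
  from summable_comparison_test_ev[OF ev this]
  have "summable (\<lambda>j. norm ((cmod (a j))\<^sup>2 * x ^ j))" by (simp add: abs_mult power_abs)
  thus ?thesis by (rule summable_norm_cancel)
qed

lemma has_derivative_energy: "(energy has_real_derivative energy_deriv x) (at x)"
  unfolding energy_def[abs_def] energy_deriv_def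
  by (rule termdiffs_strong_converges_everywhere[OF summable_energy])

lemma summable_energy_deriv: "summable (\<lambda>j. diffs (\<lambda>j. (cmod (a j))\<^sup>2) j * x ^ j)"
  by (rule termdiff_converges_all[OF summable_energy])

lemma continuous_energy: "continuous_on A energy"
  using has_derivative_energy DERIV_isCont continuous_at_imp_continuous_on by blast

lemma continuous_energy_deriv: "continuous_on A energy_deriv"
proof -
  have "((\<lambda>x. \<Sum>j. diffs (\<lambda>j. (cmod (a j))\<^sup>2) j * x ^ j) has_real_derivative
      (\<Sum>j. diffs (diffs (\<lambda>j. (cmod (a j))\<^sup>2)) j * x ^ j)) (at x)" for x
    by (rule termdiffs_strong_converges_everywhere[OF summable_energy_deriv])
  thus ?thesis unfolding energy_deriv_def[abs_def]
    using DERIV_isCont continuous_at_imp_continuous_on by blast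
qed

text \<open>
  Divided by \<open>energy x\<close>, this is the mean index for the weights \<open>|a\<^sub>j|\<^sup>2 x\<^sup>j\<close>.
\<close>
lemma energy_deriv_sums: "(\<lambda>j. real j * ((cmod (a j))\<^sup>2 * x ^ j)) sums (x * energy_deriv x)"
proof -
  have "(\<lambda>j. diffs (\<lambda>j. (cmod (a j))\<^sup>2) j * x ^ j) sums energy_deriv x"
    unfolding energy_deriv_def by (rule summable_sums[OF summable_energy_deriv])
  hence "(\<lambda>j. x * (diffs (\<lambda>j. (cmod (a j))\<^sup>2) j * x ^ j)) sums (x * energy_deriv x)"
    by (rule sums_mult)
  hence "(\<lambda>j. real (Suc j) * ((cmod (a (Suc j)))\<^sup>2 * x ^ Suc j)) sums (x * energy_deriv x)"
    by (simp add: diffs_def mult_ac)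
  thus ?thesis by (subst (asm) sums_Suc_iff) simp
qed

lemma energy_deriv_nonneg: "energy_deriv x \<ge> 0" if "x \<ge> 0"
  unfolding energy_deriv_def using that
  by (intro suminf_nonneg summable_energy_deriv) (auto simp: diffs_def)

lemma energy_ge_term: "(cmod (a j))\<^sup>2 * x ^ j \<le> energy x" if "x \<ge> 0"
  using sum_le_suminf[OF summable_energy, of "{j}" x] that by (simp add: energy_def)

lemma energy_pos: "energy x > 0" if "x > 0"
proof -
  have "0 < (cmod (a m\<^sub>0))\<^sup>2 * x ^ m\<^sub>0" using m\<^sub>0 that by simp
  also have "\<dots> \<le> energy x" using that by (intro energy_ge_term) auto
  finally show ?thesis .
qed

lemma sigma_series_pos: "sigma_series a r > 0" if "r > 0"
  using energy_pos[of "r\<^sup>2"] that by (simp add: sigma_series_eq)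

lemma ln_energy: "ln (energy (r\<^sup>2)) = 2 * ln (sigma_series a r)" if "r > 0"
  using energy_pos[of "r\<^sup>2"] that by (simp add: sigma_series_eq ln_sqrt)

lemma continuous_ln_sigma: "continuous_on {0<..} (\<lambda>r. ln (sigma_series a r))"
proof -
  have "continuous_on {0<..} (\<lambda>r::real. energy (r\<^sup>2))"
    by (rule continuous_on_compose2[OF continuous_energy[of UNIV]]) (auto intro!: continuous_intros)
  hence "continuous_on {0<..} (sigma_series a)"
    unfolding sigma_series_eq[abs_def] by (rule continuous_on_real_sqrt)
  thus ?thesis
  proof (rule continuous_on_ln, intro ballI)
    fix r :: real assume "r \<in> {0<..}"
    thus "sigma_series a r \<noteq> 0" using sigma_series_pos[of r] by simp
  qed
qed

lemma ln_sigma_at_top: "filterlim (\<lambda>r. ln (sigma_series a r)) at_top at_top"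
proof (rule filterlim_at_top_mono)
  show "filterlim (\<lambda>r. ln (cmod (a m\<^sub>0)) + ln r) at_top at_top"
    by (intro filterlim_tendsto_add_at_top[OF tendsto_const] ln_at_top)
  show "eventually (\<lambda>r. ln (cmod (a m\<^sub>0)) + ln r \<le> ln (sigma_series a r)) at_top"
    using eventually_ge_at_top[of 1]
  proof eventually_elim
    case (elim r)
    have "(cmod (a m\<^sub>0) * r)\<^sup>2 \<le> (cmod (a m\<^sub>0) * r ^ m\<^sub>0)\<^sup>2"
      using elim m\<^sub>0 by (intro power_mono mult_left_mono) (auto intro: self_le_power)
    also have "\<dots> = (cmod (a m\<^sub>0))\<^sup>2 * (r\<^sup>2) ^ m\<^sub>0" by (simp add: power_mult_distrib flip: power_mult) (simp add: mult.commute)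
    also have "\<dots> \<le> energy (r\<^sup>2)" by (intro energy_ge_term) auto
    finally have "cmod (a m\<^sub>0) * r \<le> sigma_series a r"
      unfolding sigma_series_eq by (rule real_le_rsqrt)
    hence "ln (cmod (a m\<^sub>0) * r) \<le> ln (sigma_series a r)"
      using elim m\<^sub>0 by (subst ln_le_cancel_iff) (auto intro!: sigma_series_pos)
    thus ?case using elim m\<^sub>0 by (simp add: ln_mult_pos)
  qed
qed

text \<open>
  Where the mean index exceeds half of \<open>ln \<sigma>\<^sup>2\<close> to the power \<open>1 + \<delta>\<close>, the function \<open>1/r\<close> is smaller than the derivative of \<open>F = - (ln \<sigma>\<^sup>2)\<close> to the power \<open>-\<delta>\<close>, divided by \<open>\<delta>\<close>. As \<open>F\<close> is increasing and bounded
  above, the set of these radii has finite logarithmic measure. Elsewhere \<open>exists_large_term\<close> applies. The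
  set is defined by a strict inequality between continuous functions, so that its complement is closed
  and the infimum in \<open>first_good_radii\<close> is attained.
\<close>
lemma exceptional_set:
  assumes \<delta>: "\<delta> > 0"
  shows "\<exists>R E. R \<ge> 1 \<and> finite_log_measure E \<and> closed {r. R \<le> r \<and> r \<notin> E} \<and>
    (\<forall>r\<ge>R. ln (sigma_series a r) \<ge> 1) \<and>
    (\<forall>r\<ge>R. r \<notin> E \<longrightarrow> (\<exists>m. (sigma_series a r)\<^sup>2 \<le>
       2 * ((2 * ln (sigma_series a r)) powr (1 + \<delta>) + 1) * (cmod (a m) * r ^ m)\<^sup>2))"
proof -
  have "eventually (\<lambda>r. ln (sigma_series a r) \<ge> 1) at_top"
    using ln_sigma_at_top by (simp add: filterlim_at_top)
  then obtain R' where R': "\<And>r. r \<ge> R' \<Longrightarrow> ln (sigma_series a r) \<ge> 1"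
    by (auto simp: eventually_at_top_linorder)
  define R where "R = max 1 R'"
  have R1: "R \<ge> 1" and T1: "\<And>r. r \<ge> R \<Longrightarrow> ln (sigma_series a r) \<ge> 1" using R' by (auto simp: R_def)
  define L where "L r = ln (energy (r\<^sup>2)) powr (1 + \<delta>)" for r
  have lnE: "ln (energy (r\<^sup>2)) \<ge> 2" if "r \<ge> R" for r
    using T1[OF that] ln_energy[of r] that R1 by simp
  have Epos: "energy (r\<^sup>2) > 0" if "r \<ge> R" for r
    using energy_pos[of "r\<^sup>2"] that R1 by simp
  have Lpos: "L r > 0" if "r \<ge> R" for r using lnE[OF that] by (simp add: L_def)
  define E where "E = {r. R \<le> r \<and> energy (r\<^sup>2) * L r < 2 * r\<^sup>2 * energy_deriv (r\<^sup>2)}"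
  have [measurable]: "energy \<in> borel_measurable borel" "energy_deriv \<in> borel_measurable borel"
    using continuous_energy continuous_energy_deriv by (auto intro: borel_measurable_continuous_onI)
  have [measurable]: "E \<in> sets borel" unfolding E_def L_def by measurable
  define f where "f r = 2 * r * energy_deriv (r\<^sup>2) / (energy (r\<^sup>2) * L r)" for r
  define F where "F r = - (ln (energy (r\<^sup>2)) powr (- \<delta>)) / \<delta>" for r
  have "(F has_real_derivative f r) (at r)" if r: "R \<le> r" for r
  proof -
    let ?l = "ln (energy (r\<^sup>2))"
    have 0: "((\<lambda>r. r\<^sup>2) has_real_derivative 2 * r) (at r)"
      by (auto intro!: derivative_eq_intros)
    have 1: "((\<lambda>r. ln (energy (r\<^sup>2))) has_real_derivative 1 / energy (r\<^sup>2) * (energy_deriv (r\<^sup>2) * (2 * r))) (at r)"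
      by (rule DERIV_chain2[OF DERIV_ln_divide[OF Epos[OF r]] DERIV_chain2[OF has_derivative_energy 0]])
    have "?l > 0" using lnE[OF r] by simp
    from DERIV_cdivide[OF DERIV_minus[OF DERIV_chain2[OF has_real_derivative_powr[OF this, of "- \<delta>"] 1]], of \<delta>]
    have "(F has_real_derivative (- (- \<delta> * ?l powr (- \<delta> - 1) * (1 / energy (r\<^sup>2) * (energy_deriv (r\<^sup>2) * (2 * r)))) / \<delta>)) (at r)"
      unfolding F_def[abs_def] .
    also have "?l powr (- \<delta> - 1) = 1 / L r"
    proof -
      have "- \<delta> - 1 = - (1 + \<delta>)" by simp
      thus ?thesis unfolding L_def by (metis powr_minus_divide)
    qed
    also have "- (- \<delta> * (1 / L r) * (1 / energy (r\<^sup>2) * (energy_deriv (r\<^sup>2) * (2 * r)))) / \<delta> = f r"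
      using \<delta> by (simp add: f_def mult_ac)
    finally show ?thesis .
  qed
  moreover have f0: "0 \<le> f r" if "R \<le> r" for r
    using that R1 energy_deriv_nonneg[of "r\<^sup>2"] Epos[OF that] Lpos[OF that] by (simp add: f_def)
  moreover have "(F \<longlongrightarrow> - 0 / \<delta>) at_top"
  proof -
    have f1: "filterlim (\<lambda>r. 2 * ln (sigma_series a r)) at_top at_top"
      by (rule filterlim_tendsto_pos_mult_at_top[OF tendsto_const _ ln_sigma_at_top]) simp
    have "eventually (\<lambda>r. 2 * ln (sigma_series a r) \<le> ln (energy (r\<^sup>2))) at_top"
      using eventually_gt_at_top[of 0] by eventually_elim (simp add: ln_energy)
    from filterlim_at_top_mono[OF f1 this]
    have "filterlim (\<lambda>r. ln (energy (r\<^sup>2))) at_top at_top" .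
    hence "((\<lambda>r. ln (energy (r\<^sup>2)) powr (- \<delta>)) \<longlongrightarrow> 0) at_top"
      using \<delta> by (intro tendsto_neg_powr) auto
    thus ?thesis unfolding F_def[abs_def] by (intro tendsto_intros) (use \<delta> in auto)
  qed
  moreover have fm: "f \<in> borel_measurable borel" unfolding f_def[abs_def] L_def by measurable
  ultimately have FTC: "(\<integral>\<^sup>+r. ennreal (f r) * indicator {R..} r \<partial>lborel) = (- 0 / \<delta>) - F R"
    by (intro nn_integral_FTC_atLeast) auto
  have flm: "finite_log_measure E"
    unfolding finite_log_measure_def
  proof (intro conjI)
    show "E \<subseteq> {0<..}" using R1 by (auto simp: E_def)
    show "E \<in> sets lebesgue" by simp
    have "(\<integral>\<^sup>+r\<in>E. ennreal (1 / r) \<partial>lebesgue) = (\<integral>\<^sup>+r\<in>E. ennreal (1 / r) \<partial>lborel)"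
      by (rule nn_integral_completion)
    also have "\<dots> \<le> (\<integral>\<^sup>+r. ennreal (f r) * indicator {R..} r \<partial>lborel)"
    proof (intro nn_integral_mono)
      fix r
      show "ennreal (1 / r) * indicator E r \<le> ennreal (f r) * indicator {R..} r"
      proof (cases "r \<in> E")
        case True
        hence r: "R \<le> r" "energy (r\<^sup>2) * L r < 2 * r\<^sup>2 * energy_deriv (r\<^sup>2)" by (auto simp: E_def)
        have "1 / r \<le> f r"
          using r Epos[of r] Lpos[of r] R1 by (simp add: f_def field_simps power2_eq_square)
        thus ?thesis using True r by (simp add: ennreal_leI)
      qed auto
    qed
    also have "\<dots> < \<infinity>" unfolding FTC by simp
    finally show "(\<integral>\<^sup>+r\<in>E. ennreal (1 / r) \<partial>lebesgue) < \<infinity>" .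
  qed
  have "{r. R \<le> r \<and> r \<notin> E} = {r \<in> {R..}. 2 * r\<^sup>2 * energy_deriv (r\<^sup>2) \<le> energy (r\<^sup>2) * L r}"
    by (auto simp: E_def)
  also have "closed \<dots>"
  proof (rule continuous_on_closed_Collect_le)
    show "continuous_on {R..} (\<lambda>r. 2 * r\<^sup>2 * energy_deriv (r\<^sup>2))"
      by (intro continuous_intros continuous_on_compose2[OF continuous_energy_deriv[of UNIV]]) auto
    have c: "continuous_on {R..} (\<lambda>r. energy (r\<^sup>2))"
      by (intro continuous_intros continuous_on_compose2[OF continuous_energy[of UNIV]]) auto
    have cl: "continuous_on {R..} (\<lambda>r. ln (energy (r\<^sup>2)))"
    proof (rule continuous_on_ln[OF c], rule ballI)
      fix r assume "r \<in> {R..}"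
      thus "energy (r\<^sup>2) \<noteq> 0" using Epos[of r] by simp
    qed
    have "continuous_on {R..} (\<lambda>r. ln (energy (r\<^sup>2)) powr (1 + \<delta>))"
    proof (rule continuous_on_powr[OF cl continuous_on_const], rule ballI)
      fix r assume "r \<in> {R..}"
      thus "ln (energy (r\<^sup>2)) \<noteq> 0" using lnE[of r] by simp
    qed
    thus "continuous_on {R..} (\<lambda>r. energy (r\<^sup>2) * L r)"
      unfolding L_def by (intro continuous_on_mult c)
  qed auto
  finally have cl: "closed {r. R \<le> r \<and> r \<notin> E}" .
  have big: "\<exists>m. (sigma_series a r)\<^sup>2 \<le> 2 * ((2 * ln (sigma_series a r)) powr (1 + \<delta>) + 1) * (cmod (a m) * r ^ m)\<^sup>2"
    if r: "R \<le> r" "r \<notin> E" for r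
  proof -
    have "\<exists>m. energy (r\<^sup>2) \<le> 2 * (L r + 1) * ((cmod (a m))\<^sup>2 * (r\<^sup>2) ^ m)"
    proof (rule exists_large_term)
      show "(\<lambda>j. (cmod (a j))\<^sup>2 * (r\<^sup>2) ^ j) sums energy (r\<^sup>2)"
        unfolding energy_def by (rule summable_sums[OF summable_energy])
      show "(\<lambda>j. real j * ((cmod (a j))\<^sup>2 * (r\<^sup>2) ^ j)) sums (r\<^sup>2 * energy_deriv (r\<^sup>2))"
        by (rule energy_deriv_sums)
      show "r\<^sup>2 * energy_deriv (r\<^sup>2) \<le> energy (r\<^sup>2) * L r / 2" using r by (auto simp: E_def)
    qed (use Epos Lpos r in auto)
    moreover have "(sigma_series a r)\<^sup>2 = energy (r\<^sup>2)"
      using Epos[OF r(1)] by (simp add: sigma_series_eq)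
    moreover have "L r = (2 * ln (sigma_series a r)) powr (1 + \<delta>)"
      using r R1 by (simp add: L_def ln_energy)
    moreover have "(cmod (a m) * r ^ m)\<^sup>2 = (cmod (a m))\<^sup>2 * (r\<^sup>2) ^ m" for m
      by (simp add: power_mult_distrib mult.commute flip: power_mult)
    ultimately show ?thesis by simp
  qed
  show ?thesis using R1 flm cl T1 big by blast
qed

end

section \<open>Countably many radii\<close>

text \<open>
  The radius \<open>\<rho> n\<close> is the smallest one outside \<open>E\<close> on the level \<open>[n, n + 1]\<close> of \<open>T\<close>. Being to the left of all the
  others of its level, it can transfer a lower bound for a nondecreasing function to them.
\<close>
lemma first_good_radii:
  fixes T :: "real \<Rightarrow> real"
  assumes cont: "continuous_on {R..} T" and top: "filterlim T at_top at_top"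
    and cl: "closed {r. R \<le> r \<and> r \<notin> E}"
  obtains \<rho> :: "nat \<Rightarrow> real" where
    "\<And>r n. R \<le> r \<Longrightarrow> r \<notin> E \<Longrightarrow> real n \<le> T r \<Longrightarrow> T r \<le> real n + 1 \<Longrightarrow>
       R \<le> \<rho> n \<and> \<rho> n \<le> r \<and> \<rho> n \<notin> E \<and> real n \<le> T (\<rho> n) \<and> T (\<rho> n) \<le> real n + 1"
proof -
  define K where "K n = {r. R \<le> r \<and> r \<notin> E \<and> real n \<le> T r \<and> T r \<le> real n + 1}" for n
  have "\<exists>s. K n \<noteq> {} \<longrightarrow> s \<in> K n \<and> (\<forall>r\<in>K n. s \<le> r)" for n
  proof -
    have "K n = {r. R \<le> r \<and> r \<notin> E} \<inter> ({r\<in>{R..}. real n \<le> T r} \<inter> {r\<in>{R..}. T r \<le> real n + 1})"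
      by (auto simp: K_def)
    also have "closed \<dots>"
      by (intro closed_Int cl continuous_on_closed_Collect_le cont continuous_intros closed_atLeast)
    finally have clK: "closed (K n)" .
    have "eventually (\<lambda>r. T r > real n + 1) at_top"
      using top by (simp add: filterlim_at_top_dense)
    then obtain B where B: "\<And>r. r \<ge> B \<Longrightarrow> T r > real n + 1" by (auto simp: eventually_at_top_linorder)
    have "K n \<subseteq> {R..B}"
    proof
      fix r assume r: "r \<in> K n"
      hence "\<not> r \<ge> B" using B[of r] by (auto simp: K_def)
      thus "r \<in> {R..B}" using r by (auto simp: K_def)
    qed
    hence "bounded (K n)" using bounded_closed_interval bounded_subset by blast
    hence "compact (K n)" using clK by (simp add: compact_eq_bounded_closed)
    thus ?thesis using compact_attains_inf by blast
  qed
  then obtain \<rho> where \<rho>: "\<And>n. K n \<noteq> {} \<longrightarrow> \<rho> n \<in> K n \<and> (\<forall>r\<in>K n. \<rho> n \<le> r)" by metis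
  show ?thesis
  proof (rule that)
    fix r n assume "R \<le> r" "r \<notin> E" "real n \<le> T r" "T r \<le> real n + 1"
    hence r: "r \<in> K n" by (simp add: K_def)
    hence "\<rho> n \<in> K n" "\<rho> n \<le> r" using \<rho>[of n] by auto
    thus "R \<le> \<rho> n \<and> \<rho> n \<le> r \<and> \<rho> n \<notin> E \<and> real n \<le> T (\<rho> n) \<and> T (\<rho> n) \<le> real n + 1"
      by (simp add: K_def)
  qed
qed

text \<open>
  Markov's inequality, with a measurable exceptional event \<open>D\<close> that can be fed to the Borel--Cantelli lemma.
\<close>
lemma (in prob_space) markov_event:
  assumes [measurable]: "J \<in> borel_measurable M" and J: "(\<integral>\<^sup>+\<omega>. J \<omega> \<partial>M) \<le> ennreal C" and v: "v > 0" and C: "C \<ge> 0"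
  defines "D \<equiv> {\<omega>\<in>space M. 1 \<le> ennreal (1 / v) * J \<omega>}"
  shows "D \<in> events" "prob D \<le> C / v" "\<And>\<omega>. \<omega> \<in> space M \<Longrightarrow> \<omega> \<notin> D \<Longrightarrow> J \<omega> \<le> ennreal v"
proof -
  show "D \<in> events" unfolding D_def by measurable
  have "emeasure M D \<le> ennreal (1 / v) * (\<integral>\<^sup>+\<omega>. J \<omega> * indicator (space M) \<omega> \<partial>M)"
    unfolding D_def by (rule nn_integral_Markov_inequality) auto
  also have "(\<integral>\<^sup>+\<omega>. J \<omega> * indicator (space M) \<omega> \<partial>M) = (\<integral>\<^sup>+\<omega>. J \<omega> \<partial>M)"
    by (intro nn_integral_cong) auto
  also have "ennreal (1 / v) * \<dots> \<le> ennreal (1 / v) * ennreal C"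
    by (intro mult_left_mono J) auto
  also have "\<dots> = ennreal (C / v)" using v C by (simp flip: ennreal_mult)
  finally show "prob D \<le> C / v" using v C by (simp add: emeasure_eq_measure)
  fix \<omega> assume w: "\<omega> \<in> space M" "\<omega> \<notin> D"
  hence "ennreal (1 / v) * J \<omega> \<le> 1" by (auto simp: D_def)
  hence "ennreal v * (ennreal (1 / v) * J \<omega>) \<le> ennreal v * 1" by (intro mult_left_mono) auto
  moreover have "ennreal v * (ennreal (1 / v) * J \<omega>) = J \<omega>"
    using v by (simp add: mult.assoc[symmetric] flip: ennreal_mult)
  ultimately show "J \<omega> \<le> ennreal v" by simp
qed

section \<open>Random power series\<close>

text \<open>
  The bound on the means makes the random series converge everywhere, almost surely; nonvanishing variables
  keep it nonconstant.
\<close>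
locale random_entire = prob_space M + entire_coefficients a m\<^sub>0
  for M :: "'w measure" and a m\<^sub>0 +
  fixes X :: "nat \<Rightarrow> 'w \<Rightarrow> complex" and B :: real
  assumes indep_X: "indep_vars (\<lambda>_. borel) X UNIV"
    and mean_X: "\<And>j. (\<integral>\<^sup>+\<omega>. ennreal (cmod (X j \<omega>)) \<partial>M) \<le> ennreal B"
    and X_nonzero: "\<And>j. AE \<omega> in M. X j \<omega> \<noteq> 0"
begin

lemma measurable_X [measurable]: "random_variable borel (X j)"
  using indep_X by (auto simp: indep_vars_def)

text \<open>
  The expectation of the sum of the moduli at \<open>z = n\<close> is finite, so almost surely the series converges
  absolutely at every natural number.
\<close>
lemma AE_summable: "AE \<omega> in M. \<forall>z. summable (\<lambda>j. X j \<omega> * a j * z ^ j)"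
proof -
  have "AE \<omega> in M. summable (\<lambda>j. X j \<omega> * a j * of_nat n ^ j)" for n
  proof -
    have sa: "summable (\<lambda>j. cmod (a j) * real n ^ j)"
    proof -
      have "summable (\<lambda>j. norm (a j * of_nat n ^ j))"
        by (rule powser_insidea[OF summable_coeff[of "of_nat (Suc n)"]]) (simp del: of_nat_Suc)
      thus ?thesis by (simp add: norm_mult norm_power)
    qed
    have "(\<integral>\<^sup>+\<omega>. (\<Sum>j. ennreal (cmod (X j \<omega>) * (cmod (a j) * real n ^ j))) \<partial>M) =
        (\<Sum>j. (\<integral>\<^sup>+\<omega>. ennreal (cmod (X j \<omega>)) * ennreal (cmod (a j) * real n ^ j) \<partial>M))"
      by (subst nn_integral_suminf) (auto simp: ennreal_mult)
    also have "\<dots> = (\<Sum>j. (\<integral>\<^sup>+\<omega>. ennreal (cmod (X j \<omega>)) \<partial>M) * ennreal (cmod (a j) * real n ^ j))"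
      by (subst nn_integral_multc) auto
    also have "\<dots> \<le> (\<Sum>j. ennreal B * ennreal (cmod (a j) * real n ^ j))"
      by (intro suminf_le mult_right_mono mean_X) auto
    also have "\<dots> = ennreal B * ennreal (\<Sum>j. cmod (a j) * real n ^ j)"
      using sa by (subst ennreal_suminf_cmult) (auto simp: suminf_ennreal2)
    also have "\<dots> < \<infinity>" by (simp add: ennreal_mult_less_top)
    finally have "AE \<omega> in M. (\<Sum>j. ennreal (cmod (X j \<omega>) * (cmod (a j) * real n ^ j))) \<noteq> \<infinity>"
      by (intro nn_integral_PInf_AE) auto
    thus ?thesis
    proof eventually_elim
      case (elim \<omega>)
      hence "summable (\<lambda>j. cmod (X j \<omega>) * (cmod (a j) * real n ^ j))"
        by (intro summable_suminf_not_top) auto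
      hence "summable (\<lambda>j. norm (X j \<omega> * a j * of_nat n ^ j))"
        by (simp add: norm_mult norm_power mult_ac)
      thus ?case by (rule summable_norm_cancel)
    qed
  qed
  hence "AE \<omega> in M. \<forall>n. summable (\<lambda>j. X j \<omega> * a j * of_nat n ^ j)"
    by (simp add: AE_all_countable)
  thus ?thesis
  proof eventually_elim
    case (elim \<omega>)
    show ?case
    proof
      fix z :: complex
      obtain n where n: "cmod z < real n" using reals_Archimedean2 by blast
      show "summable (\<lambda>j. X j \<omega> * a j * z ^ j)"
        by (rule powser_inside[of _ "of_nat n"]) (use elim n in auto)
    qed
  qed
qed

lemma AE_entire_nonconstant:
  "AE \<omega> in M. random_series a X \<omega> holomorphic_on UNIV \<and> (\<forall>c. \<exists>z. random_series a X \<omega> z \<noteq> c)"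
proof -
  have "AE \<omega> in M. X m\<^sub>0 \<omega> \<noteq> 0" by (rule X_nonzero)
  with AE_summable show ?thesis
  proof eventually_elim
    case (elim \<omega>)
    let ?f = "random_series a X \<omega>"
    have sums: "(\<lambda>j. X j \<omega> * a j * z ^ j) sums ?f z" for z
      unfolding random_series_def using elim by (intro summable_sums) auto
    have "?f holomorphic_on ball 0 r" for r
      by (rule power_series_holomorphic[where a = "\<lambda>j. X j \<omega> * a j"]) (use sums in simp)
    hence "?f field_differentiable at z" for z
      by (meson UNIV_I centre_in_ball holomorphic_on_imp_differentiable_at open_ball mem_ball_0 reals_Archimedean2)
    hence hol: "?f holomorphic_on UNIV"
      by (simp add: holomorphic_on_def field_differentiable_at_within)
    have "\<exists>z. ?f z \<noteq> c" for c
    proof (rule ccontr)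
      assume "\<not> ?thesis"
      hence c: "\<And>z. ?f z = c" by simp
      define b where "b j = X j \<omega> * a j - (if j = 0 then c else 0)" for j
      have "(\<lambda>j. b j * z ^ j) sums 0" for z
      proof -
        have "(\<lambda>j. X j \<omega> * a j * z ^ j - (if j = 0 then c else 0)) sums (?f z - c)"
          by (intro sums_diff sums sums_single)
        moreover have "(\<lambda>j. X j \<omega> * a j * z ^ j - (if j = 0 then c else 0)) = (\<lambda>j. b j * z ^ j)"
          by (auto simp: b_def algebra_simps)
        ultimately show ?thesis by (simp add: c)
      qed
      hence b0: "\<And>z::complex. norm (z - 0) < 1 \<Longrightarrow> (\<lambda>j. b j * (z - 0) ^ j) sums (\<lambda>_. 0) z" by simp
      have bm: "b m\<^sub>0 \<noteq> 0" using m\<^sub>0 elim by (simp add: b_def)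
      obtain s where "0 < s" "\<And>z::complex. z \<in> cball 0 s - {0} \<Longrightarrow> (\<lambda>_. 0::complex) z \<noteq> 0"
        using powser_0_nonzero[OF zero_less_one b0 refl bm] m\<^sub>0 by (metis less_le_trans zero_less_one)
      from this(1) this(2)[of "of_real s"] show False by simp
    qed
    with hol show ?case by blast
  qed
qed

lemma measurable_random_series [measurable]:
  "(\<lambda>(\<omega>, \<theta>). random_series a X \<omega> (of_real r * cis \<theta>)) \<in> borel_measurable (M \<Otimes>\<^sub>M uniform_angle)"
proof -
  have [measurable]: "cis \<in> borel_measurable borel"
    by (intro borel_measurable_continuous_onI continuous_intros)
  show ?thesis unfolding random_series_def by measurable
qed

lemma measurable_random_series_at [measurable]:
  "(\<lambda>\<omega>. random_series a X \<omega> z) \<in> borel_measurable M"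
  unfolding random_series_def by measurable

text \<open>
  Here \<open>t\<close> is the admitted deficit and \<open>q n\<close> bounds the probability that it is exceeded at a given radius of level
  \<open>n\<close>. Applied to the radii of \<open>first_good_radii\<close>, the Borel--Cantelli lemma excludes all but finitely many of
  these events. Jensen's formula turns the surviving bounds into bounds for \<open>N\<close>, and monotonicity of \<open>N\<close>
  extends them to all radii outside \<open>E\<close>; the step of the levels adds 1 to the constant \<open>K\<close>.
\<close>
lemma AE_lower_bound:
  fixes t :: "real \<Rightarrow> real" and q :: "nat \<Rightarrow> real"
  assumes R: "R \<ge> 1" and cl: "closed {r. R \<le> r \<and> r \<notin> E}"
    and T1: "\<And>r. R \<le> r \<Longrightarrow> ln (sigma_series a r) \<ge> 1"
    and t: "\<And>x y. 1 \<le> x \<Longrightarrow> x \<le> y \<Longrightarrow> t x \<le> t y"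
    and q: "summable q" "\<And>n. q n \<ge> 0"
    and rare: "\<And>n r. n \<ge> n\<^sub>0 \<Longrightarrow> R \<le> r \<Longrightarrow> r \<notin> E \<Longrightarrow> real n \<le> ln (sigma_series a r) \<Longrightarrow>
       ln (sigma_series a r) \<le> real n + 1 \<Longrightarrow>
       \<exists>D\<in>events. prob D \<le> q n \<and> (AE \<omega> in M. \<omega> \<notin> D \<longrightarrow>
         real n - t (real n) \<le> (\<integral>\<theta>. ln (cmod (random_series a X \<omega> (of_real r * cis \<theta>) - c)) \<partial>uniform_angle))"
  shows "AE \<omega> in M. \<exists>K r\<^sub>0. \<forall>r>r\<^sub>0. r \<notin> E \<longrightarrow>
     ln (sigma_series a r) \<le> integrated_count r c (random_series a X \<omega>) + t (ln (sigma_series a r)) + K"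
proof -
  define T where "T r = ln (sigma_series a r)" for r
  have "continuous_on {R..} T"
    unfolding T_def[abs_def] by (rule continuous_on_subset[OF continuous_ln_sigma]) (use R in auto)
  moreover have "filterlim T at_top at_top" unfolding T_def[abs_def] by (rule ln_sigma_at_top)
  ultimately obtain \<rho> where \<rho>: "\<And>r n. R \<le> r \<Longrightarrow> r \<notin> E \<Longrightarrow> real n \<le> T r \<Longrightarrow> T r \<le> real n + 1 \<Longrightarrow>
       R \<le> \<rho> n \<and> \<rho> n \<le> r \<and> \<rho> n \<notin> E \<and> real n \<le> T (\<rho> n) \<and> T (\<rho> n) \<le> real n + 1"
    using first_good_radii[OF _ _ cl] by blast
  define good where "good n \<longleftrightarrow> n \<ge> n\<^sub>0 \<and> R \<le> \<rho> n \<and> \<rho> n \<notin> E \<and> real n \<le> T (\<rho> n) \<and> T (\<rho> n) \<le> real n + 1" for n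
  define I where "I \<omega> r = (\<integral>\<theta>. ln (cmod (random_series a X \<omega> (of_real r * cis \<theta>) - c)) \<partial>uniform_angle)" for \<omega> r
  have "\<exists>D. D \<in> events \<and> prob D \<le> norm (q n) \<and> (good n \<longrightarrow> (AE \<omega> in M. \<omega> \<notin> D \<longrightarrow> real n - t (real n) \<le> I \<omega> (\<rho> n)))" for n
  proof (cases "good n")
    case True
    then obtain D where "D \<in> events" "prob D \<le> q n" "AE \<omega> in M. \<omega> \<notin> D \<longrightarrow> real n - t (real n) \<le> I \<omega> (\<rho> n)"
      using rare[of n "\<rho> n"] unfolding good_def T_def I_def by blast
    thus ?thesis by (intro exI[of _ D]) auto
  next
    case False
    thus ?thesis by (intro exI[of _ "{}"]) auto
  qed
  then obtain D where D: "\<And>n. D n \<in> events" "\<And>n. prob (D n) \<le> norm (q n)"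
    "\<And>n. good n \<Longrightarrow> AE \<omega> in M. \<omega> \<notin> D n \<longrightarrow> real n - t (real n) \<le> I \<omega> (\<rho> n)"
    by metis
  have "summable (\<lambda>n. prob (D n))"
    by (rule summable_comparison_test'[OF q(1), of 0]) (use D(2) q(2) in auto)
  hence bc: "AE \<omega> in M. eventually (\<lambda>n. \<omega> \<in> space M - D n) sequentially"
    by (intro borel_cantelli_AE1) (use D(1) in \<open>auto simp: emeasure_eq_measure\<close>)
  have all: "AE \<omega> in M. \<forall>n. good n \<longrightarrow> \<omega> \<notin> D n \<longrightarrow> real n - t (real n) \<le> I \<omega> (\<rho> n)"
    unfolding AE_all_countable
  proof
    fix n
    show "AE \<omega> in M. good n \<longrightarrow> \<omega> \<notin> D n \<longrightarrow> real n - t (real n) \<le> I \<omega> (\<rho> n)"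
      using D(3)[of n] by (cases "good n") auto
  qed
  from bc all AE_entire_nonconstant show ?thesis
  proof eventually_elim
    case (elim \<omega>)
    define h where "h z = random_series a X \<omega> z - c" for z
    have hol: "h holomorphic_on UNIV" unfolding h_def[abs_def] using elim by (intro holomorphic_intros) auto
    obtain w where "random_series a X \<omega> w \<noteq> c" using elim by blast
    hence nz: "h w \<noteq> 0" by (simp add: h_def)
    have I_eq: "I \<omega> r = (\<integral>\<theta>. ln (cmod (h (of_real r * cis \<theta>))) \<partial>uniform_angle)" for r
      by (simp add: I_def h_def)
    obtain K where K: "\<And>r. 0 < r \<Longrightarrow> integrated_zero_count r h = I \<omega> r - K"
      unfolding I_eq using jensen_formula[OF hol nz] by blast
    obtain n1 where n1: "\<And>n. n \<ge> n1 \<Longrightarrow> \<omega> \<notin> D n"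
      using elim(1) by (auto simp: eventually_sequentially)
    have "eventually (\<lambda>r. T r \<ge> real (n\<^sub>0 + n1 + 1)) at_top"
      unfolding T_def using ln_sigma_at_top by (simp add: filterlim_at_top)
    then obtain r1 where r1: "\<And>r. r \<ge> r1 \<Longrightarrow> T r \<ge> real (n\<^sub>0 + n1 + 1)"
      by (auto simp: eventually_at_top_linorder)
    have "T r \<le> integrated_count r c (random_series a X \<omega>) + t (T r) + (K + 1)"
      if r: "r > max R r1" "r \<notin> E" for r
    proof -
      define n where "n = nat \<lfloor>T r\<rfloor>"
      have Tr: "T r \<ge> real (n\<^sub>0 + n1 + 1)" using r r1 by simp
      have n: "real n \<le> T r" "T r \<le> real n + 1" "n \<ge> n\<^sub>0" "n \<ge> n1" "n \<ge> 1"
        using Tr unfolding n_def by linarith+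
      have rn: "R \<le> \<rho> n" "\<rho> n \<le> r" "\<rho> n \<notin> E" "real n \<le> T (\<rho> n)" "T (\<rho> n) \<le> real n + 1"
        using \<rho>[of r n] r n by auto
      hence "good n" using n by (simp add: good_def)
      hence "real n - t (real n) \<le> I \<omega> (\<rho> n)" using elim(2) n1 n by blast
      also have "\<dots> = integrated_zero_count (\<rho> n) h + K" using K[of "\<rho> n"] rn R by simp
      also have "\<dots> \<le> integrated_zero_count r h + K"
        using integrated_zero_count_mono[OF hol nz, of "\<rho> n" r] rn R by simp
      also have "integrated_zero_count r h = integrated_count r c (random_series a X \<omega>)"
        by (simp add: integrated_count_def h_def[abs_def])
      finally have "real n - t (real n) \<le> integrated_count r c (random_series a X \<omega>) + K" .
      moreover have "t (real n) \<le> t (T r)" using n by (intro t) auto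
      ultimately show ?thesis using n by linarith
    qed
    thus ?case unfolding T_def by blast
  qed
qed

text \<open>
  Given all variables but \<open>X\<^sub>m\<close>, the value of the series is \<open>a\<^sub>m z\<^sup>m X\<^sub>m\<close> plus a constant, so the event says
  that \<open>X\<^sub>m\<close> lies in a disk of radius \<open>s\<close> whose centre depends on the other variables. The assumed bound is
  uniform in the centre and therefore survives integration over them.
\<close>
lemma sum_small_ball:
  assumes small: "\<And>w s. s > 0 \<Longrightarrow> prob {\<omega>\<in>space M. cmod (X m \<omega> - w) \<le> s} \<le> K * s"
    and nz: "a m * z ^ m \<noteq> 0" and s: "s > 0"
  shows "prob {\<omega>\<in>space M. cmod (random_series a X \<omega> z - c) / cmod (a m * z ^ m) \<le> s} \<le> K * s"
proof -
  define \<alpha> where "\<alpha> = a m * z ^ m"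
  have \<alpha>: "\<alpha> \<noteq> 0" using nz by (simp add: \<alpha>_def)
  have K0: "K \<ge> 0" using order.trans[OF measure_nonneg small[of 1]] by simp
  \<comment> \<open>The sum of all other terms, as a function of the family without index \<open>m\<close>, hence independent of \<open>X m\<close>.\<close>
  define W where "W x = (\<Sum>j. if j = m then 0 else x j * a j * z ^ j)" for x :: "nat \<Rightarrow> complex"
  define Y where "Y \<omega> = W (restrict (\<lambda>j. X j \<omega>) (- {m}))" for \<omega>
  have [measurable]: "W \<in> borel_measurable (PiM (- {m}) (\<lambda>_. borel))"
  proof -
    have "(\<lambda>x. if j = m then 0 else x j * a j * z ^ j) \<in> borel_measurable (PiM (- {m}) (\<lambda>_. borel))" for j
      by (cases "j = m") auto
    thus ?thesis unfolding W_def[abs_def] by (rule borel_measurable_suminf)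
  qed
  have "indep_var (PiM {m} (\<lambda>_. borel)) (\<lambda>\<omega>. restrict (\<lambda>i. X i \<omega>) {m}) (PiM (- {m}) (\<lambda>_. borel)) (\<lambda>\<omega>. restrict (\<lambda>i. X i \<omega>) (- {m}))"
    by (rule indep_var_restrict[OF indep_X]) auto
  from indep_var_compose[OF this, of "\<lambda>x. x m" borel W borel]
  have ind: "indep_var borel (X m) borel Y"
    by (simp add: o_def Y_def[abs_def])
  have [measurable]: "random_variable borel Y" using ind by (rule indep_var_rv2)
  have joint: "distr M borel (X m) \<Otimes>\<^sub>M distr M borel Y = distr M (borel \<Otimes>\<^sub>M borel) (\<lambda>\<omega>. (X m \<omega>, Y \<omega>))"
    using ind by (simp add: indep_var_distribution_eq)
  define A where "A = {(x, y). cmod (x * \<alpha> + y - c) / cmod \<alpha> \<le> s}"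
  have A [measurable]: "A \<in> sets (borel \<Otimes>\<^sub>M borel)"
  proof -
    have "{p \<in> space (borel \<Otimes>\<^sub>M borel). cmod (fst p * \<alpha> + snd p - c) / cmod \<alpha> \<le> s} \<in> sets (borel \<Otimes>\<^sub>M borel)"
      by measurable
    also have "{p \<in> space (borel \<Otimes>\<^sub>M borel). cmod (fst p * \<alpha> + snd p - c) / cmod \<alpha> \<le> s} = A"
      by (auto simp: A_def space_pair_measure)
    finally show ?thesis .
  qed
  interpret X: prob_space "distr M borel (X m)" by (rule prob_space_distr) simp
  interpret Y: prob_space "distr M borel Y" by (rule prob_space_distr) simp
  interpret XY: pair_sigma_finite "distr M borel (X m)" "distr M borel Y" ..
  have slice: "emeasure (distr M borel (X m)) ((\<lambda>x. (x, y)) -` A) \<le> ennreal (K * s)" for y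
  proof -
    have eq: "cmod (x * \<alpha> + y - c) / cmod \<alpha> = cmod (x - (c - y) / \<alpha>)" for x
    proof -
      have "x * \<alpha> + y - c = (x - (c - y) / \<alpha>) * \<alpha>" using \<alpha> by (simp add: field_simps)
      thus ?thesis using \<alpha> by (simp only: norm_mult) simp
    qed
    have "emeasure (distr M borel (X m)) ((\<lambda>x. (x, y)) -` A) = emeasure M {\<omega>\<in>space M. cmod (X m \<omega> - (c - y) / \<alpha>) \<le> s}"
      by (subst emeasure_distr) (auto simp: A_def eq intro!: arg_cong[where f = "emeasure M"])
    thus ?thesis using small[OF s, of "(c - y) / \<alpha>"] by (simp add: emeasure_eq_measure ennreal_leI)
  qed
  have ae: "AE \<omega> in M. random_series a X \<omega> z = X m \<omega> * \<alpha> + Y \<omega>"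
    using AE_summable
  proof eventually_elim
    case (elim \<omega>)
    have 1: "(\<lambda>j. X j \<omega> * a j * z ^ j) sums random_series a X \<omega> z"
      unfolding random_series_def using elim by (intro summable_sums) auto
    have 2: "(\<lambda>j. if j = m then X m \<omega> * \<alpha> else 0) sums (X m \<omega> * \<alpha>)" by (rule sums_single)
    have "(\<lambda>j. X j \<omega> * a j * z ^ j - (if j = m then X m \<omega> * \<alpha> else 0)) sums (random_series a X \<omega> z - X m \<omega> * \<alpha>)"
      by (rule sums_diff[OF 1 2])
    moreover have "(\<lambda>j. X j \<omega> * a j * z ^ j - (if j = m then X m \<omega> * \<alpha> else 0)) =
        (\<lambda>j. if j = m then 0 else restrict (\<lambda>j. X j \<omega>) (- {m}) j * a j * z ^ j)"
      by (auto simp: \<alpha>_def)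
    ultimately have "(\<lambda>j. if j = m then 0 else restrict (\<lambda>j. X j \<omega>) (- {m}) j * a j * z ^ j) sums
        (random_series a X \<omega> z - X m \<omega> * \<alpha>)"
      by (simp only:)
    from sums_unique[OF this] have "Y \<omega> = random_series a X \<omega> z - X m \<omega> * \<alpha>"
      unfolding Y_def W_def by (rule sym)
    thus ?case by simp
  qed
  have "emeasure M {\<omega>\<in>space M. cmod (random_series a X \<omega> z - c) / cmod \<alpha> \<le> s} =
      emeasure M {\<omega>\<in>space M. cmod (X m \<omega> * \<alpha> + Y \<omega> - c) / cmod \<alpha> \<le> s}"
    by (rule emeasure_eq_AE) (use ae in auto)
  also have "\<dots> = emeasure (distr M (borel \<Otimes>\<^sub>M borel) (\<lambda>\<omega>. (X m \<omega>, Y \<omega>))) A"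
  proof -
    have "(\<lambda>\<omega>. (X m \<omega>, Y \<omega>)) -` A \<inter> space M = {\<omega>\<in>space M. cmod (X m \<omega> * \<alpha> + Y \<omega> - c) / cmod \<alpha> \<le> s}"
      by (auto simp: A_def)
    thus ?thesis by (subst emeasure_distr[OF _ A]) auto
  qed
  also have "\<dots> = (\<integral>\<^sup>+y. emeasure (distr M borel (X m)) ((\<lambda>x. (x, y)) -` A) \<partial>distr M borel Y)"
    unfolding joint[symmetric] by (rule XY.emeasure_pair_measure_alt2) simp
  also have "\<dots> \<le> (\<integral>\<^sup>+y. ennreal (K * s) \<partial>distr M borel Y)"
    by (intro nn_integral_mono slice)
  also have "\<dots> = ennreal (K * s)" by (simp add: Y.emeasure_space_1[simplified])
  finally show ?thesis
    using K0 s by (simp add: emeasure_eq_measure \<alpha>_def)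
qed

lemma measurable_circle_functional [measurable]:
  assumes [measurable]: "u \<in> borel_measurable borel"
  shows "(\<lambda>\<omega>. \<integral>\<^sup>+\<theta>. ennreal (u (random_series a X \<omega> (of_real r * cis \<theta>))) \<partial>uniform_angle) \<in> borel_measurable M"
proof -
  have "(\<lambda>x. ennreal (u ((\<lambda>(\<omega>, \<theta>). random_series a X \<omega> (of_real r * cis \<theta>)) x))) \<in> borel_measurable (M \<Otimes>\<^sub>M uniform_angle)"
    by measurable
  hence "(\<lambda>(\<omega>, \<theta>). ennreal (u (random_series a X \<omega> (of_real r * cis \<theta>)))) \<in> borel_measurable (M \<Otimes>\<^sub>M uniform_angle)"
    by (simp add: case_prod_unfold)
  thus ?thesis by (rule uniform_angle.borel_measurable_nn_integral)
qed

lemma nn_integral_circle_swap: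
  assumes [measurable]: "u \<in> borel_measurable borel"
  shows "(\<integral>\<^sup>+\<omega>. (\<integral>\<^sup>+\<theta>. ennreal (u (random_series a X \<omega> (of_real r * cis \<theta>))) \<partial>uniform_angle) \<partial>M) =
         (\<integral>\<^sup>+\<theta>. (\<integral>\<^sup>+\<omega>. ennreal (u (random_series a X \<omega> (of_real r * cis \<theta>))) \<partial>M) \<partial>uniform_angle)"
proof -
  interpret P: pair_sigma_finite M uniform_angle ..
  have "(\<lambda>x. ennreal (u ((\<lambda>(\<omega>, \<theta>). random_series a X \<omega> (of_real r * cis \<theta>)) x))) \<in> borel_measurable (M \<Otimes>\<^sub>M uniform_angle)"
    by measurable
  from P.Fubini[OF this] show ?thesis by simp
qed

section \<open>Variables with small ball probabilities\<close>

text \<open>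
  Put \<open>Y = |f\<^sub>\<omega> - c| / \<beta>\<close> on the circle, where \<open>\<beta>\<close> is the modulus of the term of index \<open>m\<close>. The expectation of
  the mean of \<open>Y\<close> to the power \<open>-p\<close> is bounded, so outside an event of small probability that mean
  is at most \<open>exp (p u)\<close>. By Jensen's inequality for the exponential, used in the form \<open>1 + x \<le> exp x\<close>,
  the mean of \<open>ln Y\<close> is then at least \<open>- u\<close>.
\<close>
lemma rare_event_small_ball:
  assumes small: "\<And>j w s. s > 0 \<Longrightarrow> prob {\<omega>\<in>space M. cmod (X j \<omega> - w) \<le> s} \<le> K * s"
    and p: "0 < p" "p < 1" and r: "r > 0" and am: "a m \<noteq> 0"
  shows "\<exists>D\<in>events. prob D \<le> negative_moment_bound K p * exp (- (p * u)) \<and>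
    (AE \<omega> in M. \<omega> \<notin> D \<longrightarrow> ln (cmod (a m) * r ^ m) - u \<le>
      (\<integral>\<theta>. ln (cmod (random_series a X \<omega> (of_real r * cis \<theta>) - c)) \<partial>uniform_angle))"
proof -
  define \<beta> where "\<beta> = cmod (a m) * r ^ m"
  have \<beta>: "\<beta> > 0" using am r by (simp add: \<beta>_def)
  define U where "U w = (cmod (w - c) / \<beta>) powr (- p)" for w
  have [measurable]: "U \<in> borel_measurable borel" unfolding U_def[abs_def] by measurable
  define J where "J \<omega> = (\<integral>\<^sup>+\<theta>. ennreal (U (random_series a X \<omega> (of_real r * cis \<theta>))) \<partial>uniform_angle)" for \<omega>
  have [measurable]: "J \<in> borel_measurable M" unfolding J_def[abs_def] by measurable
  have K0: "K \<ge> 0" using order.trans[OF measure_nonneg small[of 1]] by simp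
  define C where "C = negative_moment_bound K p"
  have "(2::real) powr (p - 1) < 2 powr 0" using p by (intro powr_less_mono) auto
  hence C0: "C \<ge> 0" using K0 unfolding C_def negative_moment_bound_def by simp
  have "(\<integral>\<^sup>+\<omega>. J \<omega> \<partial>M) = (\<integral>\<^sup>+\<theta>. (\<integral>\<^sup>+\<omega>. ennreal (U (random_series a X \<omega> (of_real r * cis \<theta>))) \<partial>M) \<partial>uniform_angle)"
    unfolding J_def by (rule nn_integral_circle_swap) simp
  also have "\<dots> \<le> (\<integral>\<^sup>+\<theta>. ennreal C \<partial>uniform_angle)"
  proof (intro nn_integral_mono)
    fix \<theta>
    have b: "cmod (a m * (of_real r * cis \<theta>) ^ m) = \<beta>"
      using r by (simp add: \<beta>_def norm_mult norm_power)
    show "(\<integral>\<^sup>+\<omega>. ennreal (U (random_series a X \<omega> (of_real r * cis \<theta>))) \<partial>M) \<le> ennreal C"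
      unfolding U_def C_def
    proof (rule negative_moment_le[OF _ _ _ p])
      fix s :: real assume s: "s > 0"
      have "a m * (of_real r * cis \<theta>) ^ m \<noteq> 0" using am r by simp
      from sum_small_ball[OF small this s, of c]
      show "prob {\<omega>\<in>space M. cmod (random_series a X \<omega> (of_real r * cis \<theta>) - c) / \<beta> \<le> s} \<le> K * s"
        unfolding b by simp
    qed (use \<beta> in auto)
  qed
  also have "\<dots> = ennreal C" by (simp add: uniform_angle.emeasure_space_1[simplified])
  finally have EJ: "(\<integral>\<^sup>+\<omega>. J \<omega> \<partial>M) \<le> ennreal C" .
  define D where "D = {\<omega>\<in>space M. 1 \<le> ennreal (1 / exp (p * u)) * J \<omega>}"
  note D = markov_event[OF _ EJ exp_gt_zero[of "p * u"] C0, folded D_def]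
  have "prob D \<le> C * exp (- (p * u))" using D(2) by (simp add: exp_minus field_simps)
  moreover have "AE \<omega> in M. \<omega> \<notin> D \<longrightarrow> ln \<beta> - u \<le>
      (\<integral>\<theta>. ln (cmod (random_series a X \<omega> (of_real r * cis \<theta>) - c)) \<partial>uniform_angle)"
    using AE_entire_nonconstant AE_space
  proof eventually_elim
    case (elim \<omega>)
    show ?case
    proof
      assume "\<omega> \<notin> D"
      hence Jle: "J \<omega> \<le> ennreal (exp (p * u))" using D(3) elim by auto
      define h where "h z = random_series a X \<omega> z - c" for z
      have hol: "h holomorphic_on UNIV" unfolding h_def[abs_def] using elim by (intro holomorphic_intros) auto
      obtain w where "random_series a X \<omega> w \<noteq> c" using elim by blast
      hence nz: "h w \<noteq> 0" by (simp add: h_def)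
      note int = integrable_ln_circle[OF hol nz r]
      define V where "V \<theta> = (cmod (h (of_real r * cis \<theta>)) / \<beta>) powr (- p)" for \<theta>
      have "continuous_on UNIV h" using hol by (rule holomorphic_on_imp_continuous_on)
      hence "continuous_on UNIV (\<lambda>\<theta>. h (of_real r * cis \<theta>))"
        by (rule continuous_on_compose2) (auto intro!: continuous_intros)
      hence "(\<lambda>\<theta>. h (of_real r * cis \<theta>)) \<in> borel_measurable borel"
        by (rule borel_measurable_continuous_onI)
      hence [measurable]: "V \<in> borel_measurable borel" unfolding V_def[abs_def] by measurable
      have JV: "J \<omega> = (\<integral>\<^sup>+\<theta>. ennreal (V \<theta>) \<partial>uniform_angle)"
        by (simp add: J_def V_def U_def h_def)
      have V0: "V \<theta> \<ge> 0" for \<theta> by (simp add: V_def)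
      have intV: "integrable uniform_angle V"
        using Jle V0 by (intro integrableI_nonneg) (auto simp: JV intro: le_less_trans)
      have "ennreal (\<integral>\<theta>. V \<theta> \<partial>uniform_angle) \<le> ennreal (exp (p * u))"
        using Jle nn_integral_eq_integral[OF intV] V0 by (simp add: JV)
      hence V_le: "(\<integral>\<theta>. V \<theta> \<partial>uniform_angle) \<le> exp (p * u)" by simp
      define I where "I = (\<integral>\<theta>. ln (cmod (h (of_real r * cis \<theta>))) \<partial>uniform_angle)"
      have "(\<integral>\<theta>. exp (p * u) * (1 + p * (ln \<beta> - u) - p * ln (cmod (h (of_real r * cis \<theta>)))) \<partial>uniform_angle)
          \<le> (\<integral>\<theta>. V \<theta> \<partial>uniform_angle)"
      proof (rule integral_mono_AE)
        show "AE \<theta> in uniform_angle. exp (p * u) * (1 + p * (ln \<beta> - u) - p * ln (cmod (h (of_real r * cis \<theta>)))) \<le> V \<theta>"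
          using AE_circle_nonzero[OF hol nz r]
        proof eventually_elim
          case (elim \<theta>)
          define y where "y = cmod (h (of_real r * cis \<theta>))"
          have y: "y > 0" using elim by (simp add: y_def)
          define x where "x = p * (ln \<beta> - u) - p * ln y"
          have "V \<theta> = exp (- p * ln (y / \<beta>))" using y \<beta> by (simp add: V_def powr_def y_def[symmetric])
          also have "- p * ln (y / \<beta>) = p * u + x" using y \<beta> by (simp add: x_def ln_div algebra_simps)
          finally have "V \<theta> = exp (p * u) * exp x" by (simp add: exp_add)
          moreover have "1 + x \<le> exp x" by (rule exp_ge_add_one_self)
          ultimately have "exp (p * u) * (1 + x) \<le> V \<theta>" by simp
          thus ?case by (simp only: x_def y_def add_diff_eq)
        qed
      qed (use int intV in auto)
      also have "\<dots> \<le> exp (p * u)" by (rule V_le)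
      also have "(\<integral>\<theta>. exp (p * u) * (1 + p * (ln \<beta> - u) - p * ln (cmod (h (of_real r * cis \<theta>)))) \<partial>uniform_angle)
          = exp (p * u) * (1 + p * (ln \<beta> - u) - p * I)"
        using int by (simp add: I_def)
      finally have "1 + p * (ln \<beta> - u) - p * I \<le> 1" by simp
      hence "p * (ln \<beta> - u) \<le> p * I" by simp
      hence "ln \<beta> - u \<le> I" using p by simp
      thus "ln \<beta> - u \<le> (\<integral>\<theta>. ln (cmod (random_series a X \<omega> (of_real r * cis \<theta>) - c)) \<partial>uniform_angle)"
        by (simp add: I_def h_def)
    qed
  qed
  ultimately show ?thesis using D(1) unfolding C_def \<beta>_def by auto
qed

end

text \<open>
  The total deficit: \<open>1 + \<epsilon>/4\<close> comes from the Borel--Cantelli lemma, and the second logarithm, which behaves like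
  \<open>(1 + \<epsilon>) ln x\<close>, from the comparison of \<open>\<sigma>\<^sup>2\<close> with its largest term.
\<close>
lemma asymptotic_small_ball:
  assumes "\<epsilon> > 0"
  shows "eventually (\<lambda>x::real. (1 + \<epsilon> / 4) * ln x + ln (2 * ((2 * (x + 1)) powr (1 + \<epsilon>) + 1)) / 2 + K \<le> (3 / 2 + \<epsilon>) * ln x) at_top"
proof -
  have 1: "eventually (\<lambda>x::real. ln (2 * ((2 * (x + 1)) powr (1 + \<epsilon>) + 1)) \<le> ln 4 + (1 + \<epsilon>) * (ln 4 + ln x)) at_top"
    using eventually_ge_at_top[of 1]
  proof eventually_elim
    case (elim x)
    have "1 \<le> (2 * (x + 1)) powr (1 + \<epsilon>)" using elim assms by (intro ge_one_powr_ge_zero) auto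
    moreover have "(2 * (x + 1)) powr (1 + \<epsilon>) \<le> (4 * x) powr (1 + \<epsilon>)"
      using elim assms by (intro powr_mono2) auto
    ultimately have "2 * ((2 * (x + 1)) powr (1 + \<epsilon>) + 1) \<le> 4 * (4 * x) powr (1 + \<epsilon>)" by simp
    hence "ln (2 * ((2 * (x + 1)) powr (1 + \<epsilon>) + 1)) \<le> ln (4 * (4 * x) powr (1 + \<epsilon>))"
      by (subst ln_le_cancel_iff) (use elim in \<open>auto intro!: add_nonneg_pos\<close>)
    also have "\<dots> = ln 4 + (1 + \<epsilon>) * (ln 4 + ln x)"
      using elim by (simp add: ln_mult_pos ln_powr)
    finally show ?case .
  qed
  have "filterlim (\<lambda>x::real. \<epsilon> / 4 * ln x) at_top at_top"
    by (rule filterlim_tendsto_pos_mult_at_top[OF tendsto_const _ ln_at_top]) (use assms in auto)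
  hence 2: "eventually (\<lambda>x::real. \<epsilon> / 4 * ln x \<ge> ln 4 / 2 + (1 + \<epsilon>) * ln 4 / 2 + K) at_top"
    unfolding filterlim_at_top by blast
  from 1 2 show ?thesis
  proof eventually_elim
    case (elim x)
    thus ?case by (simp add: algebra_simps add_divide_distrib)
  qed
qed

context random_entire
begin

theorem small_ball_lower_bound:
  assumes small: "\<And>j w s. s > 0 \<Longrightarrow> prob {\<omega>\<in>space M. cmod (X j \<omega> - w) \<le> s} \<le> K * s"
    and \<epsilon>: "\<epsilon> > 0" and R: "R \<ge> 1" and cl: "closed {r. R \<le> r \<and> r \<notin> E}"
    and T1: "\<And>r. R \<le> r \<Longrightarrow> ln (sigma_series a r) \<ge> 1"
    and big_term: "\<And>r. R \<le> r \<Longrightarrow> r \<notin> E \<Longrightarrow>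
       \<exists>m. (sigma_series a r)\<^sup>2 \<le> 2 * ((2 * ln (sigma_series a r)) powr (1 + \<epsilon>) + 1) * (cmod (a m) * r ^ m)\<^sup>2"
  shows "AE \<omega> in M. \<exists>r\<^sub>0. \<forall>r>r\<^sub>0. r \<notin> E \<longrightarrow>
     ln (sigma_series a r) \<le> integrated_count r c (random_series a X \<omega>) + (3 / 2 + \<epsilon>) * ln (ln (sigma_series a r))"
proof -
  define q where "q = 1 + \<epsilon> / 4"
  \<comment> \<open>The midpoint of \<open>1/q\<close> and 1, so that \<open>p < 1\<close> and \<open>p q > 1\<close>.\<close>
  define p where "p = (1 / q + 1) / 2"
  have q: "q > 1" using \<epsilon> by (simp add: q_def)
  have p: "0 < p" "p < 1" using q by (simp_all add: p_def add_pos_pos field_simps)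
  have pq: "p * q > 1" using q by (simp add: p_def field_simps)
  define t where "t x = q * ln x + ln (2 * ((2 * (x + 1)) powr (1 + \<epsilon>) + 1)) / 2" for x
  define C where "C = negative_moment_bound K p"
  have K0: "K \<ge> 0" using order.trans[OF measure_nonneg small[of 1]] by simp
  have "(2::real) powr (p - 1) < 2 powr 0" using p by (intro powr_less_mono) auto
  hence C0: "C \<ge> 0" using K0 unfolding C_def negative_moment_bound_def by simp
  have "AE \<omega> in M. \<exists>K' r\<^sub>0. \<forall>r>r\<^sub>0. r \<notin> E \<longrightarrow>
     ln (sigma_series a r) \<le> integrated_count r c (random_series a X \<omega>) + t (ln (sigma_series a r)) + K'"
  proof (rule AE_lower_bound[OF R cl T1])
    show "t x \<le> t y" if "1 \<le> x" "x \<le> y" for x y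
      unfolding t_def using that q \<epsilon>
      by (intro add_mono mult_left_mono divide_right_mono ln_mono powr_mono2) (auto intro!: add_nonneg_pos mult_pos_pos)
    show "summable (\<lambda>n. C * real n powr (- (p * q)))"
      using pq by (intro summable_mult) (simp add: summable_real_powr_iff)
    show "C * real n powr (- (p * q)) \<ge> 0" for n using C0 by simp
    fix n :: nat and r :: real
    assume n: "n \<ge> 1" and r: "R \<le> r" "r \<notin> E" and Tr: "real n \<le> ln (sigma_series a r)" "ln (sigma_series a r) \<le> real n + 1"
    define L where "L = 2 * ((2 * ln (sigma_series a r)) powr (1 + \<epsilon>) + 1)"
    define L' where "L' = 2 * ((2 * (real n + 1)) powr (1 + \<epsilon>) + 1)"
    have LL': "0 < L" "L \<le> L'"
      unfolding L_def L'_def using Tr \<epsilon> T1[OF r(1)]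
      by (auto intro!: powr_mono2 add_nonneg_pos)
    obtain m where m: "(sigma_series a r)\<^sup>2 \<le> L * (cmod (a m) * r ^ m)\<^sup>2"
      using big_term[OF r] unfolding L_def by blast
    have s: "sigma_series a r > 0" using r R by (intro sigma_series_pos) auto
    have am: "a m \<noteq> 0" using m s by auto
    have b: "cmod (a m) * r ^ m > 0" using am r R by simp
    have "ln ((sigma_series a r)\<^sup>2) \<le> ln (L * (cmod (a m) * r ^ m)\<^sup>2)"
      using m s mult_pos_pos[OF LL'(1) zero_less_power[OF b, of 2]] by (subst ln_le_cancel_iff) simp_all
    hence "2 * ln (sigma_series a r) \<le> ln L + 2 * ln (cmod (a m) * r ^ m)"
    proof -
      have "ln (u * v\<^sup>2) = ln u + 2 * ln v" if "u > 0" "v > 0" for u v :: real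
        using that by (simp add: ln_mult_pos ln_realpow)
      from this[OF LL'(1) b] show ?thesis
        using \<open>ln ((sigma_series a r)\<^sup>2) \<le> _\<close> s by (simp add: ln_realpow)
    qed
    moreover have "ln L \<le> ln L'" using LL' by simp
    ultimately have lnb: "real n - ln L' / 2 \<le> ln (cmod (a m) * r ^ m)" using Tr by simp
    obtain D where D: "D \<in> events" "prob D \<le> C * exp (- (p * (q * ln (real n))))"
      "AE \<omega> in M. \<omega> \<notin> D \<longrightarrow> ln (cmod (a m) * r ^ m) - q * ln (real n) \<le>
        (\<integral>\<theta>. ln (cmod (random_series a X \<omega> (of_real r * cis \<theta>) - c)) \<partial>uniform_angle)"
      using rare_event_small_ball[OF small p _ am, of r "q * ln (real n)" c] r R unfolding C_def by auto
    have "prob D \<le> C * real n powr (- (p * q))"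
      using D(2) n by (simp add: powr_def mult_ac)
    moreover have "AE \<omega> in M. \<omega> \<notin> D \<longrightarrow> real n - t (real n) \<le>
        (\<integral>\<theta>. ln (cmod (random_series a X \<omega> (of_real r * cis \<theta>) - c)) \<partial>uniform_angle)"
      using D(3)
    proof eventually_elim
      case (elim \<omega>)
      have "real n - t (real n) = (real n - ln L' / 2) - q * ln (real n)" by (simp add: t_def L'_def)
      also have "\<dots> \<le> ln (cmod (a m) * r ^ m) - q * ln (real n)" using lnb by simp
      finally show ?case using elim by auto
    qed
    ultimately show "\<exists>D\<in>events. prob D \<le> C * real n powr (- (p * q)) \<and> (AE \<omega> in M. \<omega> \<notin> D \<longrightarrow> real n - t (real n) \<le>
        (\<integral>\<theta>. ln (cmod (random_series a X \<omega> (of_real r * cis \<theta>) - c)) \<partial>uniform_angle))"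
      using D(1) by blast
  qed
  thus ?thesis
  proof eventually_elim
    case (elim \<omega>)
    then obtain K' r\<^sub>0 where *: "\<And>r. r > r\<^sub>0 \<Longrightarrow> r \<notin> E \<Longrightarrow>
     ln (sigma_series a r) \<le> integrated_count r c (random_series a X \<omega>) + t (ln (sigma_series a r)) + K'" by blast
    have "eventually (\<lambda>r. t (ln (sigma_series a r)) + K' \<le> (3 / 2 + \<epsilon>) * ln (ln (sigma_series a r))) at_top"
      using asymptotic_small_ball[OF \<epsilon>, of K'] ln_sigma_at_top unfolding t_def q_def
      by (rule eventually_compose_filterlim)
    then obtain r1 where r1: "\<And>r. r \<ge> r1 \<Longrightarrow> t (ln (sigma_series a r)) + K' \<le> (3 / 2 + \<epsilon>) * ln (ln (sigma_series a r))"
      by (auto simp: eventually_at_top_linorder)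
    show ?case
    proof (intro exI[of _ "max r\<^sub>0 r1"] allI impI)
      fix r assume r: "r > max r\<^sub>0 r1" "r \<notin> E"
      show "ln (sigma_series a r) \<le> integrated_count r c (random_series a X \<omega>) + (3 / 2 + \<epsilon>) * ln (ln (sigma_series a r))"
        using *[of r] r1[of r] r by simp
    qed
  qed
qed

end

section \<open>Variables with log-integrability\<close>

text \<open>
  Young's inequality with equality at \<open>y = \<tau>\<close>. Integrated, it takes the place of Jensen's inequality: if the
  \<open>p\<close>-th moment of \<open>y\<close> is at most \<open>\<tau>\<close> to the power \<open>p\<close>, then the mean of \<open>y\<close> is at most \<open>\<tau>\<close>.
\<close>
lemma le_scaled_powr:
  fixes y \<tau> p :: real
  assumes "y \<ge> 0" "\<tau> > 0" "p \<ge> 1"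
  shows "y \<le> \<tau> * (y powr p / (p * \<tau> powr p) + (1 - 1 / p))"
proof (cases "p = 1")
  case True
  thus ?thesis using assms by simp
next
  case False
  with assms have p: "p > 1" by simp
  define q where "q = p / (p - 1)"
  have q: "q > 1" "1 / p + 1 / q = 1" using p by (simp_all add: q_def field_simps)
  have "(y / \<tau>) * 1 \<le> (y / \<tau>) powr p / p + 1 powr q / q"
    by (rule Youngs_inequality) (use p q assms in auto)
  also have "(y / \<tau>) powr p = y powr p / \<tau> powr p" using assms by (simp add: powr_divide)
  also have "1 powr q / q = 1 - 1 / p" using q by simp
  finally have "\<tau> * (y / \<tau>) \<le> \<tau> * (y powr p / \<tau> powr p / p + (1 - 1 / p))"
    using assms by (intro mult_left_mono) auto
  thus ?thesis using assms by (simp add: mult.commute)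
qed

lemma nn_integral_angle_interval:
  assumes [measurable]: "g \<in> borel_measurable borel"
  shows "(\<integral>\<^sup>+\<theta>\<in>{0..2 * pi}. ennreal (g \<theta> / (2 * pi)) \<partial>lborel) = (\<integral>\<^sup>+\<theta>. ennreal (g \<theta>) \<partial>uniform_angle)"
proof -
  have "ennreal (g \<theta> / (2 * pi)) = ennreal (g \<theta>) * ennreal (1 / (2 * pi))" for \<theta>
    using ennreal_mult''[of "1 / (2 * pi)" "g \<theta>"] by simp
  thus ?thesis by (simp add: nn_integral_uniform_angle)
qed

context random_entire
begin

lemma rare_event_log_moment:
  assumes p: "p \<ge> 1" and r: "r > 0" and \<tau>: "\<tau> > 0" and C: "C \<ge> 0"
    and moment: "(\<integral>\<^sup>+\<omega>. (\<integral>\<^sup>+\<theta>. ennreal (\<bar>ln (cmod (random_series a X \<omega> (of_real r * cis \<theta>) / of_real (sigma_series a r)))\<bar> powr p)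
        \<partial>uniform_angle) \<partial>M) \<le> ennreal C"
  shows "\<exists>D\<in>events. prob D \<le> C / \<tau> powr p \<and>
    (AE \<omega> in M. \<omega> \<notin> D \<longrightarrow> ln (sigma_series a r) - \<tau> \<le>
      (\<integral>\<theta>. ln (cmod (random_series a X \<omega> (of_real r * cis \<theta>))) \<partial>uniform_angle))"
proof -
  define \<sigma> where "\<sigma> = sigma_series a r"
  have \<sigma>: "\<sigma> > 0" using r by (simp add: \<sigma>_def sigma_series_pos)
  define U where "U w = \<bar>ln (cmod (w / of_real \<sigma>))\<bar> powr p" for w
  have [measurable]: "U \<in> borel_measurable borel" unfolding U_def[abs_def] by measurable
  define J where "J \<omega> = (\<integral>\<^sup>+\<theta>. ennreal (U (random_series a X \<omega> (of_real r * cis \<theta>))) \<partial>uniform_angle)" for \<omega>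
  have [measurable]: "J \<in> borel_measurable M" unfolding J_def[abs_def] by measurable
  have EJ: "(\<integral>\<^sup>+\<omega>. J \<omega> \<partial>M) \<le> ennreal C"
    using moment by (simp only: J_def U_def \<sigma>_def)
  define v where "v = \<tau> powr p"
  have v: "v > 0" using \<tau> by (simp add: v_def)
  define D where "D = {\<omega>\<in>space M. 1 \<le> ennreal (1 / v) * J \<omega>}"
  note D = markov_event[OF _ EJ v C, folded D_def]
  have "AE \<omega> in M. \<omega> \<notin> D \<longrightarrow> ln \<sigma> - \<tau> \<le>
      (\<integral>\<theta>. ln (cmod (random_series a X \<omega> (of_real r * cis \<theta>))) \<partial>uniform_angle)"
    using AE_entire_nonconstant AE_space
  proof eventually_elim
    case (elim \<omega>)
    show ?case
    proof
      assume "\<omega> \<notin> D"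
      hence Jle: "J \<omega> \<le> ennreal v" using D(3) elim by auto
      define h where "h z = random_series a X \<omega> z" for z
      have hol: "h holomorphic_on UNIV" unfolding h_def[abs_def] using elim by auto
      obtain w where "random_series a X \<omega> w \<noteq> 0" using elim by blast
      hence nz: "h w \<noteq> 0" by (simp add: h_def)
      note int = integrable_ln_circle[OF hol nz r]
      define V where "V \<theta> = U (h (of_real r * cis \<theta>))" for \<theta>
      have "continuous_on UNIV h" using hol by (rule holomorphic_on_imp_continuous_on)
      hence "continuous_on UNIV (\<lambda>\<theta>. h (of_real r * cis \<theta>))"
        by (rule continuous_on_compose2) (auto intro!: continuous_intros)
      hence [measurable]: "(\<lambda>\<theta>. h (of_real r * cis \<theta>)) \<in> borel_measurable borel"
        by (rule borel_measurable_continuous_onI)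
      have [measurable]: "V \<in> borel_measurable borel" unfolding V_def[abs_def] by measurable
      have JV: "J \<omega> = (\<integral>\<^sup>+\<theta>. ennreal (V \<theta>) \<partial>uniform_angle)"
        by (simp add: J_def V_def h_def)
      have V0: "V \<theta> \<ge> 0" for \<theta> by (simp add: V_def U_def)
      have intV: "integrable uniform_angle V"
        using Jle V0 by (intro integrableI_nonneg) (auto simp: JV intro: le_less_trans)
      have "ennreal (\<integral>\<theta>. V \<theta> \<partial>uniform_angle) \<le> ennreal v"
        using Jle nn_integral_eq_integral[OF intV] V0 by (simp add: JV)
      hence V_le: "(\<integral>\<theta>. V \<theta> \<partial>uniform_angle) \<le> v" using v by simp
      define I where "I = (\<integral>\<theta>. ln (cmod (h (of_real r * cis \<theta>))) \<partial>uniform_angle)"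
      have "(\<integral>\<theta>. ln \<sigma> - ln (cmod (h (of_real r * cis \<theta>))) \<partial>uniform_angle)
          \<le> (\<integral>\<theta>. \<tau> * (V \<theta> / (p * v) + (1 - 1 / p)) \<partial>uniform_angle)"
      proof (rule integral_mono_AE)
        show "AE \<theta> in uniform_angle. ln \<sigma> - ln (cmod (h (of_real r * cis \<theta>))) \<le> \<tau> * (V \<theta> / (p * v) + (1 - 1 / p))"
          using AE_circle_nonzero[OF hol nz r]
        proof eventually_elim
          case (elim \<theta>)
          define y where "y = \<bar>ln (cmod (h (of_real r * cis \<theta>) / of_real \<sigma>))\<bar>"
          have "ln \<sigma> - ln (cmod (h (of_real r * cis \<theta>))) \<le> y"
            using elim \<sigma> by (simp add: y_def norm_divide ln_div)
          also have "y \<le> \<tau> * (y powr p / (p * v) + (1 - 1 / p))"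
            unfolding v_def by (rule le_scaled_powr) (use p \<tau> in \<open>auto simp: y_def\<close>)
          also have "y powr p = V \<theta>" by (simp add: V_def U_def y_def)
          finally show ?case .
        qed
      qed (use int intV in auto)
      also have "\<dots> = \<tau> * ((\<integral>\<theta>. V \<theta> \<partial>uniform_angle) / (p * v) + (1 - 1 / p))"
        using intV by simp
      also have "\<dots> \<le> \<tau> * (v / (p * v) + (1 - 1 / p))"
        using V_le p v \<tau> by (intro mult_left_mono add_right_mono divide_right_mono) auto
      also have "\<dots> = \<tau>" using v p by simp
      finally have "ln \<sigma> - I \<le> \<tau>" using int by (simp add: I_def)
      thus "ln \<sigma> - \<tau> \<le> (\<integral>\<theta>. ln (cmod (random_series a X \<omega> (of_real r * cis \<theta>))) \<partial>uniform_angle)"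
        by (simp add: I_def h_def)
    qed
  qed
  thus ?thesis using D(1,2) unfolding v_def \<sigma>_def by auto
qed

text \<open>
  The order \<open>p\<close> of the moment grows like \<open>ln n\<close>. For the threshold \<open>L ^ 6\<close> with \<open>L = \<beta> ln n\<close>, the choice
  \<open>p = L / (e C)\<close> minimises the Markov bound \<open>(C p / L)\<close> to the power \<open>6p\<close>; its value \<open>exp (- 6 p)\<close> is \<open>n\<close> to the power
  \<open>- 6 \<kappa>\<close> with \<open>\<kappa> = \<beta> / (e C)\<close>, and the assumption on \<open>\<beta>\<close> says that this is summable. The theorem requires
  \<open>p \<ge> 1\<close>, which determines the first index \<open>n\<^sub>0\<close>.
\<close>
theorem rademacher_lower_bound:
  assumes rad: "rademacher_sequence M X" and lic: "log_integrability_constant M C"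
    and \<beta>: "6 * \<beta> > exp 1 * C"
  shows "AE \<omega> in M. \<exists>K r\<^sub>0. \<forall>r>r\<^sub>0.
     ln (sigma_series a r) \<le> integrated_count r 0 (random_series a X \<omega>) + (\<beta> * ln (ln (sigma_series a r))) ^ 6 + K"
proof -
  have C: "C > 0" using lic by (simp add: log_integrability_constant_def)
  have b0: "\<beta> > 0" using \<beta> mult_pos_pos[OF exp_gt_zero[of 1] C] by linarith
  define \<kappa> where "\<kappa> = \<beta> / (C * exp 1)"
  have \<kappa>: "\<kappa> > 0" "6 * \<kappa> > 1" using \<beta> C b0 by (simp_all add: \<kappa>_def field_simps)
  have "eventually (\<lambda>r. ln (sigma_series a r) \<ge> 1) at_top"
    using ln_sigma_at_top by (simp add: filterlim_at_top)
  then obtain R' where R': "\<And>r. r \<ge> R' \<Longrightarrow> ln (sigma_series a r) \<ge> 1"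
    by (auto simp: eventually_at_top_linorder)
  define R where "R = max 1 R'"
  have R: "R \<ge> 1" by (simp add: R_def)
  define n\<^sub>0 where "n\<^sub>0 = nat \<lceil>exp (1 / \<kappa>)\<rceil>"
  have "AE \<omega> in M. \<exists>K r\<^sub>0. \<forall>r>r\<^sub>0. r \<notin> {} \<longrightarrow>
     ln (sigma_series a r) \<le> integrated_count r 0 (random_series a X \<omega>) + (\<beta> * ln (ln (sigma_series a r))) ^ 6 + K"
  proof (rule AE_lower_bound[OF R])
    show "closed {r. R \<le> r \<and> r \<notin> {}}" by (simp flip: atLeast_def)
    show "ln (sigma_series a r) \<ge> 1" if "R \<le> r" for r using R' that by (simp add: R_def)
    show "(\<beta> * ln x) ^ 6 \<le> (\<beta> * ln y) ^ 6" if "1 \<le> x" "x \<le> y" for x y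
      using that b0 by (intro power_mono mult_left_mono ln_mono mult_nonneg_nonneg) auto
    show "summable (\<lambda>n. real n powr (- (6 * \<kappa>)))"
      using \<kappa> by (simp add: summable_real_powr_iff)
    show "0 \<le> real n powr (- (6 * \<kappa>))" for n by simp
    fix n :: nat and r :: real
    assume n: "n \<ge> n\<^sub>0" and r: "R \<le> r" "r \<notin> {}" and Tr: "real n \<le> ln (sigma_series a r)"
    define p where "p = \<kappa> * ln (real n)"
    have "exp (1 / \<kappa>) \<le> real n" using n unfolding n\<^sub>0_def by linarith
    moreover from this have n0: "real n > 0" by (rule less_le_trans[OF exp_gt_zero])
    ultimately have "1 / \<kappa> \<le> ln (real n)" by (simp add: ln_ge_iff)
    hence p: "p \<ge> 1" using \<kappa> by (simp add: p_def field_simps)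
    define L where "L = \<beta> * ln (real n)"
    have Lp: "L = C * p * exp 1" using C by (simp add: L_def p_def \<kappa>_def)
    have L: "L > 0" unfolding Lp using C p by simp
    have m1: "(\<integral>\<^sup>+\<omega>. (\<integral>\<^sup>+\<theta>\<in>{0..2 * pi}.
            ennreal (\<bar>ln (cmod (random_series a X \<omega> (of_real r * cis \<theta>) / of_real (sigma_series a r)))\<bar>
                       powr p / (2 * pi)) \<partial>lborel) \<partial>M) \<le> ennreal ((C * p) powr (6 * p))"
    proof -
      note * = lic[unfolded log_integrability_constant_def, THEN conjunct2, rule_format]
      show ?thesis
        by (rule *) (use rad summable_coeff m\<^sub>0 r R p in auto)
    qed
    have conv: "(\<integral>\<^sup>+\<theta>\<in>{0..2 * pi}.
            ennreal (\<bar>ln (cmod (random_series a X \<omega> (of_real r * cis \<theta>) / of_real (sigma_series a r)))\<bar>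
                       powr p / (2 * pi)) \<partial>lborel) =
        (\<integral>\<^sup>+\<theta>. ennreal (\<bar>ln (cmod (random_series a X \<omega> (of_real r * cis \<theta>) / of_real (sigma_series a r)))\<bar> powr p)
        \<partial>uniform_angle)" for \<omega>
    proof -
      have [measurable]: "cis \<in> borel_measurable borel"
        by (intro borel_measurable_continuous_onI continuous_intros)
      have [measurable]: "(\<lambda>\<theta>. random_series a X \<omega> (of_real r * cis \<theta>)) \<in> borel_measurable borel"
        unfolding random_series_def by measurable
      show ?thesis by (rule nn_integral_angle_interval) measurable
    qed
    have "(\<integral>\<^sup>+\<omega>. (\<integral>\<^sup>+\<theta>. ennreal (\<bar>ln (cmod (random_series a X \<omega> (of_real r * cis \<theta>) / of_real (sigma_series a r)))\<bar> powr p)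
        \<partial>uniform_angle) \<partial>M) \<le> ennreal ((C * p) powr (6 * p))"
      using m1 unfolding conv .
    note moment = this
    have "r > 0" "L ^ 6 > 0" "(C * p) powr (6 * p) \<ge> 0" using r R L by auto
    from rare_event_log_moment[OF p this moment]
    obtain D where D: "D \<in> events" "prob D \<le> (C * p) powr (6 * p) / (L ^ 6) powr p"
      "AE \<omega> in M. \<omega> \<notin> D \<longrightarrow> ln (sigma_series a r) - L ^ 6 \<le>
      (\<integral>\<theta>. ln (cmod (random_series a X \<omega> (of_real r * cis \<theta>))) \<partial>uniform_angle)"
      by blast
    have "(L ^ 6) powr p = L powr (6 * p)"
      using L powr_powr[of L 6 p] by simp
    also have "\<dots> = (C * p) powr (6 * p) * exp (6 * p)"
      unfolding Lp using C p by (simp add: powr_mult exp_powr_real)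
    finally have "(C * p) powr (6 * p) / (L ^ 6) powr p = exp (- (6 * p))"
      using C p by (simp add: exp_minus field_simps)
    also have "\<dots> = real n powr (- (6 * \<kappa>))"
      using n0 by (simp add: powr_def p_def)
    finally have "prob D \<le> real n powr (- (6 * \<kappa>))" using D(2) by simp
    moreover have "AE \<omega> in M. \<omega> \<notin> D \<longrightarrow> real n - (\<beta> * ln (real n)) ^ 6 \<le>
      (\<integral>\<theta>. ln (cmod (random_series a X \<omega> (of_real r * cis \<theta>) - 0)) \<partial>uniform_angle)"
      using D(3)
    proof eventually_elim
      case (elim \<omega>)
      thus ?case using Tr by (auto simp: L_def)
    qed
    ultimately show "\<exists>D\<in>events. prob D \<le> real n powr (- (6 * \<kappa>)) \<and> (AE \<omega> in M. \<omega> \<notin> D \<longrightarrow> real n - (\<beta> * ln (real n)) ^ 6 \<le>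
      (\<integral>\<theta>. ln (cmod (random_series a X \<omega> (of_real r * cis \<theta>) - 0)) \<partial>uniform_angle))"
      using D(1) by blast
  qed
  thus ?thesis by simp
qed

end

section \<open>The three random sequences\<close>

text \<open>
  A disk of radius \<open>s \<le> 1\<close> has probability at most \<open>s\<^sup>2\<close>, because the density is bounded by \<open>1/\<pi>\<close>. For the mean,
  \<open>|X|\<close> is at most \<open>exp (|X|\<^sup>2 / 2)\<close>, whose expectation is the integral of \<open>exp (- |z|\<^sup>2 / 2) / \<pi>\<close>; the
  substitution \<open>z = \<surd>2 u\<close> turns this into twice the total mass of the Gaussian density.
\<close>
lemma (in prob_space) random_entire_of_gaussian:
  assumes ec: "entire_coefficients a m\<^sub>0" and g: "gaussian_sequence M X"
  shows "random_entire M a m\<^sub>0 X 2"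
    and "\<And>j w s. s > 0 \<Longrightarrow> prob {\<omega>\<in>space M. cmod (X j \<omega> - w) \<le> s} \<le> 1 * s"
proof -
  define f where "f z = ennreal (exp (- (cmod z)\<^sup>2) / pi)" for z
  have ind: "indep_vars (\<lambda>_. borel) X UNIV" and dist: "\<And>j. distributed M lborel (X j) f"
    using g unfolding gaussian_sequence_def f_def[abs_def] by auto
  have [measurable]: "random_variable borel (X j)" for j
    using ind by (auto simp: indep_vars_def)
  have [measurable]: "f \<in> borel_measurable borel" unfolding f_def[abs_def] by measurable
  have nn: "(\<integral>\<^sup>+\<omega>. u (X j \<omega>) \<partial>M) = (\<integral>\<^sup>+z. f z * u z \<partial>lborel)" if "u \<in> borel_measurable borel" for u j
    using distributed_nn_integral[OF dist[of j], of u] that by simp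
  show small: "prob {\<omega>\<in>space M. cmod (X j \<omega> - w) \<le> s} \<le> 1 * s" if s: "s > 0" for j w s
  proof (cases "s \<le> 1")
    case True
    have "emeasure M {\<omega>\<in>space M. cmod (X j \<omega> - w) \<le> s} = (\<integral>\<^sup>+\<omega>. indicator {\<omega>\<in>space M. cmod (X j \<omega> - w) \<le> s} \<omega> \<partial>M)"
      by (rule nn_integral_indicator[symmetric]) measurable
    also have "\<dots> = (\<integral>\<^sup>+\<omega>. indicator (cball w s) (X j \<omega>) \<partial>M)"
      by (intro nn_integral_cong) (auto simp: indicator_def dist_norm norm_minus_commute)
    also have "\<dots> = (\<integral>\<^sup>+z. f z * indicator (cball w s) z \<partial>lborel)"
      by (rule nn, rule borel_measurable_indicator) simp
    also have "\<dots> \<le> (\<integral>\<^sup>+z. ennreal (1 / pi) * indicator (cball w s) z \<partial>lborel)"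
      by (intro nn_integral_mono mult_right_mono) (auto simp: f_def intro!: ennreal_leI divide_right_mono)
    also have "\<dots> = ennreal (1 / pi) * ennreal (pi * s\<^sup>2)"
      using s by (subst nn_integral_cmult_indicator) (auto simp: emeasure_cball unit_ball_vol_2)
    also have "\<dots> = ennreal (s\<^sup>2)" by (simp flip: ennreal_mult)
    finally have "prob {\<omega>\<in>space M. cmod (X j \<omega> - w) \<le> s} \<le> s\<^sup>2" by (simp add: emeasure_eq_measure)
    also have "\<dots> \<le> s" using s True by (simp add: power2_eq_square mult_left_le)
    finally show ?thesis by simp
  next
    case False
    thus ?thesis using prob_le_1[of "{\<omega>\<in>space M. cmod (X j \<omega> - w) \<le> s}"] by linarith
  qed
  have "(\<integral>\<^sup>+\<omega>. ennreal (cmod (X j \<omega>)) \<partial>M) \<le> ennreal 2" for j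
  proof -
    have le: "x \<le> exp (x\<^sup>2 / 2)" for x :: real
    proof -
      have "0 \<le> (x - 1)\<^sup>2" by simp
      hence "x \<le> 1 + x\<^sup>2 / 2" by (simp add: power2_eq_square algebra_simps)
      also have "\<dots> \<le> exp (x\<^sup>2 / 2)" by (rule exp_ge_add_one_self)
      finally show ?thesis .
    qed
    have "(\<integral>\<^sup>+\<omega>. ennreal (cmod (X j \<omega>)) \<partial>M) \<le> (\<integral>\<^sup>+\<omega>. ennreal (exp ((cmod (X j \<omega>))\<^sup>2 / 2)) \<partial>M)"
      by (intro nn_integral_mono ennreal_leI le)
    also have "\<dots> = (\<integral>\<^sup>+z. f z * ennreal (exp ((cmod z)\<^sup>2 / 2)) \<partial>lborel)" by (rule nn) simp
    also have "\<dots> = (\<integral>\<^sup>+z. ennreal (exp (- (cmod z)\<^sup>2 / 2) / pi) \<partial>lborel)"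
      by (intro nn_integral_cong) (simp add: f_def flip: ennreal_mult exp_add)
    also have "\<dots> = (\<integral>\<^sup>+z. ennreal (exp (- (cmod z)\<^sup>2 / 2) / pi)
        \<partial>density (distr lborel borel (\<lambda>x. 0 + sqrt 2 *\<^sub>R x)) (\<lambda>_. ennreal (\<bar>sqrt 2\<bar> ^ DIM(complex))))"
      by (rule arg_cong[where f = "\<lambda>N. nn_integral N (\<lambda>z. ennreal (exp (- (cmod z)\<^sup>2 / 2) / pi))"], rule lborel_affine) simp
    also have "\<dots> = (\<integral>\<^sup>+z. ennreal (\<bar>sqrt 2\<bar> ^ DIM(complex)) * ennreal (exp (- (cmod z)\<^sup>2 / 2) / pi)
        \<partial>distr lborel borel (\<lambda>x. 0 + sqrt 2 *\<^sub>R x))"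
      by (rule nn_integral_density) measurable
    also have "\<dots> = (\<integral>\<^sup>+z. ennreal (\<bar>sqrt 2\<bar> ^ DIM(complex)) * ennreal (exp (- (cmod (0 + sqrt 2 *\<^sub>R z))\<^sup>2 / 2) / pi) \<partial>(lborel :: complex measure))"
      by (rule nn_integral_distr) measurable
    also have "\<dots> = (\<integral>\<^sup>+z. 2 * f z \<partial>lborel)"
      by (intro nn_integral_cong) (simp add: f_def power_mult_distrib)
    also have "\<dots> = 2 * (\<integral>\<^sup>+z. f z * 1 \<partial>lborel)" by (simp add: nn_integral_cmult)
    also have "(\<integral>\<^sup>+z. f z * 1 \<partial>lborel) = (\<integral>\<^sup>+\<omega>. 1 \<partial>M)" by (rule nn[symmetric]) simp
    finally show ?thesis by (simp add: emeasure_space_1)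
  qed
  moreover have "AE \<omega> in M. X j \<omega> \<noteq> 0" for j
  proof -
    have "AE \<omega> in M. cmod (X j \<omega>) > 0"
      by (rule small_ball_AE_pos[where K = 1]) (use small[of _ j 0] in auto)
    thus ?thesis by simp
  qed
  ultimately show "random_entire M a m\<^sub>0 X 2"
    using ind ec by (intro random_entire.intro random_entire_axioms.intro prob_space_axioms) auto
qed

lemma (in prob_space) uniform_interval_angle:
  assumes m: "random_variable borel \<theta>" and u: "distr M lborel \<theta> = uniform_measure lborel {0..1::real}"
    and [measurable]: "A \<in> sets borel"
  shows "prob {\<omega>\<in>space M. 2 * pi * \<theta> \<omega> \<in> A} = uniform_angle.prob A"
proof -
  note [measurable] = m
  define A' where "A' = {t. 2 * pi * t \<in> A}"
  have [measurable]: "A' \<in> sets borel"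
  proof -
    have "(\<lambda>t. 2 * pi * t) -` A \<inter> space borel \<in> sets borel" by measurable
    thus ?thesis by (simp add: A'_def vimage_def)
  qed
  have "emeasure M {\<omega>\<in>space M. 2 * pi * \<theta> \<omega> \<in> A} = emeasure (distr M lborel \<theta>) A'"
    by (subst emeasure_distr) (auto simp: A'_def intro!: arg_cong[where f = "emeasure M"])
  also have "\<dots> = emeasure lborel ({0..1} \<inter> A')"
    unfolding u by (subst emeasure_uniform_measure) (auto simp: divide_ennreal_def)
  also have "\<dots> = (\<integral>\<^sup>+x. indicator ({0..1} \<inter> A') x \<partial>lborel)" by simp
  also have "\<dots> = (\<integral>\<^sup>+x. ennreal (2 * pi) * (indicator A (0 + 2 * pi * x) * ennreal (1 / (2 * pi)) * indicator {0..2 * pi} (0 + 2 * pi * x)) \<partial>lborel)"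
    by (intro nn_integral_cong) (use pi_gt_zero in \<open>auto simp: indicator_def A'_def zero_le_mult_iff not_le[symmetric] simp flip: ennreal_mult\<close>)
  also have "\<dots> = ennreal (2 * pi) * (\<integral>\<^sup>+x. (indicator A (0 + 2 * pi * x) * ennreal (1 / (2 * pi)) * indicator {0..2 * pi} (0 + 2 * pi * x)) \<partial>lborel)"
    by (intro nn_integral_cmult) measurable
  also have "\<dots> = (\<integral>\<^sup>+x\<in>{0..2 * pi}. indicator A x * ennreal (1 / (2 * pi)) \<partial>lborel)"
    by (subst nn_integral_real_affine[where c = "2 * pi" and t = 0]) auto
  also have "\<dots> = (\<integral>\<^sup>+x. indicator A x \<partial>uniform_angle)"
    by (rule nn_integral_uniform_angle[symmetric]) simp
  also have "\<dots> = emeasure uniform_angle A" by simp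
  finally show ?thesis by (simp add: emeasure_eq_measure uniform_angle.emeasure_eq_measure)
qed

lemma (in prob_space) random_entire_of_uniform_phases:
  assumes ec: "entire_coefficients a m\<^sub>0" and ind: "indep_vars (\<lambda>_. borel) \<theta> UNIV"
    and u: "\<And>j. distr M lborel (\<theta> j) = uniform_measure lborel {0..1::real}"
  shows "random_entire M a m\<^sub>0 (\<lambda>j \<omega>. cis (2 * pi * \<theta> j \<omega>)) 1"
    and "\<And>j w s. s > 0 \<Longrightarrow> prob {\<omega>\<in>space M. cmod (cis (2 * pi * \<theta> j \<omega>) - w) \<le> s} \<le> 2 * s"
proof -
  have c [measurable]: "cis \<in> borel_measurable borel"
    by (intro borel_measurable_continuous_onI continuous_intros)
  have m: "random_variable borel (\<theta> j)" for j
    using ind by (auto simp: indep_vars_def)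
  have "indep_vars (\<lambda>_. borel) (\<lambda>j \<omega>. cis (2 * pi * \<theta> j \<omega>)) UNIV"
    using ind by (rule indep_vars_compose2) measurable
  thus "random_entire M a m\<^sub>0 (\<lambda>j \<omega>. cis (2 * pi * \<theta> j \<omega>)) 1"
    using ec by (intro random_entire.intro random_entire_axioms.intro prob_space_axioms) (auto simp: emeasure_space_1)
  fix j w and s :: real assume s: "s > 0"
  have [measurable]: "{\<theta>. cmod (cis \<theta> - w) \<le> s} \<in> sets borel"
    by (intro borel_closed closed_Collect_le continuous_intros)
  show "prob {\<omega>\<in>space M. cmod (cis (2 * pi * \<theta> j \<omega>) - w) \<le> s} \<le> 2 * s"
    using uniform_interval_angle[OF m[of j] u[of j], of "{\<theta>. cmod (cis \<theta> - w) \<le> s}"] uniform_angle_small_ball[OF s, of w]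
    by simp
qed

lemma (in prob_space) AE_rademacher:
  assumes "rademacher_sequence M X"
  shows "AE \<omega> in M. X j \<omega> = 1 \<or> X j \<omega> = - 1"
proof -
  have [measurable]: "random_variable borel (X j)"
    using assms by (auto simp: rademacher_sequence_def indep_vars_def)
  have "prob {\<omega>\<in>space M. X j \<omega> = 1 \<or> X j \<omega> = - 1} = prob ({\<omega>\<in>space M. X j \<omega> = 1} \<union> {\<omega>\<in>space M. X j \<omega> = - 1})"
    by (intro arg_cong[where f = prob]) auto
  also have "\<dots> = prob {\<omega>\<in>space M. X j \<omega> = 1} + prob {\<omega>\<in>space M. X j \<omega> = - 1}"
    by (intro finite_measure_Union) auto
  also have "\<dots> = 1 / 2 + 1 / 2" using assms unfolding rademacher_sequence_def by metis
  also have "\<dots> = 1" by simp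
  finally show ?thesis
    by (subst (asm) prob_Collect_eq_1) auto
qed

lemma (in prob_space) random_entire_of_rademacher:
  assumes ec: "entire_coefficients a m\<^sub>0" and rad: "rademacher_sequence M X"
  shows "random_entire M a m\<^sub>0 X 1"
proof -
  have "(\<integral>\<^sup>+\<omega>. ennreal (cmod (X j \<omega>)) \<partial>M) \<le> ennreal 1" for j
  proof -
    have "(\<integral>\<^sup>+\<omega>. ennreal (cmod (X j \<omega>)) \<partial>M) = (\<integral>\<^sup>+\<omega>. 1 \<partial>M)"
      by (rule nn_integral_cong_AE) (use AE_rademacher[OF rad, of j] in \<open>eventually_elim, auto\<close>)
    thus ?thesis by (simp add: emeasure_space_1)
  qed
  moreover have "AE \<omega> in M. X j \<omega> \<noteq> 0" for j
    using AE_rademacher[OF rad, of j] by eventually_elim auto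
  ultimately show ?thesis
    using ec rad by (intro random_entire.intro random_entire_axioms.intro prob_space_axioms) (auto simp: rademacher_sequence_def)
qed

lemma entire_coefficients_update:
  assumes "entire_coefficients a m\<^sub>0"
  shows "entire_coefficients (a(0 := v)) m\<^sub>0"
proof -
  interpret entire_coefficients a m\<^sub>0 by fact
  show ?thesis
  proof
    fix z
    have "summable (\<lambda>j. a j * z ^ j + (if j = 0 then v - a 0 else 0))"
      by (intro summable_add summable_coeff) (rule sums_summable[OF sums_single])
    also have "(\<lambda>j. a j * z ^ j + (if j = 0 then v - a 0 else 0)) = (\<lambda>j. (a(0 := v)) j * z ^ j)"
      by auto
    finally show "summable (\<lambda>j. (a(0 := v)) j * z ^ j)" .
  qed (use m\<^sub>0 in auto)
qed

text \<open>
  Changing the constant coefficient changes \<open>\<sigma>\<^sup>2\<close> by a constant, while \<open>\<sigma>\<close> tends to infinity.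
\<close>
lemma ln_sigma_update:
  assumes "entire_coefficients a m\<^sub>0"
  shows "eventually (\<lambda>r. \<bar>ln (sigma_series (a(0 := v)) r) - ln (sigma_series a r)\<bar> \<le> 1) at_top"
proof -
  interpret A: entire_coefficients a m\<^sub>0 by fact
  interpret B: entire_coefficients "a(0 := v)" m\<^sub>0 by (rule entire_coefficients_update) fact
  define d where "d = (cmod v)\<^sup>2 - (cmod (a 0))\<^sup>2"
  have diff: "B.energy x = A.energy x + d" for x
  proof -
    have "(\<lambda>j. (cmod (a j))\<^sup>2 * x ^ j + (if j = 0 then d else 0)) sums (A.energy x + d)"
      unfolding A.energy_def by (intro sums_add summable_sums A.summable_energy sums_single)
    also have "(\<lambda>j. (cmod (a j))\<^sup>2 * x ^ j + (if j = 0 then d else 0)) = (\<lambda>j. (cmod ((a(0 := v)) j))\<^sup>2 * x ^ j)"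
      by (auto simp: d_def)
    finally show ?thesis unfolding B.energy_def by (rule sums_unique[symmetric])
  qed
  have "eventually (\<lambda>r. ln (sigma_series a r) \<ge> ln (2 * \<bar>d\<bar> + 1)) at_top"
    using A.ln_sigma_at_top unfolding filterlim_at_top by blast
  thus ?thesis using eventually_gt_at_top[of 0]
  proof eventually_elim
    case (elim r)
    define e where "e = A.energy (r\<^sup>2)"
    have e: "e > 0" "e + d > 0"
      using A.energy_pos[of "r\<^sup>2"] B.energy_pos[of "r\<^sup>2"] elim by (auto simp: e_def diff)
    have "2 * \<bar>d\<bar> + 1 \<le> sigma_series a r"
      using elim A.sigma_series_pos[of r] by (subst (asm) ln_le_cancel_iff) auto
    hence "(2 * \<bar>d\<bar> + 1)\<^sup>2 \<le> (sigma_series a r)\<^sup>2" by (intro power_mono) auto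
    also have "\<dots> = e" using e by (simp add: A.sigma_series_eq e_def)
    finally have "(2 * \<bar>d\<bar> + 1)\<^sup>2 \<le> e" .
    moreover have "2 * \<bar>d\<bar> \<le> (2 * \<bar>d\<bar> + 1)\<^sup>2" by (simp add: power2_eq_square algebra_simps)
    ultimately have d: "2 * \<bar>d\<bar> \<le> e" by linarith
    have ex: "(2::real) \<le> exp 2" using exp_ge_add_one_self[of 2] by linarith
    have "e + d \<le> 2 * e" using d abs_ge_self[of d] by linarith
    also have "\<dots> \<le> exp 2 * e" using ex e by (intro mult_right_mono) auto
    finally have "ln (e + d) \<le> ln (exp 2 * e)" using e by (subst ln_le_cancel_iff) auto
    hence 1: "ln (e + d) \<le> 2 + ln e" using e by (simp add: ln_mult_pos)
    have "e \<le> 2 * (e + d)" using d abs_ge_minus_self[of d] by argo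
    also have "\<dots> \<le> exp 2 * (e + d)" using ex e by (intro mult_right_mono) auto
    finally have "ln e \<le> ln (exp 2 * (e + d))" using e by (subst ln_le_cancel_iff) auto
    hence 2: "ln e \<le> 2 + ln (e + d)" using e by (simp add: ln_mult_pos)
    have "ln e = 2 * ln (sigma_series a r)" "ln (e + d) = 2 * ln (sigma_series (a(0 := v)) r)"
      using A.ln_energy[of r] B.ln_energy[of r] elim by (simp_all add: e_def diff)
    with 1 2 show ?case by linarith
  qed
qed

lemma asymptotic_sixth_power:
  fixes \<beta> \<gamma> K :: real
  assumes \<beta>: "\<beta> \<ge> 0" "\<beta> ^ 6 < \<gamma>"
  shows "eventually (\<lambda>x. (\<beta> * ln (x + 1)) ^ 6 + K \<le> \<gamma> * (ln x) ^ 6) at_top"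
proof -
  have inv: "((\<lambda>y::real. inverse y) \<longlongrightarrow> 0) at_top" by (rule tendsto_inverse_0_at_top) (rule filterlim_ident)
  have "((\<lambda>y. (\<beta> * (1 + inverse y)) ^ 6 + K * inverse y ^ 6) \<longlongrightarrow> (\<beta> * (1 + 0)) ^ 6 + K * 0 ^ 6) at_top"
    by (intro tendsto_intros inv)
  hence "eventually (\<lambda>y. (\<beta> * (1 + inverse y)) ^ 6 + K * inverse y ^ 6 < \<gamma>) at_top"
    using \<beta> by (intro order_tendstoD(2)) auto
  hence "eventually (\<lambda>y. (\<beta> * (y + 1)) ^ 6 + K \<le> \<gamma> * y ^ 6) at_top"
    using eventually_gt_at_top[of 0]
  proof eventually_elim
    case (elim y)
    have "((\<beta> * (1 + inverse y)) ^ 6 + K * inverse y ^ 6) * y ^ 6 \<le> \<gamma> * y ^ 6"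
      using elim by (intro mult_right_mono) auto
    moreover have "((\<beta> * (1 + inverse y)) ^ 6 + K * inverse y ^ 6) * y ^ 6 = (\<beta> * (1 + inverse y) * y) ^ 6 + K * (inverse y * y) ^ 6"
    proof -
      have "(u ^ 6 + K * v ^ 6) * w ^ 6 = (u * w) ^ 6 + K * (v * w) ^ 6" for u v w :: real
        by (simp add: distrib_right power_mult_distrib)
      thus ?thesis .
    qed
    moreover have "\<beta> * (1 + inverse y) * y = \<beta> * (y + 1)" "inverse y * y = 1" using elim by (simp_all add: field_simps)
    ultimately show ?case by simp
  qed
  from eventually_compose_filterlim[OF this ln_at_top]
  show ?thesis using eventually_ge_at_top[of 1]
  proof eventually_elim
    case (elim x)
    have "ln (x + 1) \<le> ln (2 * x)" using elim by simp
    also have "\<dots> = ln 2 + ln x" using elim by (simp add: ln_mult_pos)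
    also have "\<dots> \<le> ln x + 1" using ln_le_minus_one[of 2] by simp
    finally have "(\<beta> * ln (x + 1)) ^ 6 \<le> (\<beta> * (ln x + 1)) ^ 6"
      using \<beta> elim by (intro power_mono mult_left_mono) auto
    thus ?case using elim by linarith
  qed
qed

text \<open>
  As \<open>X\<^sub>0\<close> is \<open>1\<close> or \<open>-1\<close>, \<open>X\<^sub>0 a\<^sub>0 - c = X\<^sub>0 (a\<^sub>0 - X\<^sub>0 c)\<close>. Hence \<open>f\<^sub>\<omega> - c\<close> is one of the two Rademacher series
  with constant coefficient \<open>a\<^sub>0 - c\<close> or \<open>a\<^sub>0 + c\<close>, according to the value of \<open>X\<^sub>0\<close>, and the case of value zero
  applies almost surely to both.
\<close>
lemma (in prob_space) rademacher_lower_bound_shifted: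
  assumes ec: "entire_coefficients a m\<^sub>0" and rad: "rademacher_sequence M X"
    and lic: "log_integrability_constant M C" and \<epsilon>: "\<epsilon> > 0"
  shows "AE \<omega> in M. \<exists>r\<^sub>0. \<forall>r>r\<^sub>0. ln (sigma_series a r) \<le> integrated_count r c (random_series a X \<omega>)
           + ((exp 1 * C / 6) ^ 6 + \<epsilon>) * (ln (ln (sigma_series a r))) ^ 6"
proof -
  interpret A: random_entire M a m\<^sub>0 X 1 by (rule random_entire_of_rademacher[OF ec rad])
  have C: "C > 0" using lic by (simp add: log_integrability_constant_def)
  \<comment> \<open>Halfway between the two bounds for \<open>\<beta>\<close> to the sixth power: summability needs more than \<open>(e C / 6)\<close> to
    the sixth power, and the claim allows \<open>\<epsilon>\<close> in addition.\<close>
  define \<beta> where "\<beta> = root 6 ((exp 1 * C / 6) ^ 6 + \<epsilon> / 2)"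
  have b6: "\<beta> ^ 6 = (exp 1 * C / 6) ^ 6 + \<epsilon> / 2"
    unfolding \<beta>_def using \<epsilon> by (intro real_root_pow_pos2) auto
  have b0: "\<beta> \<ge> 0" using \<epsilon> unfolding \<beta>_def by (intro real_root_ge_zero) auto
  have "(exp 1 * C / 6) ^ 6 < \<beta> ^ 6" unfolding b6 using \<epsilon> by linarith
  hence "exp 1 * C / 6 < \<beta>" by (rule power_less_imp_less_base) (rule b0)
  hence \<beta>: "6 * \<beta> > exp 1 * C" by simp
  define b where "b s = a(0 := a 0 - s * c)" for s :: complex
  have ecb: "entire_coefficients (b s) m\<^sub>0" for s unfolding b_def by (rule entire_coefficients_update[OF ec])
  have res: "AE \<omega> in M. \<exists>K r\<^sub>0. \<forall>r>r\<^sub>0.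
     ln (sigma_series (b s) r) \<le> integrated_count r 0 (random_series (b s) X \<omega>) + (\<beta> * ln (ln (sigma_series (b s) r))) ^ 6 + K" for s
  proof -
    interpret B: random_entire M "b s" m\<^sub>0 X 1 by (rule random_entire_of_rademacher[OF ecb rad])
    show ?thesis by (rule B.rademacher_lower_bound[OF rad lic \<beta>])
  qed
  from res[of 1] res[of "- 1"] AE_rademacher[OF rad, of 0] A.AE_summable show ?thesis
  proof eventually_elim
    case (elim \<omega>)
    define s where "s = X 0 \<omega>"
    have s: "s = 1 \<or> s = - 1" using elim(3) by (simp add: s_def)
    obtain K r\<^sub>0 where K: "\<And>r. r > r\<^sub>0 \<Longrightarrow>
      ln (sigma_series (b s) r) \<le> integrated_count r 0 (random_series (b s) X \<omega>) + (\<beta> * ln (ln (sigma_series (b s) r))) ^ 6 + K"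
      using s elim(1,2) by blast
    have shift: "random_series (b s) X \<omega> z = random_series a X \<omega> z - c" for z
    proof -
      have "(\<lambda>j. X j \<omega> * a j * z ^ j - (if j = 0 then c else 0)) sums (random_series a X \<omega> z - c)"
        unfolding random_series_def using elim(4) by (intro sums_diff sums_single summable_sums) auto
      also have "(\<lambda>j. X j \<omega> * a j * z ^ j - (if j = 0 then c else 0)) = (\<lambda>j. X j \<omega> * b s j * z ^ j)"
        using s by (auto simp: b_def s_def algebra_simps)
      finally show ?thesis unfolding random_series_def by (rule sums_unique[symmetric])
    qed
    have cnt: "integrated_count r 0 (random_series (b s) X \<omega>) = integrated_count r c (random_series a X \<omega>)" for r
      by (simp add: integrated_count_def shift)
    have "eventually (\<lambda>x. (\<beta> * ln (x + 1)) ^ 6 + (K + 1) \<le> ((exp 1 * C / 6) ^ 6 + \<epsilon>) * (ln x) ^ 6) at_top"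
      by (rule asymptotic_sixth_power) (use b0 b6 \<epsilon> in auto)
    from eventually_compose_filterlim[OF this A.ln_sigma_at_top]
    have e1: "eventually (\<lambda>r. (\<beta> * ln (ln (sigma_series a r) + 1)) ^ 6 + (K + 1) \<le> ((exp 1 * C / 6) ^ 6 + \<epsilon>) * (ln (ln (sigma_series a r))) ^ 6) at_top" .
    have e2: "eventually (\<lambda>r. \<bar>ln (sigma_series (b s) r) - ln (sigma_series a r)\<bar> \<le> 1) at_top"
      unfolding b_def by (rule ln_sigma_update[OF ec])
    have e3: "eventually (\<lambda>r. ln (sigma_series a r) \<ge> 2) at_top"
      using A.ln_sigma_at_top unfolding filterlim_at_top by blast
    from e1 e2 e3 eventually_gt_at_top[of r\<^sub>0]
    have "eventually (\<lambda>r. ln (sigma_series a r) \<le> integrated_count r c (random_series a X \<omega>)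
           + ((exp 1 * C / 6) ^ 6 + \<epsilon>) * (ln (ln (sigma_series a r))) ^ 6) at_top"
    proof eventually_elim
      case (elim r)
      have "ln (ln (sigma_series (b s) r)) \<le> ln (ln (sigma_series a r) + 1)"
        using elim by (subst ln_le_cancel_iff) auto
      moreover have "0 \<le> ln (ln (sigma_series (b s) r))" using elim by (intro ln_ge_zero) linarith
      ultimately have "(\<beta> * ln (ln (sigma_series (b s) r))) ^ 6 \<le> (\<beta> * ln (ln (sigma_series a r) + 1)) ^ 6"
        using b0 by (intro power_mono mult_left_mono mult_nonneg_nonneg) auto
      thus ?case using K[of r] elim unfolding cnt by linarith
    qed
    then obtain N where "\<And>r. r \<ge> N \<Longrightarrow> ln (sigma_series a r) \<le> integrated_count r c (random_series a X \<omega>)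
           + ((exp 1 * C / 6) ^ 6 + \<epsilon>) * (ln (ln (sigma_series a r))) ^ 6"
      unfolding eventually_at_top_linorder by blast
    thus ?case by (intro exI[of _ N]) auto
  qed
qed

section \<open>The lower bounds for N(r, a, f)\<close>

lemma transcendental_nonconstant_coefficient:
  assumes f: "transcendental_entire f" and sums: "\<And>z. (\<lambda>j. a j * z ^ j) sums f z"
  obtains m where "m \<ge> 1" "a m \<noteq> 0"
proof (rule ccontr)
  assume "\<not> thesis"
  hence a0: "a j = 0" if "j \<ge> 1" for j using that \<open>\<And>m. m \<ge> 1 \<Longrightarrow> a m \<noteq> 0 \<Longrightarrow> thesis\<close> by blast
  have "f z = poly [:a 0:] z" for z
  proof -
    have "(\<lambda>j. a j * z ^ j) = (\<lambda>j. if j = 0 then a 0 else 0)"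
      using a0 by (auto simp: fun_eq_iff)
    hence "(\<lambda>j. if j = 0 then a 0 else 0) sums f z" using sums[of z] by simp
    from sums_unique2[OF this sums_single] show ?thesis by simp
  qed
  thus False using f unfolding transcendental_entire_def by blast
qed

theorem corollary3p5:
  fixes M :: "'w measure" and X :: "nat \<Rightarrow> 'w \<Rightarrow> complex"
    and f :: "complex \<Rightarrow> complex" and a :: "nat \<Rightarrow> complex"
    and C\<^sub>0 \<epsilon> :: real
  assumes "prob_space M"
    and "transcendental_entire f"
    and "\<And>z. (\<lambda>j. a j * z ^ j) sums f z"
    and "\<epsilon> > 0"
  shows "\<exists>E. finite_log_measure E \<and>
    (\<forall>c :: complex. AE \<omega> in M. \<exists>r\<^sub>0 :: real. \<forall>r. r > r\<^sub>0 \<longrightarrow> r \<notin> E \<longrightarrow>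
      (gaussian_sequence M X \<longrightarrow>
         ln (sigma_series a r) \<le> integrated_count r c (random_series a X \<omega>)
           + (3 / 2 + \<epsilon>) * ln (ln (sigma_series a r))) \<and>
      (rademacher_sequence M X \<longrightarrow> log_integrability_constant M C\<^sub>0 \<longrightarrow>
         ln (sigma_series a r) \<le> integrated_count r c (random_series a X \<omega>)
           + ((exp 1 * C\<^sub>0 / 6) ^ 6 + \<epsilon>) * (ln (ln (sigma_series a r))) ^ 6) \<and>
      (steinhaus_sequence M X \<longrightarrow>
         ln (sigma_series a r) \<le> integrated_count r c (random_series a X \<omega>)
           + (2 + \<epsilon>) * ln (ln (sigma_series a r))))"
proof -
  interpret prob_space M by fact
  note \<epsilon> = assms(4)
  obtain m\<^sub>0 where m0: "m\<^sub>0 \<ge> 1" "a m\<^sub>0 \<noteq> 0"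
    using transcendental_nonconstant_coefficient[OF assms(2,3)] .
  have ec: "entire_coefficients a m\<^sub>0"
    by unfold_locales (use assms(3) m0 in \<open>auto intro: sums_summable\<close>)
  obtain R E where R: "R \<ge> 1" and E: "finite_log_measure E" and cl: "closed {r. R \<le> r \<and> r \<notin> E}"
    and T1: "\<And>r. R \<le> r \<Longrightarrow> ln (sigma_series a r) \<ge> 1"
    and big_term: "\<And>r. R \<le> r \<Longrightarrow> r \<notin> E \<Longrightarrow>
       \<exists>m. (sigma_series a r)\<^sup>2 \<le> 2 * ((2 * ln (sigma_series a r)) powr (1 + \<epsilon>) + 1) * (cmod (a m) * r ^ m)\<^sup>2"
    using entire_coefficients.exceptional_set[OF ec \<epsilon>] by blast
  have gauss: "AE \<omega> in M. \<exists>r\<^sub>0. \<forall>r>r\<^sub>0. r \<notin> E \<longrightarrow> gaussian_sequence M X \<longrightarrow>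
         ln (sigma_series a r) \<le> integrated_count r c (random_series a X \<omega>)
           + (3 / 2 + \<epsilon>) * ln (ln (sigma_series a r))" for c
  proof (cases "gaussian_sequence M X")
    case True
    interpret G: random_entire M a m\<^sub>0 X 2 by (rule random_entire_of_gaussian(1)[OF ec True])
    have "AE \<omega> in M. \<exists>r\<^sub>0. \<forall>r>r\<^sub>0. r \<notin> E \<longrightarrow> ln (sigma_series a r) \<le>
        integrated_count r c (random_series a X \<omega>) + (3 / 2 + \<epsilon>) * ln (ln (sigma_series a r))"
    proof (rule G.small_ball_lower_bound[OF _ \<epsilon> R cl])
      show "prob {\<omega>\<in>space M. cmod (X j \<omega> - w) \<le> s} \<le> 1 * s" if "s > 0" for j w s
        by (rule random_entire_of_gaussian(2)[OF ec True that])
    qed (rule T1 big_term; assumption)+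
    thus ?thesis by eventually_elim blast
  qed auto
  have rademacher: "AE \<omega> in M. \<exists>r\<^sub>0. \<forall>r>r\<^sub>0. rademacher_sequence M X \<longrightarrow> log_integrability_constant M C\<^sub>0 \<longrightarrow>
         ln (sigma_series a r) \<le> integrated_count r c (random_series a X \<omega>)
           + ((exp 1 * C\<^sub>0 / 6) ^ 6 + \<epsilon>) * (ln (ln (sigma_series a r))) ^ 6" for c
  proof (cases "rademacher_sequence M X \<and> log_integrability_constant M C\<^sub>0")
    case True
    from rademacher_lower_bound_shifted[OF ec conjunct1[OF True] conjunct2[OF True] \<epsilon>, of c]
    show ?thesis by eventually_elim blast
  qed auto
  have steinhaus: "AE \<omega> in M. \<exists>r\<^sub>0. \<forall>r>r\<^sub>0. r \<notin> E \<longrightarrow> steinhaus_sequence M X \<longrightarrow>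
         ln (sigma_series a r) \<le> integrated_count r c (random_series a X \<omega>)
           + (2 + \<epsilon>) * ln (ln (sigma_series a r))" for c
  proof (cases "steinhaus_sequence M X")
    case True
    then obtain \<theta> where th: "indep_vars (\<lambda>_. borel) \<theta> UNIV"
        "\<And>j. distr M lborel (\<theta> j) = uniform_measure lborel {0..1::real}"
        "\<And>j \<omega>. \<omega> \<in> space M \<Longrightarrow> X j \<omega> = exp (2 * of_real pi * \<i> * of_real (\<theta> j \<omega>))"
      unfolding steinhaus_sequence_def by blast
    define X' where "X' j \<omega> = cis (2 * pi * \<theta> j \<omega>)" for j \<omega>
    interpret S: random_entire M a m\<^sub>0 X' 1
      unfolding X'_def[abs_def] by (rule random_entire_of_uniform_phases(1)[OF ec th(1,2)])
    have small: "prob {\<omega>\<in>space M. cmod (X' j \<omega> - w) \<le> s} \<le> 2 * s" if "s > 0" for j w s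
      unfolding X'_def by (rule random_entire_of_uniform_phases(2)[OF ec th(1,2) that])
    have X_eq: "random_series a X \<omega> = random_series a X' \<omega>" if "\<omega> \<in> space M" for \<omega>
      using th(3)[OF that] by (simp add: random_series_def X'_def cis_conv_exp mult_ac fun_eq_iff)
    have "AE \<omega> in M. \<exists>r\<^sub>0. \<forall>r>r\<^sub>0. r \<notin> E \<longrightarrow> ln (sigma_series a r) \<le>
        integrated_count r c (random_series a X' \<omega>) + (3 / 2 + \<epsilon>) * ln (ln (sigma_series a r))"
    proof (rule S.small_ball_lower_bound[OF _ \<epsilon> R cl])
      show "prob {\<omega>\<in>space M. cmod (X' j \<omega> - w) \<le> s} \<le> 2 * s" if "s > 0" for j w s
        using that by (rule small)
    qed (rule T1 big_term; assumption)+
    with AE_space show ?thesis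
    proof eventually_elim
      case (elim \<omega>)
      then obtain r\<^sub>0 where r0: "\<And>r. r > r\<^sub>0 \<Longrightarrow> r \<notin> E \<Longrightarrow> ln (sigma_series a r) \<le>
          integrated_count r c (random_series a X \<omega>) + (3 / 2 + \<epsilon>) * ln (ln (sigma_series a r))"
        unfolding X_eq[OF elim(1)] by blast
      show ?case
      proof (intro exI[of _ "max r\<^sub>0 R"] allI impI)
        fix r assume r: "r > max r\<^sub>0 R" "r \<notin> E"
        have "(3 / 2 + \<epsilon>) * ln (ln (sigma_series a r)) \<le> (2 + \<epsilon>) * ln (ln (sigma_series a r))"
          using T1[of r] r by (intro mult_right_mono ln_ge_zero) auto
        thus "ln (sigma_series a r) \<le> integrated_count r c (random_series a X \<omega>) + (2 + \<epsilon>) * ln (ln (sigma_series a r))"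
          using r0[of r] r by simp
      qed
    qed
  qed auto
  show ?thesis
  proof (intro exI[of _ E] conjI E allI)
    fix c :: complex
    from gauss[of c] rademacher[of c] steinhaus[of c]
    show "AE \<omega> in M. \<exists>r\<^sub>0 :: real. \<forall>r. r > r\<^sub>0 \<longrightarrow> r \<notin> E \<longrightarrow>
      (gaussian_sequence M X \<longrightarrow>
         ln (sigma_series a r) \<le> integrated_count r c (random_series a X \<omega>)
           + (3 / 2 + \<epsilon>) * ln (ln (sigma_series a r))) \<and>
      (rademacher_sequence M X \<longrightarrow> log_integrability_constant M C\<^sub>0 \<longrightarrow>
         ln (sigma_series a r) \<le> integrated_count r c (random_series a X \<omega>)
           + ((exp 1 * C\<^sub>0 / 6) ^ 6 + \<epsilon>) * (ln (ln (sigma_series a r))) ^ 6) \<and>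
      (steinhaus_sequence M X \<longrightarrow>
         ln (sigma_series a r) \<le> integrated_count r c (random_series a X \<omega>)
           + (2 + \<epsilon>) * ln (ln (sigma_series a r)))"
    proof eventually_elim
      case (elim \<omega>)
      then obtain r1 r2 r3 where
        1: "\<forall>r>r1. r \<notin> E \<longrightarrow> gaussian_sequence M X \<longrightarrow>
         ln (sigma_series a r) \<le> integrated_count r c (random_series a X \<omega>)
           + (3 / 2 + \<epsilon>) * ln (ln (sigma_series a r))" and
        2: "\<forall>r>r2. rademacher_sequence M X \<longrightarrow> log_integrability_constant M C\<^sub>0 \<longrightarrow>
         ln (sigma_series a r) \<le> integrated_count r c (random_series a X \<omega>)
           + ((exp 1 * C\<^sub>0 / 6) ^ 6 + \<epsilon>) * (ln (ln (sigma_series a r))) ^ 6" and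
        3: "\<forall>r>r3. r \<notin> E \<longrightarrow> steinhaus_sequence M X \<longrightarrow>
         ln (sigma_series a r) \<le> integrated_count r c (random_series a X \<omega>)
           + (2 + \<epsilon>) * ln (ln (sigma_series a r))"
        by blast
      show ?case
      proof (intro exI[of _ "max r1 (max r2 r3)"] allI impI)
        fix r assume "r > max r1 (max r2 r3)" and r: "r \<notin> E"
        hence "r > r1" "r > r2" "r > r3" by auto
        with 1 2 3 r show "(gaussian_sequence M X \<longrightarrow>
           ln (sigma_series a r) \<le> integrated_count r c (random_series a X \<omega>)
             + (3 / 2 + \<epsilon>) * ln (ln (sigma_series a r))) \<and>
        (rademacher_sequence M X \<longrightarrow> log_integrability_constant M C\<^sub>0 \<longrightarrow>
           ln (sigma_series a r) \<le> integrated_count r c (random_series a X \<omega>)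
             + ((exp 1 * C\<^sub>0 / 6) ^ 6 + \<epsilon>) * (ln (ln (sigma_series a r))) ^ 6) \<and>
        (steinhaus_sequence M X \<longrightarrow>
           ln (sigma_series a r) \<le> integrated_count r c (random_series a X \<omega>)
             + (2 + \<epsilon>) * ln (ln (sigma_series a r)))"
          by blast
      qed
    qed
  qed
qed

end
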